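(* Let $\Omega,\Omega'\subset\mathbb{R}^d$ be bounded domains, $\Omega$ having Lipschitz boundary, and let $\mu\in\mathcal P(\Omega)$, $\nu\in\mathcal P(\Omega')$ be absolutely continuous with densities $f,g$ bounded from below by positive constants on $\Omega$, $\Omega'$ respectively. Assume that the class of maps $T\in H^1(\Omega)$ with $T_\#\mu=\nu$ is non-empty. Then the functional $\dfrac{J_\varepsilon-W_1}{\varepsilon}$ $\Gamma$-converges, as $\varepsilon\to0$, to $$\mathcal H:T\mapsto\begin{cases}\displaystyle\int_\Omega|DT(x)|^2\,dx&\text{if }T\in\mathcal O_1(\mu,\nu)\cap H^1(\Omega),\\ +\infty&\text{otherwise,}\end{cases}$$ where $\mathcal H$ is extended by $+\infty$ to the transport plans which are not induced by maps.
   Context: $|\cdot|$ is the Euclidean norm on vectors and matrices. $W_1=\min\{\int_\Omega|T(x)-x|\,d\mu(x):T_\#\mu=\nu\}$ and $\mathcal O_1(\mu,\nu)$ is the set of maps with $T_\#\mu=\nu$ attaining this minimum. Transport plans are probability measures $\gamma$ on $\Omega\times\Omega'$ with marginals $\mu$ and $\nu$; a map $T$ with $T_\#\mu=\nu$ induces the plan $\gamma_T=(\mathrm{id}\times T)_\#\mu$, and functionals on maps are regarded as functionals on plans via $T\mapsto\gamma_T$. For $\varepsilon>0$, $J_\varepsilon(\gamma_T)=J_\varepsilon(T)=\int_\Omega|T(x)-x|\,d\mu(x)+\varepsilon\int_\Omega|DT(x)|^2\,dx$ if $T\in H^1(\Omega)$, $T_\#\mu=\nu$, and $J_\varepsilon(\gamma)=+\infty$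 for all plans not of this form. $\Gamma$-convergence is on the set of transport plans with respect to weak convergence of probability measures (for plans induced by maps, $\gamma_{T_n}\rightharpoonup\gamma_T$ is equivalent to $T_n\to T$ in $L^2_\mu(\Omega)$): $F_\varepsilon$ $\Gamma$-converges to $F$ as $\varepsilon\to0$ if for every sequence $\varepsilon_n\to0^+$ and every $\gamma$: (i) $\liminf_nF_{\varepsilon_n}(\gamma_n)\ge F(\gamma)$ for every $\gamma_n\rightharpoonup\gamma$; (ii) there is $\gamma_n\rightharpoonup\gamma$ with $\limsup_nF_{\varepsilon_n}(\gamma_n)\le F(\gamma)$. *)

theory Defs
  imports "HOL-Probability.Probability"
begin

subsection \<open>Domains with Lipschitz boundary\<close>

text \<open>Near every boundary point, after an orthogonal change of coordinates, the set is the strict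
  epigraph of a Lipschitz function of \<open>d - 1\<close> variables. The unit vector \<open>e\<close> is the direction of
  the last coordinate, and the hyperplane orthogonal to \<open>e\<close> plays the role of \<open>\<real>\<^sup>d\<^sup>-\<^sup>1\<close>.\<close>

definition lipschitz_boundary :: "'a::euclidean_space set \<Rightarrow> bool" where
  "lipschitz_boundary \<Omega> \<longleftrightarrow>
     (\<forall>p\<in>frontier \<Omega>. \<exists>r>0. \<exists>e L \<psi>. norm e = 1 \<and> L-lipschitz_on {y. y \<bullet> e = 0} \<psi> \<and>
        \<Omega> \<inter> ball p r = {x \<in> ball p r. \<psi> (x - (x \<bullet> e) *\<^sub>R e) < x \<bullet> e})"


subsection \<open>The Sobolev space $H^1$\<close>

definition partial_deriv :: "'d \<Rightarrow> (real^'d \<Rightarrow> real) \<Rightarrow> real^'d \<Rightarrow> real" where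
  "partial_deriv i \<phi> x = frechet_derivative \<phi> (at x) (axis i 1)"

primrec C_k :: "nat \<Rightarrow> (real^'d \<Rightarrow> real) \<Rightarrow> bool" where
  "C_k 0 \<phi> \<longleftrightarrow> continuous_on UNIV \<phi>"
| "C_k (Suc k) \<phi> \<longleftrightarrow> (\<forall>x. \<phi> differentiable at x) \<and> (\<forall>i. C_k k (partial_deriv i \<phi>))"

definition test_function :: "(real^'d) set \<Rightarrow> (real^'d \<Rightarrow> real) \<Rightarrow> bool" where
  "test_function \<Omega> \<phi> \<longleftrightarrow>
     (\<forall>k. C_k k \<phi>) \<and> compact (closure {x. \<phi> x \<noteq> 0}) \<and> closure {x. \<phi> x \<noteq> 0} \<subseteq> \<Omega>"

definition L2_on :: "(real^'d) set \<Rightarrow> (real^'d \<Rightarrow> 'b::euclidean_space) \<Rightarrow> bool" where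
  "L2_on \<Omega> u \<longleftrightarrow>
     set_borel_measurable lborel \<Omega> u \<and> set_integrable lborel \<Omega> (\<lambda>x. (norm (u x))\<^sup>2)"

text \<open>Row \<open>j\<close> of \<open>G x\<close> is the weak gradient of the \<open>j\<close>-th component of \<open>T\<close>.\<close>

definition has_weak_deriv ::
    "(real^'d) set \<Rightarrow> (real^'d \<Rightarrow> real^'d) \<Rightarrow> (real^'d \<Rightarrow> real^'d^'d) \<Rightarrow> bool" where
  "has_weak_deriv \<Omega> T G \<longleftrightarrow>
     (\<forall>\<phi>. test_function \<Omega> \<phi> \<longrightarrow>
        (\<forall>i j. (LINT x:\<Omega>|lborel. T x $ j * partial_deriv i \<phi> x)
             = - (LINT x:\<Omega>|lborel. G x $ j $ i * \<phi> x)))"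

definition H1 :: "(real^'d) set \<Rightarrow> (real^'d \<Rightarrow> real^'d) set" where
  "H1 \<Omega> = {T. L2_on \<Omega> T \<and> (\<exists>G. L2_on \<Omega> G \<and> has_weak_deriv \<Omega> T G)}"

text \<open>For \<open>T \<in> H1 \<Omega>\<close> with \<open>\<Omega>\<close> open, \<open>weak_deriv \<Omega> T\<close> is determined up to null sets in \<open>\<Omega>\<close>.\<close>

definition weak_deriv :: "(real^'d) set \<Rightarrow> (real^'d \<Rightarrow> real^'d) \<Rightarrow> real^'d \<Rightarrow> real^'d^'d" where
  "weak_deriv \<Omega> T = (SOME G. L2_on \<Omega> G \<and> has_weak_deriv \<Omega> T G)"

text \<open>The norm of \<^typ>\<open>real^'d^'d\<close> is the Frobenius norm.\<close>

definition dirichlet :: "(real^'d) set \<Rightarrow> (real^'d \<Rightarrow> real^'d) \<Rightarrow> real" where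
  "dirichlet \<Omega> T = (LINT x:\<Omega>|lborel. (norm (weak_deriv \<Omega> T x))\<^sup>2)"


subsection \<open>Transport maps and plans\<close>

text \<open>Probability measures on \<open>\<Omega>\<close> and \<open>\<Omega>'\<close> are measures whose underlying spaces are \<open>\<Omega>\<close> and \<open>\<Omega>'\<close>
  themselves. Hence a transport map sends every point of \<open>\<Omega>\<close> into \<open>\<Omega>'\<close>; a map into \<open>\<real>\<^sup>d\<close> pushing
  \<open>\<mu>\<close> forward to \<open>\<nu>\<close> does so almost everywhere, so each equivalence class has such a
  representative.\<close>

definition transport_maps :: "'a measure \<Rightarrow> 'b measure \<Rightarrow> ('a \<Rightarrow> 'b) set" where
  "transport_maps \<mu> \<nu> = {T \<in> measurable \<mu> \<nu>. distr \<mu> \<nu> T = \<nu>}"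

definition transport_plans :: "'a measure \<Rightarrow> 'b measure \<Rightarrow> ('a \<times> 'b) measure set" where
  "transport_plans \<mu> \<nu> =
     {\<gamma>. prob_space \<gamma> \<and> sets \<gamma> = sets (\<mu> \<Otimes>\<^sub>M \<nu>) \<and> distr \<gamma> \<mu> fst = \<mu> \<and> distr \<gamma> \<nu> snd = \<nu>}"

definition induced_plan ::
    "'a measure \<Rightarrow> 'b measure \<Rightarrow> ('a \<Rightarrow> 'b) \<Rightarrow> ('a \<times> 'b) measure" where
  "induced_plan \<mu> \<nu> T = distr \<mu> (\<mu> \<Otimes>\<^sub>M \<nu>) (\<lambda>x. (x, T x))"

text \<open>A functional on maps as a functional on plans. Maps inducing the same plan agree
  \<open>\<mu>\<close>-almost everywhere, so for functionals insensitive to \<open>\<mu>\<close>-null sets the choice of \<open>T\<close> is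
  immaterial.\<close>

definition on_plans ::
    "'a measure \<Rightarrow> 'b measure \<Rightarrow> (('a \<Rightarrow> 'b) \<Rightarrow> ereal) \<Rightarrow> ('a \<times> 'b) measure \<Rightarrow> ereal" where
  "on_plans \<mu> \<nu> F \<gamma> =
     (if \<exists>T\<in>transport_maps \<mu> \<nu>. \<gamma> = induced_plan \<mu> \<nu> T
      then F (SOME T. T \<in> transport_maps \<mu> \<nu> \<and> \<gamma> = induced_plan \<mu> \<nu> T)
      else \<infinity>)"

definition transport_cost :: "'a::euclidean_space measure \<Rightarrow> ('a \<Rightarrow> 'a) \<Rightarrow> real" where
  "transport_cost \<mu> T = (LINT x|\<mu>. norm (T x - x))"

definition W1 :: "'a::euclidean_space measure \<Rightarrow> 'a measure \<Rightarrow> real" where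
  "W1 \<mu> \<nu> = (INF T\<in>transport_maps \<mu> \<nu>. transport_cost \<mu> T)"

definition O1 :: "'a::euclidean_space measure \<Rightarrow> 'a measure \<Rightarrow> ('a \<Rightarrow> 'a) set" where
  "O1 \<mu> \<nu> = {T \<in> transport_maps \<mu> \<nu>. transport_cost \<mu> T = W1 \<mu> \<nu>}"


subsection \<open>The functionals\<close>

definition J :: "(real^'d) set \<Rightarrow> (real^'d) measure \<Rightarrow> (real^'d) measure \<Rightarrow> real
    \<Rightarrow> (real^'d \<Rightarrow> real^'d) \<Rightarrow> ereal" where
  "J \<Omega> \<mu> \<nu> \<epsilon> T =
     (if T \<in> H1 \<Omega> \<inter> transport_maps \<mu> \<nu>
      then ereal (transport_cost \<mu> T + \<epsilon> * dirichlet \<Omega> T) else \<infinity>)"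

definition H_limit :: "(real^'d) set \<Rightarrow> (real^'d) measure \<Rightarrow> (real^'d) measure
    \<Rightarrow> (real^'d \<Rightarrow> real^'d) \<Rightarrow> ereal" where
  "H_limit \<Omega> \<mu> \<nu> T = (if T \<in> O1 \<mu> \<nu> \<inter> H1 \<Omega> then ereal (dirichlet \<Omega> T) else \<infinity>)"


subsection \<open>Weak convergence and \<open>\<Gamma>\<close>-convergence\<close>

definition weakly_converges ::
    "'a::topological_space set \<Rightarrow> (nat \<Rightarrow> 'a measure) \<Rightarrow> 'a measure \<Rightarrow> bool" where
  "weakly_converges X \<gamma>s \<gamma> \<longleftrightarrow>
     (\<forall>\<phi>::'a \<Rightarrow> real. continuous_on X \<phi> \<and> bounded (\<phi> ` X) \<longrightarrow>
        (\<lambda>n. LINT z|\<gamma>s n. \<phi> z) \<longlonglongrightarrow> (LINT z|\<gamma>. \<phi> z))"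

definition gamma_converges ::
    "'x set \<Rightarrow> ((nat \<Rightarrow> 'x) \<Rightarrow> 'x \<Rightarrow> bool) \<Rightarrow> (real \<Rightarrow> 'x \<Rightarrow> ereal) \<Rightarrow> ('x \<Rightarrow> ereal) \<Rightarrow> bool" where
  "gamma_converges X conv F F0 \<longleftrightarrow>
     (\<forall>\<epsilon>. (\<forall>n. 0 < \<epsilon> n) \<and> \<epsilon> \<longlonglongrightarrow> 0 \<longrightarrow>
        (\<forall>\<gamma>\<in>X.
           (\<forall>\<gamma>s. (\<forall>n. \<gamma>s n \<in> X) \<and> conv \<gamma>s \<gamma> \<longrightarrow> F0 \<gamma> \<le> liminf (\<lambda>n. F (\<epsilon> n) (\<gamma>s n))) \<and>
           (\<exists>\<gamma>s. (\<forall>n. \<gamma>s n \<in> X) \<and> conv \<gamma>s \<gamma> \<and> limsup (\<lambda>n. F (\<epsilon> n) (\<gamma>s n)) \<le> F0 \<gamma>)))"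

end

theory Submission imports Defs begin

text \<open>
  The upper bound is attained by constant sequences: at \<open>T \<in> \<O>\<^sub>1 \<inter> H\<^sup>1\<close> the quotient
  \<open>(J\<^sub>\<epsilon> - W\<^sub>1) / \<epsilon>\<close> is exactly the Dirichlet energy. For the lower bound, finite quotients give
  transport maps \<open>T\<^sub>n\<close> with bounded Dirichlet energy and cost tending to \<open>W\<^sub>1\<close>, and everything rests on
  the strong precompactness of \<open>(T\<^sub>n)\<close>, which makes the weak limit of the plans a plan induced by a map.
  Compactness comes without Poincare inequalities or mollifiers. Testing the weak derivative with
  translates of \<open>bump * polynomial\<close> gives \<open>\<integral> \<chi> w (w(\<cdot> + y) - w) = O(\<bar>y\<bar>)\<close> for a bounded function \<open>w\<close>;
  averaging over small \<open>y\<close> turns the mixed term into a weakly vanishing quantity, so a weakly null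
  sequence with bounded gradients is strongly null on \<open>{\<chi> > 0}\<close>. Weak nullity of the differences
  \<open>T\<^sub>m - T\<^sub>n\<close> is read off the weak convergence of the plans. As the maps are
  uniformly bounded, local convergence suffices. The limit of the gradients is the strong
  limit of almost minimal elements of the convex sets of gradients of maps close to \<open>T\<close>.
\<close>

section \<open>Smooth bump functions and approximation by polynomials\<close>

text \<open>The obstacle is that a weak limit of plans induced by maps need not be carried by a
  graph: oscillating maps split mass in the limit. A gradient bound excludes this. It is available
  because \<open>W1\<close> is the infimum of the cost over the same maps: the excess of the cost
  over \<open>W1\<close> is nonnegative, so a quotient below C bounds the Dirichlet energy by C and
  the excess by C * \<epsilon>. The elementary compactness argument works because the translation
  estimate sees the test function only through its supremum. Polynomials approximating the bounded
  function itself can therefore be inserted, although their derivatives are uncontrolled. Since no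
  limit map is known beforehand, convergence is proved in Cauchy form. Weak convergence of plans
  speaks about \<mu>, weak derivatives about Lebesgue measure. The lower bound on the density of
  \<mu> connects the two: dividing a bounded weight by the density keeps it bounded. Both the weak
  derivative and the map representing a plan are arbitrary choices, so the limit statements are
  shown for every representative.\<close>

definition flat :: "nat \<Rightarrow> real \<Rightarrow> real" where
  "flat n t = (if t > 0 then inverse t ^ n * exp (- inverse t) else 0)"

text \<open>The powers of \<open>inverse t\<close> make the family closed under differentiation up
  to linear combinations, so one formula handles all orders. At 0 the exponential beats every
  power.\<close>

lemma flat_has_derivative:
  "(flat n has_real_derivative flat (n + 2) t - real n * flat (n + 1) t) (at t)"
proof -
  consider "t < 0" | "t > 0" | "t = 0" by linarith
  then show ?thesis
  proof cases
    case 1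
    have "((\<lambda>_. 0::real) has_real_derivative 0) (at t)" by simp
    then have "(flat n has_real_derivative 0) (at t)"
      by (rule has_field_derivative_transform_within_open[of _ _ _ "{..<0}"])
        (use 1 in \<open>auto simp: flat_def\<close>)
    then show ?thesis using 1 by (simp add: flat_def)
  next
    case 2
    have "((\<lambda>t. inverse t ^ n * exp (- inverse t)) has_real_derivative
        inverse t ^ n * (exp (- inverse t) * (inverse t)\<^sup>2) -
          real n * (inverse t ^ (n - 1) * (inverse t)\<^sup>2) * exp (- inverse t)) (at t)"
      using 2 by (auto intro!: derivative_eq_intros simp: power2_eq_square)
    also have "inverse t ^ n * (exp (- inverse t) * (inverse t)\<^sup>2) -
          real n * (inverse t ^ (n - 1) * (inverse t)\<^sup>2) * exp (- inverse t) =
        flat (n + 2) t - real n * flat (n + 1) t"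
      using 2 by (cases n) (simp_all add: flat_def power2_eq_square algebra_simps)
    finally show ?thesis
      by (rule has_field_derivative_transform_within_open[of _ _ _ "{0<..}"])
        (use 2 in \<open>auto simp: flat_def\<close>)
  next
    case 3
    have "((\<lambda>h. flat n h / h) \<longlongrightarrow> 0) (at_left 0)"
      by (rule tendsto_eventually)
        (auto simp: flat_def eventually_at_filter)
    moreover have "((\<lambda>h. flat n h / h) \<longlongrightarrow> 0) (at_right 0)"
    proof -
      \<comment> \<open>With s = 1/h the difference quotient \<open>flat n h / h\<close> becomes a
        power of s over exp s; the extra power comes from the division by h.\<close>
      have "((\<lambda>h. inverse h ^ Suc n / exp (inverse h)) \<longlongrightarrow> (0::real)) (at_right 0)"
        by (rule filterlim_compose[OF tendsto_power_div_exp_0 filterlim_inverse_at_top_right])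
      moreover have "eventually (\<lambda>h::real. inverse h ^ Suc n / exp (inverse h) = flat n h / h) (at_right 0)"
        by (auto simp: flat_def eventually_at_filter exp_minus field_simps)
      ultimately show ?thesis
        by (rule Lim_transform_eventually)
    qed
    ultimately have "((\<lambda>h. flat n h / h) \<longlongrightarrow> 0) (at 0)"
      by (simp add: filterlim_split_at)
    then show ?thesis
      using 3 by (simp add: has_field_derivative_iff flat_def)
  qed
qed

text \<open>A class closed under partial derivatives, so that smoothness of every order is a single induction.\<close>

inductive elem_smooth :: "(real^'d \<Rightarrow> real) \<Rightarrow> bool" where
  const: "elem_smooth (\<lambda>x. c)"
| linear: "bounded_linear l \<Longrightarrow> elem_smooth l"
| flat: "elem_smooth g \<Longrightarrow> elem_smooth (\<lambda>x. flat n (g x))"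
| add: "elem_smooth g \<Longrightarrow> elem_smooth h \<Longrightarrow> elem_smooth (\<lambda>x. g x + h x)"
| mult: "elem_smooth g \<Longrightarrow> elem_smooth h \<Longrightarrow> elem_smooth (\<lambda>x. g x * h x)"

lemma elem_smooth_polynomial:
  "real_polynomial_function p \<Longrightarrow> elem_smooth p"
  by (induction rule: real_polynomial_function.induct) (auto intro: elem_smooth.intros)

lemma vec_eq_sum_axis: "(y::real^'d) = (\<Sum>i\<in>UNIV. y $ i *\<^sub>R axis i 1)"
  by (simp add: vec_eq_iff axis_def if_distrib cong: if_cong)

text \<open>Coefficient functions are quantified existentially instead of being written as
  \<open>partial_deriv\<close>, so that each induction step can exhibit them in closed form;
  evaluating the derivative at basis vectors identifies them afterwards.\<close>

lemma elem_smooth_derivative: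
  "elem_smooth f \<Longrightarrow> \<exists>f'. (\<forall>x. (f has_derivative (\<lambda>y. \<Sum>i\<in>UNIV. y $ i * f' i x)) (at x)) \<and>
     (\<forall>i. elem_smooth (f' i))"
proof (induction rule: elem_smooth.induct)
  case (const c)
  show ?case
    by (rule exI[of _ "\<lambda>i x. 0"]) (auto intro: elem_smooth.intros)
next
  case (linear l)
  have "l y = (\<Sum>i\<in>UNIV. y $ i * l (axis i 1))" for y
  proof -
    interpret bounded_linear l by fact
    have "l y = l (\<Sum>i\<in>UNIV. y $ i *\<^sub>R axis i 1)" using vec_eq_sum_axis[of y] by simp
    then show ?thesis by (simp add: sum scaleR)
  qed
  then have "(\<lambda>y. \<Sum>i\<in>UNIV. y $ i * l (axis i 1)) = l" by (intro ext) (rule sym)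
  then show ?case
    using linear by (intro exI[of _ "\<lambda>i x. l (axis i 1)"])
      (auto intro: elem_smooth.intros bounded_linear_imp_has_derivative)
next
  case (flat g n)
  then obtain g' where g': "\<And>x. (g has_derivative (\<lambda>y. \<Sum>i\<in>UNIV. y $ i * g' i x)) (at x)"
    "\<And>i. elem_smooth (g' i)" by blast
  let ?c = "\<lambda>x. flat (n + 2) (g x) + (- real n) * flat (n + 1) (g x)"
  have "((\<lambda>x. flat n (g x)) has_derivative (\<lambda>y. \<Sum>i\<in>UNIV. y $ i * (?c x * g' i x))) (at x)" for x
  proof -
    have "((\<lambda>x. flat n (g x)) has_derivative
        (\<lambda>y. (flat (n + 2) (g x) - real n * flat (n + 1) (g x)) * (\<Sum>i\<in>UNIV. y $ i * g' i x))) (at x)"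
      using has_derivative_compose[OF g'(1) flat_has_derivative[unfolded has_field_derivative_def]] .
    then show ?thesis by (simp add: sum_distrib_left mult.left_commute)
  qed
  moreover have "elem_smooth (\<lambda>x. ?c x * g' i x)" for i
    using flat g'(2) by (intro elem_smooth.mult elem_smooth.add elem_smooth.flat elem_smooth.const)
  ultimately show ?case by (intro exI[of _ "\<lambda>i x. ?c x * g' i x"]) simp
next
  case (add g h)
  then obtain g' h' where *: "\<And>x. (g has_derivative (\<lambda>y. \<Sum>i\<in>UNIV. y $ i * g' i x)) (at x)"
    "\<And>i. elem_smooth (g' i)" "\<And>x. (h has_derivative (\<lambda>y. \<Sum>i\<in>UNIV. y $ i * h' i x)) (at x)"
    "\<And>i. elem_smooth (h' i)" by blast
  have "((\<lambda>x. g x + h x) has_derivative (\<lambda>y. \<Sum>i\<in>UNIV. y $ i * (g' i x + h' i x))) (at x)" for x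
    using has_derivative_add[OF *(1,3)] by (simp add: distrib_left sum.distrib)
  then show ?case
    using * by (intro exI[of _ "\<lambda>i x. g' i x + h' i x"]) (auto intro: elem_smooth.intros)
next
  case (mult g h)
  then obtain g' h' where *: "\<And>x. (g has_derivative (\<lambda>y. \<Sum>i\<in>UNIV. y $ i * g' i x)) (at x)"
    "\<And>i. elem_smooth (g' i)" "\<And>x. (h has_derivative (\<lambda>y. \<Sum>i\<in>UNIV. y $ i * h' i x)) (at x)"
    "\<And>i. elem_smooth (h' i)" by blast
  have "((\<lambda>x. g x * h x) has_derivative (\<lambda>y. \<Sum>i\<in>UNIV. y $ i * (g x * h' i x + g' i x * h x))) (at x)" for x
    using has_derivative_mult[OF *(1,3)]
    by (simp add: distrib_left sum.distrib sum_distrib_left sum_distrib_right mult_ac)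
  moreover have "elem_smooth (\<lambda>x. g x * h' i x + g' i x * h x)" for i
    using mult *(2,4) by (intro elem_smooth.add elem_smooth.mult)
  ultimately show ?case
    by (intro exI[of _ "\<lambda>i x. g x * h' i x + g' i x * h x"]) simp
qed

lemma elem_smooth_has_derivative:
  assumes "elem_smooth f"
  shows "(f has_derivative (\<lambda>y. \<Sum>i\<in>UNIV. y $ i * partial_deriv i f x)) (at x)"
    and "elem_smooth (partial_deriv i f)"
proof -
  obtain f' where f': "\<And>x. (f has_derivative (\<lambda>y. \<Sum>i\<in>UNIV. y $ i * f' i x)) (at x)"
    "\<And>i. elem_smooth (f' i)" using elem_smooth_derivative[OF assms] by blast
  have eq: "partial_deriv i f = f' i" for i
  proof
    fix x
    have "partial_deriv i f x = (\<Sum>k\<in>UNIV. axis i 1 $ k * f' k x)"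
      unfolding partial_deriv_def frechet_derivative_at[OF f'(1)[of x], symmetric] ..
    also have "\<dots> = f' i x" by (simp add: axis_def if_distrib[of "\<lambda>a. a * _"] cong: if_cong)
    finally show "partial_deriv i f x = f' i x" .
  qed
  show "(f has_derivative (\<lambda>y. \<Sum>i\<in>UNIV. y $ i * partial_deriv i f x)) (at x)"
    unfolding eq by (rule f'(1))
  show "elem_smooth (partial_deriv i f)"
    unfolding eq by (rule f'(2))
qed

lemma elem_smooth_continuous: "elem_smooth f \<Longrightarrow> continuous_on UNIV f"
  by (intro continuous_at_imp_continuous_on ballI has_derivative_continuous[OF elem_smooth_has_derivative(1)])

lemma elem_smooth_C_k: "elem_smooth f \<Longrightarrow> C_k k f"
proof (induction k arbitrary: f)
  case 0
  then show ?case by (simp add: elem_smooth_continuous)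
next
  case (Suc k)
  have "f differentiable (at x)" for x
    using elem_smooth_has_derivative(1)[OF Suc.prems] by (rule differentiableI)
  then show ?case
    using Suc.IH[OF elem_smooth_has_derivative(2)[OF Suc.prems]] by simp
qed

section \<open>Bump functions and the test functions built from them\<close>

definition bump :: "real^'d \<Rightarrow> real \<Rightarrow> real^'d \<Rightarrow> real" where
  "bump c r x = flat 0 (r\<^sup>2 - (norm (x - c))\<^sup>2)"

lemma elem_smooth_bump: "elem_smooth (bump c r)"
proof -
  have p: "real_polynomial_function (\<lambda>x. r\<^sup>2 - (\<Sum>i\<in>UNIV. (x $ i + (- c $ i))\<^sup>2))" for c :: "real^'d"
    by (intro real_polynomial_function_diff real_polynomial_function.intros(3) real_polynomial_function_sum real_polynomial_function_power
        real_polynomial_function.intros(2) real_polynomial_function.intros(1)[OF bounded_linear_vec_nth])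
      simp
  have "bump c r = (\<lambda>x. flat 0 (r\<^sup>2 - (\<Sum>i\<in>UNIV. (x $ i - c $ i)\<^sup>2)))"
    by (simp add: fun_eq_iff bump_def norm_vec_def L2_set_def sum_nonneg)
  then show ?thesis using elem_smooth.flat[OF elem_smooth_polynomial[OF p], of 0 c] by simp
qed

lemma bump_nonneg: "0 \<le> bump c r x" and bump_le_1: "bump c r x \<le> 1"
  by (auto simp: bump_def flat_def)

lemma bump_pos_iff: "0 \<le> r \<Longrightarrow> 0 < bump c r x \<longleftrightarrow> x \<in> ball c r"
proof -
  assume "0 \<le> r"
  then have "(norm (x - c))\<^sup>2 < r\<^sup>2 \<longleftrightarrow> norm (x - c) < r"
    using power_strict_mono power_less_imp_less_base norm_ge_zero by (metis zero_less_numeral)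
  then show ?thesis
    by (simp add: bump_def flat_def dist_norm norm_minus_commute)
qed

lemma bump_eq_0: "0 \<le> r \<Longrightarrow> x \<notin> ball c r \<Longrightarrow> bump c r x = 0"
  using bump_pos_iff[of r c x] bump_nonneg[of c r x] by linarith

lemma bump_translate: "bump c r (x + y) = bump (c - y) r x"
  by (simp add: bump_def algebra_simps)

text \<open>This is the whole supply of test functions used below. It is stable under translation,
  since a shifted bump is a bump about another centre and a shifted polynomial is a
  polynomial.\<close>

lemma bump_times_polynomial:
  assumes "real_polynomial_function p" "0 \<le> r" "cball c r \<subseteq> \<Omega>"
  shows "elem_smooth (\<lambda>x. bump c r x * p x)" "test_function \<Omega> (\<lambda>x. bump c r x * p x)"
proof -
  show *: "elem_smooth (\<lambda>x. bump c r x * p x)"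
    by (intro elem_smooth.mult elem_smooth_bump elem_smooth_polynomial assms)
  have sub: "closure {x. bump c r x * p x \<noteq> 0} \<subseteq> cball c r"
  proof (rule closure_minimal)
    show "{x. bump c r x * p x \<noteq> 0} \<subseteq> cball c r"
    proof
      fix x assume "x \<in> {x. bump c r x * p x \<noteq> 0}"
      then have "x \<in> ball c r" using bump_eq_0[OF assms(2), of x c] by force
      then show "x \<in> cball c r" by simp
    qed
  qed simp
  then have "compact (closure {x. bump c r x * p x \<noteq> 0})"
    by (meson bounded_cball bounded_subset closure_subset compact_closure)
  then show "test_function \<Omega> (\<lambda>x. bump c r x * p x)"
    unfolding test_function_def using sub assms(3) elem_smooth_C_k[OF *] by blast
qed

section \<open>Almost everywhere approximation by continuous functions and polynomials\<close>

lemma borel_measurable_continuous_approx: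
  fixes u :: "'a::euclidean_space \<Rightarrow> real"
  assumes u: "u \<in> borel_measurable borel" and C: "\<And>x. \<bar>u x\<bar> \<le> C"
  obtains g where "\<And>n. continuous_on UNIV (g n)" "\<And>n x. \<bar>g n x\<bar> \<le> C"
    "AE x in lborel. (\<lambda>n. g n x) \<longlonglongrightarrow> u x"
proof -
  \<comment> \<open>Lebesgue measurability is equivalent to \<open>measurable_on\<close>, whose
    definition supplies continuous functions converging off a negligible set.\<close>
  have "u \<in> borel_measurable lebesgue" using u by (intro measurable_completion) simp
  then have "u measurable_on UNIV"
    by (simp add: measurable_on_iff_borel_measurable)
  then obtain N g where g: "negligible N" "\<And>n. continuous_on UNIV (g n)"
    "\<And>x. x \<notin> N \<Longrightarrow> (\<lambda>n. g n x) \<longlonglongrightarrow> u x"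
    unfolding measurable_on_def by auto
  have C0: "0 \<le> C" using C[of undefined] by linarith
  \<comment> \<open>Truncation preserves continuity, does not change the limit because its absolute
    value is at most \<open>C\<close>, and yields the uniform bound needed for dominated
    convergence.\<close>
  let ?g = "\<lambda>n x. max (- C) (min C (g n x))"
  show ?thesis
  proof (rule that[of ?g])
    show "continuous_on UNIV (?g n)" for n
      by (intro continuous_intros g)
    show "\<bar>?g n x\<bar> \<le> C" for n x using C0 by auto
    have "AE x in lebesgue. x \<notin> N"
      using g(1) by (auto simp: negligible_iff_null_sets eventually_ae_filter)
    then have "AE x in lebesgue. (\<lambda>n. ?g n x) \<longlonglongrightarrow> u x"
    proof (rule AE_mp, intro AE_I2 impI)
      fix x assume "x \<notin> N"
      then have "(\<lambda>n. ?g n x) \<longlonglongrightarrow> max (- C) (min C (u x))"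
        by (intro tendsto_intros g)
      then show "(\<lambda>n. ?g n x) \<longlonglongrightarrow> u x" using C[of x] by (simp add: abs_le_iff max_absorb2)
    qed
    then show "AE x in lborel. (\<lambda>n. ?g n x) \<longlonglongrightarrow> u x"
      by (simp add: AE_completion_iff)
  qed
qed

text \<open>Stone-Weierstrass on the compact closure of \<open>S\<close> follows the n-th continuous
  approximant within 1/(n+1). This error is at most 1, whence the bound \<open>C + 1\<close>, which
  is claimed on \<open>S\<close> only.\<close>

lemma borel_measurable_polynomial_approx:
  fixes u :: "'a::euclidean_space \<Rightarrow> real"
  assumes u: "u \<in> borel_measurable borel" and C: "\<And>x. \<bar>u x\<bar> \<le> C" and S: "bounded S"
  obtains p where "\<And>n. real_polynomial_function (p n)" "\<And>n x. x \<in> S \<Longrightarrow> \<bar>p n x\<bar> \<le> C + 1"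
    "AE x in lborel. x \<in> S \<longrightarrow> (\<lambda>n. p n x) \<longlonglongrightarrow> u x"
proof -
  obtain g where g: "\<And>n. continuous_on UNIV (g n)" "\<And>n x. \<bar>g n x\<bar> \<le> C"
    "AE x in lborel. (\<lambda>n. g n x) \<longlonglongrightarrow> u x"
    using borel_measurable_continuous_approx[OF u C] by blast
  have "\<exists>p. real_polynomial_function p \<and> (\<forall>x\<in>closure S. \<bar>g n x - p x\<bar> < inverse (real (Suc n)))" for n
    by (rule Stone_Weierstrass_real_polynomial_function[of "closure S" "g n" "inverse (real (Suc n))"])
      (use S g(1) in \<open>auto simp: compact_closure intro: continuous_on_subset\<close>)
  then obtain p where p: "\<And>n. real_polynomial_function (p n)"
    "\<And>n x. x \<in> closure S \<Longrightarrow> \<bar>g n x - p n x\<bar> < inverse (real (Suc n))" by metis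
  show ?thesis
  proof (rule that[OF p(1)])
    fix n x assume "x \<in> S"
    then have "\<bar>g n x - p n x\<bar> < inverse (real (Suc n))" using p(2) closure_subset by blast
    also have "\<dots> \<le> 1" by (simp add: inverse_le_1_iff)
    finally show "\<bar>p n x\<bar> \<le> C + 1" using g(2)[of n x] by linarith
  next
    show "AE x in lborel. x \<in> S \<longrightarrow> (\<lambda>n. p n x) \<longlonglongrightarrow> u x"
      using g(3)
    proof (rule AE_mp, intro AE_I2 impI)
      fix x assume *: "(\<lambda>n. g n x) \<longlonglongrightarrow> u x" "x \<in> S"
      have "(\<lambda>n. g n x - p n x) \<longlonglongrightarrow> 0"
        by (rule Lim_null_comparison[OF _ LIMSEQ_inverse_real_of_nat])
          (use p(2)[of x] *(2) closure_subset in \<open>force intro!: always_eventually less_imp_le\<close>)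
      from tendsto_diff[OF *(1) this] show "(\<lambda>n. p n x) \<longlonglongrightarrow> u x" by simp
    qed
  qed
qed

section \<open>Translation estimates for weak gradients\<close>

lemma borel_measurable_bump [measurable]: "bump c r \<in> borel_measurable borel"
  by (intro borel_measurable_continuous_onI elem_smooth_continuous elem_smooth_bump)

text \<open>The doubled radius leaves a margin: \<open>ball (c n) (r n)\<close> may be translated by
  up to \<open>r n\<close> without leaving \<Omega>. Lindelof makes the cover countable.\<close>

lemma open_eq_Union_balls:
  fixes \<Omega> :: "'a::euclidean_space set"
  assumes "open \<Omega>" "\<Omega> \<noteq> {}"
  obtains c :: "nat \<Rightarrow> 'a" and r where "\<And>n. 0 < r n" "\<And>n. cball (c n) (2 * r n) \<subseteq> \<Omega>"
    "\<Omega> = (\<Union>n. ball (c n) (r n))"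
proof -
  let ?F = "{ball c r |c r. 0 < r \<and> cball c (2 * r) \<subseteq> \<Omega>}"
  have "\<Union>?F = \<Omega>"
  proof (intro antisym subsetI)
    fix x assume "x \<in> \<Omega>"
    then obtain e where "e > 0" "cball x e \<subseteq> \<Omega>"
      using assms(1) open_contains_cball by blast
    then show "x \<in> \<Union>?F"
      by (intro UnionI[of "ball x (e / 2)"]) (auto intro!: exI[of _ x] exI[of _ "e / 2"])
  next
    fix x assume "x \<in> \<Union>?F"
    then obtain c r where "x \<in> ball c r" "0 < r" "cball c (2 * r) \<subseteq> \<Omega>" by blast
    moreover from this have "x \<in> cball c (2 * r)" by simp
    ultimately show "x \<in> \<Omega>" by blast
  qed
  moreover obtain F' where F': "F' \<subseteq> ?F" "countable F'" "\<Union>F' = \<Union>?F"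
    by (rule Lindelof[of ?F]) auto
  ultimately have ne: "F' \<noteq> {}" and U: "\<Omega> = \<Union>F'" using assms(2) by auto
  have "\<exists>c r. from_nat_into F' n = ball c r \<and> 0 < r \<and> cball c (2 * r) \<subseteq> \<Omega>" for n
    using from_nat_into[OF ne, of n] F'(1) by blast
  then obtain c r where cr: "\<And>n. from_nat_into F' n = ball (c n) (r n)" "\<And>n. 0 < r n"
    "\<And>n. cball (c n) (2 * r n) \<subseteq> \<Omega>" by metis
  have "\<Omega> = (\<Union>n. from_nat_into F' n)"
    using U range_from_nat_into[OF ne F'(2)] by simp
  then show ?thesis using that[of r c] cr by simp
qed

text \<open>The fundamental lemma of the calculus of variations. On each ball, polynomials
  converging to the sign of h are cut off by the bump; in the limit the integral of the bump times
  the absolute value of h vanishes, and the bump is positive on the ball.\<close>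

lemma AE_eq_0_if_test_integrals_eq_0:
  fixes h :: "real^'d \<Rightarrow> real"
  assumes \<Omega>: "open \<Omega>" and h: "set_integrable lborel \<Omega> h"
    and test: "\<And>\<phi>. test_function \<Omega> \<phi> \<Longrightarrow> (LINT x:\<Omega>|lborel. h x * \<phi> x) = 0"
  shows "AE x in lborel. x \<in> \<Omega> \<longrightarrow> h x = 0"
proof (cases "\<Omega> = {}")
  case False
  define h' where "h' x = indicator \<Omega> x * h x" for x
  have h'_int: "integrable lborel h'"
    using h by (simp add: set_integrable_def h'_def[abs_def])
  then have [measurable]: "h' \<in> borel_measurable borel" by simp
  obtain c r where cr: "\<And>n::nat. 0 < r n" "\<And>n. cball (c n) (2 * r n) \<subseteq> \<Omega>"
    "\<Omega> = (\<Union>n. ball (c n) (r n))" by (rule open_eq_Union_balls[OF \<Omega> False]) blast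
  have "AE x in lborel. x \<in> ball (c n) (r n) \<longrightarrow> h x = 0" for n
  proof -
    obtain p where p: "\<And>k. real_polynomial_function (p k)"
      "\<And>k x. x \<in> ball (c n) (r n) \<Longrightarrow> \<bar>p k x\<bar> \<le> 1 + 1"
      "AE x in lborel. x \<in> ball (c n) (r n) \<longrightarrow> (\<lambda>k. p k x) \<longlonglongrightarrow> sgn (h' x)"
      by (rule borel_measurable_polynomial_approx[of "\<lambda>x. sgn (h' x)" 1 "ball (c n) (r n)"])
        (auto simp: abs_sgn_eq)
    let ?b = "bump (c n) (r n)"
    have [measurable]: "p k \<in> borel_measurable borel" for k
      by (intro borel_measurable_continuous_onI elem_smooth_continuous elem_smooth_polynomial p)
    have b0: "?b x = 0" if "x \<notin> ball (c n) (r n)" for x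
      using bump_eq_0[of "r n" x "c n"] that cr(1)[of n] by simp
    have sub: "cball (c n) (r n) \<subseteq> \<Omega>"
      using cr(1)[of n] cr(2)[of n] by (meson subset_cball order.trans mult_le_cancel_right1 less_imp_le one_le_numeral not_le)
    have "(\<lambda>k. LINT x|lborel. h' x * (?b x * p k x)) \<longlonglongrightarrow> (LINT x|lborel. h' x * (?b x * sgn (h' x)))"
    proof (rule integral_dominated_convergence[where w = "\<lambda>x. 2 * \<bar>h' x\<bar>"])
      show "integrable lborel (\<lambda>x. 2 * \<bar>h' x\<bar>)" using h'_int by simp
      show "AE x in lborel. (\<lambda>k. h' x * (?b x * p k x)) \<longlonglongrightarrow> h' x * (?b x * sgn (h' x))"
        using p(3)
      proof (rule AE_mp, intro AE_I2 impI)
        fix x assume *: "x \<in> ball (c n) (r n) \<longrightarrow> (\<lambda>k. p k x) \<longlonglongrightarrow> sgn (h' x)"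
        show "(\<lambda>k. h' x * (?b x * p k x)) \<longlonglongrightarrow> h' x * (?b x * sgn (h' x))"
          using * b0[of x] by (cases "x \<in> ball (c n) (r n)") (auto intro!: tendsto_mult)
      qed
      show "AE x in lborel. norm (h' x * (?b x * p k x)) \<le> 2 * \<bar>h' x\<bar>" for k
      proof (rule AE_I2)
        fix x
        have "\<bar>?b x * p k x\<bar> \<le> 2"
          using b0[of x] p(2)[of x k] bump_nonneg[of "c n" "r n" x] bump_le_1[of "c n" "r n" x]
            mult_mono[of "?b x" 1 "\<bar>p k x\<bar>" 2]
          by (cases "x \<in> ball (c n) (r n)") (auto simp: abs_mult)
        then show "norm (h' x * (?b x * p k x)) \<le> 2 * \<bar>h' x\<bar>"
          using mult_left_mono[of "\<bar>?b x * p k x\<bar>" 2 "\<bar>h' x\<bar>"] by (simp add: abs_mult mult_ac)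
      qed
    qed simp_all
    moreover have "(LINT x|lborel. h' x * (?b x * p k x)) = 0" for k
      using test[OF bump_times_polynomial(2)[OF p(1)[of k] less_imp_le[OF cr(1)[of n]] sub]]
      by (simp add: set_lebesgue_integral_def h'_def mult_ac)
    ultimately have "(LINT x|lborel. h' x * (?b x * sgn (h' x))) = 0"
      by (simp add: LIMSEQ_const_iff)
    moreover have "h' x * (?b x * sgn (h' x)) = ?b x * \<bar>h' x\<bar>" for x
      by (simp add: sgn_if)
    ultimately have int0: "(LINT x|lborel. ?b x * \<bar>h' x\<bar>) = 0"
      by (simp only:)
    have "integrable lborel (\<lambda>x. ?b x * \<bar>h' x\<bar>)"
      using bump_nonneg[of "c n" "r n"] bump_le_1[of "c n" "r n"]
      by (intro Bochner_Integration.integrable_bound[OF h'_int])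
        (auto simp: abs_mult mult_left_le_one_le)
    from integral_nonneg_eq_0_iff_AE[OF this] have "AE x in lborel. ?b x * \<bar>h' x\<bar> = 0"
      using int0 bump_nonneg[of "c n" "r n"] by simp
    then show ?thesis
    proof (rule AE_mp, intro AE_I2 impI)
      fix x assume *: "?b x * \<bar>h' x\<bar> = 0" "x \<in> ball (c n) (r n)"
      then have "h' x = 0" using bump_pos_iff[of "r n" "c n" x] cr(1)[of n] by auto
      moreover have "x \<in> \<Omega>" using * cr(3) by blast
      ultimately show "h x = 0" by (simp add: h'_def)
    qed
  qed
  then have "AE x in lborel. \<forall>n. x \<in> ball (c n) (r n) \<longrightarrow> h x = 0"
    unfolding AE_all_countable by (rule allI)
  then show ?thesis by (rule AE_mp) (use cr(3) in blast)
qed simp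

section \<open>Integrals against translated test functions\<close>

lemma lborel_integral_translate:
  fixes f :: "'a::euclidean_space \<Rightarrow> real"
  assumes [measurable]: "f \<in> borel_measurable borel"
  shows "(LINT x|lborel. f (x + y)) = (LINT x|lborel. f x)"
proof -
  have "(LINT x|lborel. f x) = (LINT x|distr lborel borel ((+) y). f x)"
    by (simp add: lborel_distr_plus)
  also have "\<dots> = (LINT x|lborel. f (y + x))"
    by (subst integral_distr) simp_all
  finally show ?thesis by (simp add: add.commute)
qed

lemma lborel_integrable_translate:
  fixes f :: "'a::euclidean_space \<Rightarrow> real"
  assumes "integrable lborel f"
  shows "integrable lborel (\<lambda>x. f (x + y))"
proof -
  have "integrable (distr lborel borel ((+) y)) f"
    using assms by (simp add: lborel_distr_plus)
  then have "integrable lborel (\<lambda>x. f (y + x))"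
    by (subst (asm) integrable_distr_eq) (use assms in simp_all)
  then show ?thesis by (simp add: add.commute)
qed

lemma partial_deriv_bounded:
  fixes \<phi> :: "real^'d \<Rightarrow> real"
  assumes cont: "continuous_on UNIV (partial_deriv i \<phi>)" and 0: "\<And>x. x \<notin> ball c r \<Longrightarrow> \<phi> x = 0"
  obtains B where "\<And>x. \<bar>partial_deriv i \<phi> x\<bar> \<le> B"
proof -
  have "compact (partial_deriv i \<phi> ` cball c r)"
    by (intro compact_continuous_image continuous_on_subset[OF cont]) auto
  then obtain B where B: "\<And>x. x \<in> cball c r \<Longrightarrow> \<bar>partial_deriv i \<phi> x\<bar> \<le> B"
    by (force dest!: compact_imp_bounded simp: bounded_iff)
  have "partial_deriv i \<phi> x = 0" if "x \<notin> cball c r" for x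
  proof -
    have "((\<lambda>_. 0::real) has_derivative (\<lambda>_. 0)) (at x)" by simp
    then have "(\<phi> has_derivative (\<lambda>_. 0)) (at x)"
      by (rule has_derivative_transform_within_open[of _ _ _ _ "- cball c r"])
        (use that 0 in \<open>auto simp: open_Compl\<close>)
    then show ?thesis by (simp add: partial_deriv_def flip: frechet_derivative_at)
  qed
  then have "\<bar>partial_deriv i \<phi> x\<bar> \<le> max B 0" for x
    using B[of x] by (cases "x \<in> cball c r") auto
  then show ?thesis using that by blast
qed

text \<open>The mean value inequality, with partial derivatives bounded because the support is
  bounded. The constant serves to dominate difference quotients.\<close>

lemma elem_smooth_lipschitz:
  fixes \<phi> :: "real^'d \<Rightarrow> real"
  assumes \<phi>: "elem_smooth \<phi>" and 0: "\<And>x. x \<notin> ball c r \<Longrightarrow> \<phi> x = 0"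
  obtains L where "\<And>x y. \<bar>\<phi> x - \<phi> y\<bar> \<le> L * norm (x - y)"
proof -
  have "\<exists>B. \<forall>x. \<bar>partial_deriv i \<phi> x\<bar> \<le> B" for i
    using partial_deriv_bounded[OF elem_smooth_continuous[OF elem_smooth_has_derivative(2)[OF \<phi>]] 0] by blast
  then obtain B where B: "\<And>i x. \<bar>partial_deriv i \<phi> x\<bar> \<le> B i" by metis
  have "norm (\<phi> x - \<phi> y) \<le> (\<Sum>i\<in>UNIV. B i) * norm (x - y)" for x y
  proof (rule differentiable_bound[of UNIV])
    show "(\<phi> has_derivative (\<lambda>y. \<Sum>i\<in>UNIV. y $ i * partial_deriv i \<phi> x)) (at x within UNIV)" for x
      using elem_smooth_has_derivative(1)[OF \<phi>] by simp
    show "onorm (\<lambda>y. \<Sum>i\<in>UNIV. y $ i * partial_deriv i \<phi> x) \<le> (\<Sum>i\<in>UNIV. B i)" for x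
    proof (rule onorm_le)
      fix y :: "real^'d"
      have "norm (\<Sum>i\<in>UNIV. y $ i * partial_deriv i \<phi> x) \<le> (\<Sum>i\<in>UNIV. norm y * B i)"
        by (rule sum_norm_le) (use B in \<open>auto simp: abs_mult intro!: mult_mono component_le_norm_cart\<close>)
      then show "norm (\<Sum>i\<in>UNIV. y $ i * partial_deriv i \<phi> x) \<le> (\<Sum>i\<in>UNIV. B i) * norm y"
        by (simp add: sum_distrib_left mult.commute)
    qed
  qed auto
  then show ?thesis using that by auto
qed

lemma integrable_mult_bounded:
  fixes f g :: "'a \<Rightarrow> real"
  assumes "integrable M f" "g \<in> borel_measurable M" "\<And>x. \<bar>g x\<bar> \<le> B"
  shows "integrable M (\<lambda>x. f x * g x)"
proof (rule Bochner_Integration.integrable_bound[of _ "\<lambda>x. B * f x"])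
  show "AE x in M. norm (f x * g x) \<le> norm (B * f x)"
  proof (rule AE_I2)
    fix x
    have "\<bar>g x\<bar> \<le> \<bar>B\<bar>" using assms(3)[of x] by linarith
    then show "norm (f x * g x) \<le> norm (B * f x)"
      by (simp add: abs_mult mult.commute[of "\<bar>f x\<bar>"] mult_right_mono)
  qed
qed (use assms in simp_all)

text \<open>Since u is merely integrable, the translation is put on the smooth factor; its
  difference quotients are dominated by a constant multiple of the absolute value of u.\<close>

lemma integral_translate_has_derivative:
  fixes u \<phi> :: "real^'d \<Rightarrow> real"
  assumes u: "integrable lborel u" and \<phi>: "elem_smooth \<phi>" and B: "\<And>x. \<bar>\<phi> x\<bar> \<le> B"
    and L: "\<And>x y. \<bar>\<phi> x - \<phi> y\<bar> \<le> L * norm (x - y)"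
  shows "((\<lambda>s. LINT x|lborel. u x * \<phi> (x - s *\<^sub>R y)) has_real_derivative
    (LINT x|lborel. u x * - (\<Sum>i\<in>UNIV. y $ i * partial_deriv i \<phi> x))) (at 0)"
proof -
  let ?h = "\<lambda>s. LINT x|lborel. u x * \<phi> (x - s *\<^sub>R y)"
  let ?q = "\<lambda>s x. (\<phi> (x - s *\<^sub>R y) - \<phi> x) / s"
  let ?d = "\<lambda>x. - (\<Sum>i\<in>UNIV. y $ i * partial_deriv i \<phi> x)"
  have [measurable]: "\<phi> \<in> borel_measurable borel" "partial_deriv i \<phi> \<in> borel_measurable borel" for i
    by (intro borel_measurable_continuous_onI elem_smooth_continuous \<phi> elem_smooth_has_derivative(2))+
  have [measurable]: "u \<in> borel_measurable borel" using u by simp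
  have int: "integrable lborel (\<lambda>x. u x * \<phi> (x - s *\<^sub>R y))" for s
    by (rule integrable_mult_bounded[OF u _ B]) simp
  have quot: "(?h s - ?h 0) / s = (LINT x|lborel. u x * ?q s x)" for s
  proof -
    have "(?h s - ?h 0) / s = (LINT x|lborel. (u x * \<phi> (x - s *\<^sub>R y) - u x * \<phi> x) / s)"
      using int[of s] int[of 0] by simp
    then show ?thesis by (simp add: algebra_simps)
  qed
  have lim: "((\<lambda>s. ?q s x) \<longlongrightarrow> ?d x) (at 0)" for x
  proof -
    have "((\<lambda>s. x - s *\<^sub>R y) has_derivative (\<lambda>s. - (s *\<^sub>R y))) (at 0)"
      by (auto intro!: derivative_eq_intros)
    moreover have "(\<phi> has_derivative (\<lambda>y. \<Sum>i\<in>UNIV. y $ i * partial_deriv i \<phi> x)) (at (x - 0 *\<^sub>R y))"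
      using elem_smooth_has_derivative(1)[OF \<phi>] by simp
    ultimately have "((\<lambda>s. \<phi> (x - s *\<^sub>R y)) has_derivative
        (\<lambda>s. \<Sum>i\<in>UNIV. (- (s *\<^sub>R y)) $ i * partial_deriv i \<phi> x)) (at 0)"
      by (rule has_derivative_compose)
    moreover have "(\<lambda>s. \<Sum>i\<in>UNIV. (- (s *\<^sub>R y)) $ i * partial_deriv i \<phi> x) = (*) (?d x)"
    proof
      fix s
      have "(\<Sum>i\<in>UNIV. (- (s *\<^sub>R y)) $ i * partial_deriv i \<phi> x) =
          (\<Sum>i\<in>UNIV. (- s) * (y $ i * partial_deriv i \<phi> x))" by (simp add: mult.assoc)
      also have "\<dots> = - s * (\<Sum>i\<in>UNIV. y $ i * partial_deriv i \<phi> x)"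
        by (rule sum_distrib_left[symmetric])
      finally show "(\<Sum>i\<in>UNIV. (- (s *\<^sub>R y)) $ i * partial_deriv i \<phi> x) = ?d x * s"
        by (simp add: mult.commute)
    qed
    ultimately have "((\<lambda>s. \<phi> (x - s *\<^sub>R y)) has_real_derivative ?d x) (at 0)"
      unfolding has_field_derivative_def by simp
    then show ?thesis by (simp add: has_field_derivative_iff)
  qed
  have "(\<lambda>n. LINT x|lborel. u x * ?q (S n) x) \<longlonglongrightarrow> (LINT x|lborel. u x * ?d x)"
    if S: "\<And>n. S n \<noteq> 0" "S \<longlonglongrightarrow> 0" for S :: "nat \<Rightarrow> real"
  proof (rule integral_dominated_convergence[where w = "\<lambda>x. (\<bar>L\<bar> * norm y) * \<bar>u x\<bar>"])
    show "AE x in lborel. (\<lambda>n. u x * ?q (S n) x) \<longlonglongrightarrow> u x * ?d x"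
      using lim S by (intro AE_I2 tendsto_mult tendsto_const) (auto simp: tendsto_at_iff_sequentially comp_def)
    show "AE x in lborel. norm (u x * ?q (S n) x) \<le> (\<bar>L\<bar> * norm y) * \<bar>u x\<bar>" for n
    proof (rule AE_I2)
      fix x
      have "\<bar>\<phi> (x - S n *\<^sub>R y) - \<phi> x\<bar> \<le> L * (\<bar>S n\<bar> * norm y)"
        using L[of "x - S n *\<^sub>R y" x] by simp
      also have "\<dots> \<le> \<bar>L\<bar> * (\<bar>S n\<bar> * norm y)" by (intro mult_right_mono) auto
      finally have "\<bar>?q (S n) x\<bar> \<le> \<bar>L\<bar> * norm y"
        using S(1)[of n] by (simp add: abs_divide divide_le_eq mult_ac)
      then show "norm (u x * ?q (S n) x) \<le> (\<bar>L\<bar> * norm y) * \<bar>u x\<bar>"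
        using mult_left_mono[of "\<bar>?q (S n) x\<bar>" "\<bar>L\<bar> * norm y" "\<bar>u x\<bar>"]
        by (simp only: real_norm_def abs_mult mult.commute)
    qed
  qed (use u in simp_all)
  then have "((\<lambda>s. (?h s - ?h 0) / s) \<longlongrightarrow> (LINT x|lborel. u x * ?d x)) (at 0)"
    unfolding quot by (auto simp: tendsto_at_iff_sequentially comp_def)
  then show ?thesis by (simp add: has_field_derivative_iff)
qed

text \<open>The scalar form of \<open>has_weak_deriv\<close>: compactness is proved for one
  component of a map at a time.\<close>

definition weak_gradient :: "(real^'d) set \<Rightarrow> (real^'d \<Rightarrow> real) \<Rightarrow> (real^'d \<Rightarrow> real^'d) \<Rightarrow> bool" where
  "weak_gradient \<Omega> u H \<longleftrightarrow> (\<forall>\<phi> i. test_function \<Omega> \<phi> \<longrightarrow>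
     (LINT x:\<Omega>|lborel. u x * partial_deriv i \<phi> x) = - (LINT x:\<Omega>|lborel. H x $ i * \<phi> x))"

lemma integrable_bounded_support:
  fixes u :: "'a::euclidean_space \<Rightarrow> real"
  assumes "u \<in> borel_measurable borel" "bounded \<Omega>" "\<And>x. \<bar>u x\<bar> \<le> C" "\<And>x. x \<notin> \<Omega> \<Longrightarrow> u x = 0"
  shows "integrable lborel u"
proof -
  obtain a where "\<And>x. x \<in> \<Omega> \<Longrightarrow> norm x \<le> a" using assms(2) unfolding bounded_iff by blast
  then have a: "\<Omega> \<subseteq> cball 0 a" by auto
  show ?thesis
  proof (rule Bochner_Integration.integrable_bound[of _ "\<lambda>x. C * indicator (cball 0 a) x"])
    show "integrable lborel (\<lambda>x::'a. C * indicator (cball 0 a) x)"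
      by (intro integrable_mult_right integrable_real_indicator) (auto intro: emeasure_bounded_finite[unfolded infinity_ennreal_def])
    have "\<bar>u x\<bar> \<le> \<bar>C * indicator (cball 0 a) x\<bar>" for x
      using assms(3)[of x] assms(4)[of x] a by (cases "x \<in> cball 0 a") (auto simp: subset_iff)
    then show "AE x in lborel. norm (u x) \<le> norm (C * indicator (cball 0 a) x)" by simp
  qed (use assms(1) in simp)
qed

text \<open>Along t in [0, 1], the integral of u against the test function translated by t y has as
  derivative the integral of the inner product of H and y against that translated function. The
  estimate a b \<le> \<open>a\<^sup>2 + b\<^sup>2\<close> bounds this by the stated constant times
  \<open>norm y\<close>. The test function enters through \<open>B\<close> alone, and the margin
  \<open>norm y\<close> keeps all its translates supported in \<Omega>.\<close>

lemma weak_gradient_translation_bound: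
  fixes u :: "real^'d \<Rightarrow> real"
  assumes \<Omega>: "bounded \<Omega>" "open \<Omega>"
    and u: "u \<in> borel_measurable borel" "\<And>x. \<bar>u x\<bar> \<le> C" "\<And>x. x \<notin> \<Omega> \<Longrightarrow> u x = 0"
    and grad: "weak_gradient \<Omega> u H" and H: "L2_on \<Omega> H"
    and p: "real_polynomial_function p" and r: "0 \<le> r" "cball c (r + norm y) \<subseteq> \<Omega>"
    and B: "\<And>x. \<bar>bump c r x * p x\<bar> \<le> B"
  shows "\<bar>LINT x|lborel. (u (x + y) - u x) * (bump c r x * p x)\<bar>
    \<le> ((LINT x:\<Omega>|lborel. (norm (H x))\<^sup>2) + B\<^sup>2 * measure lborel \<Omega>) * norm y"
proof -
  let ?\<phi> = "\<lambda>x. bump c r x * p x"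
  let ?h = "\<lambda>t. LINT x|lborel. u x * ?\<phi> (x - t *\<^sub>R y)"
  let ?K = "(LINT x:\<Omega>|lborel. (norm (H x))\<^sup>2) + B\<^sup>2 * measure lborel \<Omega>"
  have \<phi>: "elem_smooth ?\<phi>" by (intro elem_smooth.mult elem_smooth_bump elem_smooth_polynomial p)
  have [measurable]: "p \<in> borel_measurable borel" "u \<in> borel_measurable borel"
    by (intro borel_measurable_continuous_onI elem_smooth_continuous elem_smooth_polynomial p u)+
  have [measurable]: "\<Omega> \<in> sets borel" using \<Omega> by simp
  define H' where "H' x = indicator \<Omega> x *\<^sub>R H x" for x
  have [measurable]: "H' \<in> borel_measurable borel"
    using H by (simp add: L2_on_def set_borel_measurable_def H'_def[abs_def])
  have norm_H': "(norm (H' x))\<^sup>2 = indicator \<Omega> x * (norm (H x))\<^sup>2" for x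
    by (simp add: H'_def indicator_def)
  have H2: "integrable lborel (\<lambda>x. (norm (H' x))\<^sup>2)"
    using H by (simp add: norm_H' L2_on_def set_integrable_def)
  have fin: "emeasure lborel \<Omega> < \<infinity>" using \<Omega>(1) by (rule emeasure_bounded_finite)
  have u_int: "integrable lborel u" by (rule integrable_bounded_support[OF u(1) \<Omega>(1) u(2,3)])
  have "?\<phi> x = 0" if "x \<notin> ball c r" for x using bump_eq_0[OF r(1) that] by simp
  then obtain L where L: "\<And>x y. \<bar>?\<phi> x - ?\<phi> y\<bar> \<le> L * norm (x - y)"
    using elem_smooth_lipschitz[OF \<phi>, of c r] by blast
  have deriv: "\<exists>D. (?h has_real_derivative D) (at t) \<and> \<bar>D\<bar> \<le> ?K * norm y"
    if t: "0 \<le> t" "t \<le> 1" for t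
  proof -
    let ?\<psi> = "\<lambda>x. ?\<phi> (x - t *\<^sub>R y)"
    \<comment> \<open>The translated test function is again a bump times a polynomial, hence
      admissible for the weak gradient at every t.\<close>
    have \<psi>_eq: "?\<psi> = (\<lambda>x. bump (c + t *\<^sub>R y) r x * p (x - t *\<^sub>R y))"
      using bump_translate[of c r _ "- (t *\<^sub>R y)"] by (simp add: fun_eq_iff)
    have p': "real_polynomial_function (\<lambda>x. p (x - t *\<^sub>R y))"
    proof -
      have "polynomial_function (\<lambda>x. x - t *\<^sub>R y)"
        by (intro polynomial_function_diff polynomial_function_id polynomial_function_const)
      then show ?thesis
        using real_polynomial_function_compose[OF _ p] by (simp add: comp_def)
    qed
    have "cball (c + t *\<^sub>R y) r \<subseteq> \<Omega>"
    proof
      fix x assume "x \<in> cball (c + t *\<^sub>R y) r"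
      then have "dist c x \<le> dist c (c + t *\<^sub>R y) + r"
        using dist_triangle[of c x "c + t *\<^sub>R y"] by simp
      also have "dist c (c + t *\<^sub>R y) \<le> norm y"
        using t by (simp add: dist_norm mult_left_le_one_le)
      finally show "x \<in> \<Omega>" using r(2) by auto
    qed
    note \<psi> = bump_times_polynomial[OF p' r(1) this, folded \<psi>_eq]
    have "((\<lambda>s. LINT x|lborel. u x * ?\<psi> (x - s *\<^sub>R y)) has_real_derivative
        (LINT x|lborel. u x * - (\<Sum>i\<in>UNIV. y $ i * partial_deriv i ?\<psi> x))) (at 0)" (is "(_ has_real_derivative ?D) _")
      by (rule integral_translate_has_derivative[OF u_int \<psi>(1) B])
        (use L[of "_ - t *\<^sub>R y" "_ - t *\<^sub>R y"] in simp)
    moreover have "?h (s + t) = (LINT x|lborel. u x * ?\<psi> (x - s *\<^sub>R y))" for s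
      by (simp add: algebra_simps)
    ultimately have D: "(?h has_real_derivative ?D) (at t)"
      using DERIV_shift[of ?h ?D 0 t] by simp
    have [measurable]: "partial_deriv i ?\<psi> \<in> borel_measurable borel" for i
      by (intro borel_measurable_continuous_onI elem_smooth_continuous elem_smooth_has_derivative(2) \<psi>)
    have bound: "\<bar>H' x \<bullet> v * ?\<psi> x\<bar> \<le> norm v * ((norm (H' x))\<^sup>2 + B\<^sup>2 * indicator \<Omega> x)" for x v
    proof (cases "x \<in> \<Omega>")
      case True
      have "\<bar>H' x \<bullet> v * ?\<psi> x\<bar> \<le> (norm (H' x) * norm v) * B"
        unfolding abs_mult[of "H' x \<bullet> v"] by (intro mult_mono Cauchy_Schwarz_ineq2 B) auto
      also have "\<dots> = norm v * (norm (H' x) * B)" by simp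
      also have "norm (H' x) * B \<le> (norm (H' x))\<^sup>2 + B\<^sup>2"
        using sum_squares_bound[of "norm (H' x)" B] zero_le_power2[of "norm (H' x)"] zero_le_power2[of B]
        by linarith
      finally show ?thesis using True by (simp add: mult_left_mono)
    qed (simp add: H'_def)
    have bnd_int: "integrable lborel (\<lambda>x. (norm (H' x))\<^sup>2 + B\<^sup>2 * indicator \<Omega> x)"
      using H2 fin by (intro Bochner_Integration.integrable_add integrable_mult_right integrable_real_indicator) auto
    have H_int: "integrable lborel (\<lambda>x. H' x \<bullet> v * ?\<psi> x)" for v
    proof (rule Bochner_Integration.integrable_bound)
      show "integrable lborel (\<lambda>x. norm v * ((norm (H' x))\<^sup>2 + B\<^sup>2 * indicator \<Omega> x))"
        using bnd_int by (rule integrable_mult_right)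
      show "AE x in lborel. norm (H' x \<bullet> v * ?\<psi> x)
          \<le> norm (norm v * ((norm (H' x))\<^sup>2 + B\<^sup>2 * indicator \<Omega> x))"
        unfolding real_norm_def by (intro AE_I2 order.trans[OF bound abs_ge_self])
    qed simp
    have ud_int: "integrable lborel (\<lambda>x. u x * partial_deriv i ?\<psi> x)" for i
    proof -
      have "?\<psi> x = 0" if "x \<notin> ball (c + t *\<^sub>R y) r" for x
        using bump_eq_0[OF r(1) that] fun_cong[OF \<psi>_eq, of x] by simp
      then obtain P where "\<And>x. \<bar>partial_deriv i ?\<psi> x\<bar> \<le> P"
        using partial_deriv_bounded[OF elem_smooth_continuous[OF elem_smooth_has_derivative(2)[OF \<psi>(1)]]] by blast
      then show ?thesis by (intro integrable_mult_bounded[OF u_int]) simp_all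
    qed
    have part: "(LINT x|lborel. u x * partial_deriv i ?\<psi> x) = - (LINT x|lborel. H' x \<bullet> axis i 1 * ?\<psi> x)" for i
    proof -
      have "(LINT x|lborel. u x * partial_deriv i ?\<psi> x) = (LINT x:\<Omega>|lborel. u x * partial_deriv i ?\<psi> x)"
        unfolding set_lebesgue_integral_def
        by (intro Bochner_Integration.integral_cong) (auto simp: u(3) indicator_def)
      also have "\<dots> = - (LINT x:\<Omega>|lborel. H x $ i * ?\<psi> x)"
        using grad \<psi>(2) by (simp add: weak_gradient_def)
      also have "(LINT x:\<Omega>|lborel. H x $ i * ?\<psi> x) = (LINT x|lborel. H' x \<bullet> axis i 1 * ?\<psi> x)"
        unfolding set_lebesgue_integral_def
        by (intro Bochner_Integration.integral_cong) (auto simp: H'_def inner_axis)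
      finally show ?thesis .
    qed
    have "?D = (LINT x|lborel. - (\<Sum>i\<in>UNIV. y $ i * (u x * partial_deriv i ?\<psi> x)))"
      by (simp add: sum_distrib_left mult.left_commute)
    also have "\<dots> = - (\<Sum>i\<in>UNIV. y $ i * (LINT x|lborel. u x * partial_deriv i ?\<psi> x))"
      using ud_int by (simp add: Bochner_Integration.integral_sum)
    also have "\<dots> = (\<Sum>i\<in>UNIV. y $ i * (LINT x|lborel. H' x \<bullet> axis i 1 * ?\<psi> x))"
      unfolding part by (simp add: sum_negf)
    also have "\<dots> = (LINT x|lborel. (\<Sum>i\<in>UNIV. y $ i * (H' x \<bullet> axis i 1 * ?\<psi> x)))"
      using H_int by (simp add: Bochner_Integration.integral_sum)
    also have "\<dots> = (LINT x|lborel. H' x \<bullet> y * ?\<psi> x)"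
    proof (intro Bochner_Integration.integral_cong refl)
      fix x
      have "H' x \<bullet> y = (\<Sum>i\<in>UNIV. y $ i * (H' x \<bullet> axis i 1))"
        by (simp add: inner_axis inner_vec_def[of _ y] mult.commute)
      then show "(\<Sum>i\<in>UNIV. y $ i * (H' x \<bullet> axis i 1 * ?\<psi> x)) = H' x \<bullet> y * ?\<psi> x"
        by (simp only: sum_distrib_right mult.assoc)
    qed
    finally have D_eq: "?D = (LINT x|lborel. H' x \<bullet> y * ?\<psi> x)" .
    have "\<bar>?D\<bar> \<le> (LINT x|lborel. norm y * ((norm (H' x))\<^sup>2 + B\<^sup>2 * indicator \<Omega> x))"
      unfolding D_eq
      by (rule integral_abs_bound_integral[OF H_int]) (use bnd_int bound in auto)
    also have "\<dots> = ?K * norm y"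
    proof -
      have "(LINT x|lborel. (norm (H' x))\<^sup>2 + B\<^sup>2 * indicator \<Omega> x) =
          (LINT x|lborel. (norm (H' x))\<^sup>2) + B\<^sup>2 * measure lborel \<Omega>"
        using H2 fin by (subst Bochner_Integration.integral_add) (auto intro!: integrable_mult_right integrable_real_indicator)
      then show ?thesis by (simp add: set_lebesgue_integral_def norm_H' mult.commute)
    qed
    finally show ?thesis using D by blast
  qed
  \<comment> \<open>A derivative is selected for each t so that the mean value inequality on [0, 1]
    can be applied.\<close>
  define D where "D t = (SOME D. (?h has_real_derivative D) (at t) \<and> \<bar>D\<bar> \<le> ?K * norm y)" for t
  have D: "(?h has_real_derivative D t) (at t) \<and> \<bar>D t\<bar> \<le> ?K * norm y" if "0 \<le> t" "t \<le> 1" for t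
    unfolding D_def by (rule someI_ex[OF deriv[OF that]])
  have "norm (?h 1 - ?h 0) \<le> (?K * norm y) * norm (1 - 0 :: real)"
  proof (rule field_differentiable_bound[of "{0..1}" ?h D])
    show "(?h has_real_derivative D t) (at t within {0..1})" if "t \<in> {0..1}" for t
      by (rule has_field_derivative_at_within[OF D[THEN conjunct1]]) (use that in auto)
    show "norm (D t) \<le> ?K * norm y" if "t \<in> {0..1}" for t
      unfolding real_norm_def by (rule D[THEN conjunct2]) (use that in auto)
  qed auto
  \<comment> \<open>At t = 1, translation invariance of Lebesgue measure moves the shift from the
    test function back to u.\<close>
  moreover have "?h 1 - ?h 0 = (LINT x|lborel. (u (x + y) - u x) * ?\<phi> x)"
  proof -
    have "?h 1 = (LINT x|lborel. u (x + y) * ?\<phi> x)"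
      using lborel_integral_translate[of "\<lambda>x. u x * ?\<phi> (x - y)" y] by simp
    moreover have "integrable lborel (\<lambda>x. u (x + y) * ?\<phi> x)" "integrable lborel (\<lambda>x. u x * ?\<phi> x)"
      by (intro integrable_mult_bounded[OF lborel_integrable_translate[OF u_int] _ B]
          integrable_mult_bounded[OF u_int _ B]; simp)+
    ultimately show ?thesis
      by (simp add: left_diff_distrib)
  qed
  ultimately show ?thesis by (simp only: real_norm_def diff_zero abs_one mult_1_right)
qed

section \<open>Local and global compactness\<close>

text \<open>The function u itself is not smooth enough to be a test factor. Polynomials converging
  to it on the ball are bounded there by \<open>C + 1\<close>, so the preceding estimate holds for
  all of them with one constant and passes to the limit.\<close>

lemma weak_gradient_bump_bound:
  fixes u :: "real^'d \<Rightarrow> real"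
  assumes \<Omega>: "bounded \<Omega>" "open \<Omega>"
    and u: "u \<in> borel_measurable borel" "\<And>x. \<bar>u x\<bar> \<le> C" "\<And>x. x \<notin> \<Omega> \<Longrightarrow> u x = 0"
    and grad: "weak_gradient \<Omega> u H" and H: "L2_on \<Omega> H"
    and r: "0 \<le> r" "cball c (r + norm y) \<subseteq> \<Omega>"
  shows "\<bar>LINT x|lborel. (u (x + y) - u x) * (bump c r x * u x)\<bar>
    \<le> ((LINT x:\<Omega>|lborel. (norm (H x))\<^sup>2) + (C + 1)\<^sup>2 * measure lborel \<Omega>) * norm y"
proof -
  have [measurable]: "u \<in> borel_measurable borel" by fact
  have C0: "0 \<le> C" using u(2)[of 0] by linarith
  obtain p where p: "\<And>k::nat. real_polynomial_function (p k)"
    "\<And>k x. x \<in> ball c r \<Longrightarrow> \<bar>p k x\<bar> \<le> C + 1"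
    "AE x in lborel. x \<in> ball c r \<longrightarrow> (\<lambda>k. p k x) \<longlonglongrightarrow> u x"
    using borel_measurable_polynomial_approx[OF u(1,2) bounded_ball] by blast
  have [measurable]: "p k \<in> borel_measurable borel" for k
    by (intro borel_measurable_continuous_onI elem_smooth_continuous elem_smooth_polynomial p)
  have B: "\<bar>bump c r x * p k x\<bar> \<le> C + 1" for k x
  proof (cases "x \<in> ball c r")
    case True
    have "\<bar>bump c r x\<bar> * \<bar>p k x\<bar> \<le> 1 * (C + 1)"
      using bump_nonneg[of c r x] bump_le_1[of c r x] p(2)[OF True, of k] by (intro mult_mono) auto
    then show ?thesis by (simp add: abs_mult)
  next
    case False
    then show ?thesis using C0 bump_eq_0[OF r(1) False] by simp
  qed
  have u_int: "integrable lborel u" by (rule integrable_bounded_support[OF u(1) \<Omega>(1) u(2,3)])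
  have "(\<lambda>k. LINT x|lborel. (u (x + y) - u x) * (bump c r x * p k x))
      \<longlonglongrightarrow> (LINT x|lborel. (u (x + y) - u x) * (bump c r x * u x))"
  proof (rule integral_dominated_convergence[where w = "\<lambda>x. (C + 1) * \<bar>u (x + y) - u x\<bar>"])
    show "integrable lborel (\<lambda>x. (C + 1) * \<bar>u (x + y) - u x\<bar>)"
      by (intro integrable_mult_right integrable_abs Bochner_Integration.integrable_diff
          lborel_integrable_translate u_int)
    show "AE x in lborel. (\<lambda>k. (u (x + y) - u x) * (bump c r x * p k x))
        \<longlonglongrightarrow> (u (x + y) - u x) * (bump c r x * u x)"
      using p(3)
    proof (rule AE_mp, intro AE_I2 impI)
      fix x assume *: "x \<in> ball c r \<longrightarrow> (\<lambda>k. p k x) \<longlonglongrightarrow> u x"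
      show "(\<lambda>k. (u (x + y) - u x) * (bump c r x * p k x)) \<longlonglongrightarrow> (u (x + y) - u x) * (bump c r x * u x)"
        using * bump_eq_0[OF r(1), of x c]
        by (cases "x \<in> ball c r") (auto intro!: tendsto_mult)
    qed
    show "AE x in lborel. norm ((u (x + y) - u x) * (bump c r x * p k x)) \<le> (C + 1) * \<bar>u (x + y) - u x\<bar>" for k
    proof (rule AE_I2)
      fix x
      have "\<bar>u (x + y) - u x\<bar> * \<bar>bump c r x * p k x\<bar> \<le> \<bar>u (x + y) - u x\<bar> * (C + 1)"
        by (intro mult_left_mono B abs_ge_zero)
      then show "norm ((u (x + y) - u x) * (bump c r x * p k x)) \<le> (C + 1) * \<bar>u (x + y) - u x\<bar>"
        by (simp only: real_norm_def abs_mult[of "u (x + y) - u x"] mult.commute[of "C + 1"])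
    qed
  qed simp_all
  then show ?thesis
    using weak_gradient_translation_bound[OF \<Omega> u grad H p(1) r B]
    by (intro LIMSEQ_le_const2[OF tendsto_rabs]) auto
qed

text \<open>For small y, the integral of the bump times the square of \<open>w n\<close> exceeds the
  mixed integral with w n(x) w n(x + y) by at most K times \<open>norm y\<close>. Averaging over y
  in a small ball replaces the shifted factor by a local mean, which tends to 0 pointwise by weak
  nullity; dominated convergence then removes the mixed term.\<close>

lemma weak_gradient_compact_local:
  fixes w :: "nat \<Rightarrow> real^'d \<Rightarrow> real"
  assumes \<Omega>: "bounded \<Omega>" "open \<Omega>"
    and w: "\<And>n. w n \<in> borel_measurable borel" "\<And>n x. \<bar>w n x\<bar> \<le> C" "\<And>n x. x \<notin> \<Omega> \<Longrightarrow> w n x = 0"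
    and grad: "\<And>n. weak_gradient \<Omega> (w n) (H n)"
    and H: "\<And>n. L2_on \<Omega> (H n)" "\<And>n. (LINT x:\<Omega>|lborel. (norm (H n x))\<^sup>2) \<le> M"
    and weak: "\<And>\<psi>. \<psi> \<in> borel_measurable borel \<Longrightarrow> (\<And>x. \<bar>\<psi> x\<bar> \<le> 1) \<Longrightarrow>
      (\<lambda>n. LINT x|lborel. \<psi> x * w n x) \<longlonglongrightarrow> 0"
    and r: "0 < r" "cball c (2 * r) \<subseteq> \<Omega>"
  shows "(\<lambda>n. LINT x|lborel. bump c r x * (w n x)\<^sup>2) \<longlonglongrightarrow> 0"
proof (rule LIMSEQ_I)
  fix e :: real assume e: "e > 0"
  have [measurable]: "w n \<in> borel_measurable borel" for n by (rule w)
  have C0: "0 \<le> C" using w(2)[of 0 0] by linarith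
  define K where "K = M + (C + 1)\<^sup>2 * measure lborel \<Omega>"
  have "0 \<le> (LINT x:\<Omega>|lborel. (norm (H 0 x))\<^sup>2)"
    unfolding set_lebesgue_integral_def by (intro integral_nonneg_AE AE_I2) simp
  then have K0: "0 \<le> K" unfolding K_def using H(2)[of 0] by simp
  \<comment> \<open>The bound \<open>r\<close> keeps the translated balls inside
    \<open>cball c (2 * r)\<close>; the second term makes the translation error at most e/2, with
    \<open>K + 1\<close> avoiding a division by zero.\<close>
  define \<delta> where "\<delta> = min r (e / (2 * (K + 1)))"
  have \<delta>: "0 < \<delta>" "\<delta> \<le> r" "K * \<delta> \<le> e / 2"
  proof -
    show "0 < \<delta>" "\<delta> \<le> r" using r e K0 by (auto simp: \<delta>_def)
    have "K * \<delta> \<le> (K + 1) * (e / (2 * (K + 1)))"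
      using K0 \<open>0 < \<delta>\<close> by (intro mult_mono) (auto simp: \<delta>_def)
    also have "\<dots> = e / 2" using K0 by (simp add: field_simps)
    finally show "K * \<delta> \<le> e / 2" .
  qed
  define B where "B = ball (0::real^'d) \<delta>"
  have [measurable]: "B \<in> sets borel" by (simp add: B_def)
  define V where "V = measure lborel B"
  have V: "0 < V" using \<delta>(1) by (simp add: V_def B_def content_ball_pos)
  have finB: "emeasure lborel B < \<infinity>" unfolding B_def by (intro emeasure_bounded_finite bounded_ball)
  have w_int: "integrable lborel (w n)" for n by (rule integrable_bounded_support[OF w(1) \<Omega>(1) w(2,3)])
  have bw: "\<bar>bump c r x * w n x\<bar> \<le> C" for n x
    using mult_mono[of "bump c r x" 1 "\<bar>w n x\<bar>" C] w(2)[of n x] C0 bump_nonneg[of c r x] bump_le_1[of c r x]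
    by (simp add: abs_mult)
  define I where "I n = (LINT x|lborel. bump c r x * (w n x)\<^sup>2)" for n
  \<comment> \<open>The local mean of \<open>w n\<close> over the ball of radius \<delta> about x,
    multiplied by the volume \<open>V\<close>.\<close>
  define G where "G n x = (LINT y|lborel. indicator B y * w n (x + y))" for n x
  have G_eq: "G n x = (LINT z|lborel. indicator B (z - x) * w n z)" for n x
    using lborel_integral_translate[of "\<lambda>z. indicator B (z - x) * w n z" x] by (simp add: G_def add.commute)
  have [measurable]: "G n \<in> borel_measurable borel" for n
    unfolding G_def[abs_def] by measurable
  \<comment> \<open>For fixed x the indicator of the shifted ball is itself a legitimate weight in
    the weak nullity hypothesis.\<close>
  have G0: "(\<lambda>n. G n x) \<longlonglongrightarrow> 0" for x
    unfolding G_eq by (rule weak) (auto simp: indicator_def)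
  have G_bound: "\<bar>G n x\<bar> \<le> C * V" for n x
  proof -
    have "\<bar>G n x\<bar> \<le> (LINT y|lborel. C * indicator B y)"
      unfolding G_def
    proof (rule integral_abs_bound_integral)
      show "integrable lborel (\<lambda>y. C * indicator B y)"
        using finB by (intro integrable_mult_right integrable_real_indicator) auto
      then show "integrable lborel (\<lambda>y. indicator B y * w n (x + y))"
        by (rule Bochner_Integration.integrable_bound)
          (use w(2)[of n] C0 in \<open>auto intro!: AE_I2 simp: indicator_def\<close>)
    qed (use w(2)[of n] in \<open>auto simp: indicator_def\<close>)
    then show ?thesis using finB by (simp add: V_def)
  qed
  have lim: "(\<lambda>n. LINT x|lborel. bump c r x * w n x * G n x) \<longlonglongrightarrow> (LINT x::real^'d|lborel. 0)"
  proof (rule integral_dominated_convergence[where w = "\<lambda>x. C * (C * V) * indicator \<Omega> x"])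
    show "integrable lborel (\<lambda>x. C * (C * V) * indicator \<Omega> x)"
      using emeasure_bounded_finite[OF \<Omega>(1)] \<Omega>(2) by (intro integrable_mult_right integrable_real_indicator) auto
    show "AE x in lborel. (\<lambda>n. bump c r x * w n x * G n x) \<longlonglongrightarrow> 0"
    proof (rule AE_I2)
      fix x
      have "norm (bump c r x * w n x * G n x) \<le> C * \<bar>G n x\<bar>" for n
        unfolding real_norm_def abs_mult[of "bump c r x * w n x"]
        by (rule mult_right_mono[OF bw abs_ge_zero])
      then have "eventually (\<lambda>n. norm (bump c r x * w n x * G n x) \<le> C * \<bar>G n x\<bar>) sequentially"
        by (intro always_eventually allI)
      moreover have "(\<lambda>n. C * \<bar>G n x\<bar>) \<longlonglongrightarrow> 0"
        by (rule tendsto_mult_right_zero[OF tendsto_rabs_zero[OF G0]])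
      ultimately show "(\<lambda>n. bump c r x * w n x * G n x) \<longlonglongrightarrow> 0"
        by (rule Lim_null_comparison)
    qed
    show "AE x in lborel. norm (bump c r x * w n x * G n x) \<le> C * (C * V) * indicator \<Omega> x" for n
    proof (intro AE_I2)
      fix x
      have "\<bar>bump c r x * w n x\<bar> * \<bar>G n x\<bar> \<le> C * (C * V)"
        by (intro mult_mono bw G_bound C0) auto
      then show "norm (bump c r x * w n x * G n x) \<le> C * (C * V) * indicator \<Omega> x"
        using w(3)[of x n] by (cases "x \<in> \<Omega>") (simp_all add: abs_mult)
    qed
  qed (use \<Omega>(2) in simp_all)
  \<comment> \<open>Joint integrability for Fubini: the integrand is bounded by \<open>C * C\<close>
    and vanishes off the bounded set \<open>ball c r \<times> B\<close>.\<close>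
  have F_int: "integrable (lborel \<Otimes>\<^sub>M lborel) (\<lambda>(x, y). bump c r x * w n x * (indicator B y * w n (x + y)))" for n
  proof (rule Bochner_Integration.integrable_bound[of _ "\<lambda>z. C * C * indicator (ball c r \<times> B) z"])
    have "emeasure (lborel \<Otimes>\<^sub>M lborel) (ball c r \<times> B) < \<infinity>"
      unfolding lborel_prod B_def by (intro emeasure_bounded_finite bounded_Times bounded_ball)
    then show "integrable (lborel \<Otimes>\<^sub>M lborel) (\<lambda>z. C * C * indicator (ball c r \<times> B) z)"
      by (intro integrable_mult_right integrable_real_indicator) auto
    show "AE z in lborel \<Otimes>\<^sub>M lborel. norm (case z of (x, y) \<Rightarrow> bump c r x * w n x * (indicator B y * w n (x + y)))
        \<le> norm (C * C * indicator (ball c r \<times> B) z)"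
    proof (intro AE_I2, clarify)
      fix x y
      have "\<bar>bump c r x * w n x\<bar> * \<bar>w n (x + y)\<bar> \<le> C * C"
        by (intro mult_mono bw w C0) auto
      then show "norm (bump c r x * w n x * (indicator B y * w n (x + y))) \<le> norm (C * C * indicator (ball c r \<times> B) (x, y))"
        using bump_eq_0[of r x c] r(1) C0
        by (cases "x \<in> ball c r"; cases "y \<in> B") (simp_all add: abs_mult)
    qed
  qed simp
  have main: "V * I n \<le> (LINT x|lborel. bump c r x * w n x * G n x) + V * (K * \<delta>)" for n
  proof -
    \<comment> \<open>The indicator makes the translation estimate valid for every y, so that it can
      be integrated over the whole space.\<close>
    have inner: "indicator B y * I n \<le>
        (LINT x|lborel. bump c r x * w n x * (indicator B y * w n (x + y))) + K * \<delta> * indicator B y" for y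
    proof (cases "y \<in> B")
      case True
      then have y: "norm y \<le> \<delta>" by (simp add: B_def)
      then have "cball c (r + norm y) \<subseteq> \<Omega>" using \<delta>(2) r(2) by (intro order.trans[OF subset_cball r(2)]) simp
      from weak_gradient_bump_bound[OF \<Omega> w(1,2,3) grad H(1) _ this]
      have "\<bar>LINT x|lborel. (w n (x + y) - w n x) * (bump c r x * w n x)\<bar>
        \<le> ((LINT x:\<Omega>|lborel. (norm (H n x))\<^sup>2) + (C + 1)\<^sup>2 * measure lborel \<Omega>) * norm y"
        using r(1) by simp
      also have "\<dots> \<le> K * \<delta>"
        using H(2)[of n] y K0 by (intro mult_mono) (auto simp: K_def)
      finally have "\<bar>LINT x|lborel. (w n (x + y) - w n x) * (bump c r x * w n x)\<bar> \<le> K * \<delta>" .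
      moreover have "(LINT x|lborel. (w n (x + y) - w n x) * (bump c r x * w n x)) =
          (LINT x|lborel. w n (x + y) * (bump c r x * w n x)) - (LINT x|lborel. w n x * (bump c r x * w n x))"
        unfolding left_diff_distrib
        by (intro Bochner_Integration.integral_diff integrable_mult_bounded[OF _ _ bw]
            lborel_integrable_translate w_int) simp_all
      ultimately show ?thesis
        using True by (simp add: I_def power2_eq_square mult_ac)
    qed simp
    have "V * I n = (LINT y|lborel. indicator B y * I n)"
      using finB by (simp add: V_def)
    also have "\<dots> \<le> (LINT y|lborel. (LINT x|lborel. bump c r x * w n x * (indicator B y * w n (x + y)))
        + K * \<delta> * indicator B y)"
    proof (rule integral_mono)
      show "integrable lborel (\<lambda>y. indicator B y * I n)"
        using finB by (intro integrable_mult_left integrable_real_indicator) auto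
      show "integrable lborel (\<lambda>y. (LINT x|lborel. bump c r x * w n x * (indicator B y * w n (x + y)))
        + K * \<delta> * indicator B y)"
        using finB lborel_pair.integrable_snd[OF F_int[of n]]
        by (intro Bochner_Integration.integrable_add integrable_mult_right integrable_real_indicator) auto
    qed (rule inner)
    also have "\<dots> = (LINT y|lborel. (LINT x|lborel. bump c r x * w n x * (indicator B y * w n (x + y)))) + K * \<delta> * V"
      using finB lborel_pair.integrable_snd[OF F_int[of n]]
      by (subst Bochner_Integration.integral_add) (auto simp: V_def intro!: integrable_mult_right integrable_real_indicator)
    also have "(LINT y|lborel. (LINT x|lborel. bump c r x * w n x * (indicator B y * w n (x + y)))) =
        (LINT x|lborel. (LINT y|lborel. bump c r x * w n x * (indicator B y * w n (x + y))))"
      using lborel_pair.Fubini_integral[OF F_int[of n]] .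
    also have "\<dots> = (LINT x|lborel. bump c r x * w n x * G n x)"
      by (simp add: G_def)
    finally show ?thesis by (simp add: mult_ac)
  qed
  have "eventually (\<lambda>n. \<bar>LINT x|lborel. bump c r x * w n x * G n x\<bar> < V * (e / 2)) sequentially"
    using order_tendstoD(2)[OF tendsto_rabs[OF lim], of "V * (e / 2)"] V e by simp
  then obtain N where N: "\<And>n. n \<ge> N \<Longrightarrow> \<bar>LINT x|lborel. bump c r x * w n x * G n x\<bar> < V * (e / 2)"
    by (auto simp: eventually_sequentially)
  have "norm (I n - 0) < e" if "n \<ge> N" for n
  proof -
    have "V * I n < V * (e / 2) + V * (K * \<delta>)" using main[of n] N[OF that] by linarith
    also have "\<dots> \<le> V * (e / 2) + V * (e / 2)"
      using \<delta>(3) V by (intro add_left_mono mult_left_mono) auto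
    finally have "I n < e" using V by (simp flip: distrib_left)
    moreover have "0 \<le> I n" unfolding I_def using bump_nonneg[of c r] by (intro integral_nonneg_AE AE_I2) simp
    ultimately show ?thesis by simp
  qed
  then show "\<exists>N. \<forall>n\<ge>N. norm ((LINT x|lborel. bump c r x * (w n x)\<^sup>2) - 0) < e"
    unfolding I_def by blast
qed

text \<open>Local convergence controls the integral wherever finitely many bumps have a sum bounded
  away from 0. The remaining part of \<Omega> has small measure, and there the uniform bound
  \<open>C\<close> suffices. The index m is fixed before n tends to infinity.\<close>

lemma weak_gradient_compact:
  fixes w :: "nat \<Rightarrow> real^'d \<Rightarrow> real"
  assumes \<Omega>: "bounded \<Omega>" "open \<Omega>" "\<Omega> \<noteq> {}"
    and w: "\<And>n. w n \<in> borel_measurable borel" "\<And>n x. \<bar>w n x\<bar> \<le> C" "\<And>n x. x \<notin> \<Omega> \<Longrightarrow> w n x = 0"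
    and grad: "\<And>n. weak_gradient \<Omega> (w n) (H n)"
    and H: "\<And>n. L2_on \<Omega> (H n)" "\<And>n. (LINT x:\<Omega>|lborel. (norm (H n x))\<^sup>2) \<le> M"
    and weak: "\<And>\<psi>. \<psi> \<in> borel_measurable borel \<Longrightarrow> (\<And>x. \<bar>\<psi> x\<bar> \<le> 1) \<Longrightarrow>
      (\<lambda>n. LINT x|lborel. \<psi> x * w n x) \<longlonglongrightarrow> 0"
  shows "(\<lambda>n. LINT x|lborel. (w n x)\<^sup>2) \<longlonglongrightarrow> 0"
proof (rule LIMSEQ_I)
  fix e :: real assume e: "e > 0"
  have [measurable]: "w n \<in> borel_measurable borel" for n by (rule w)
  have [measurable]: "\<Omega> \<in> sets borel" using \<Omega> by simp
  have fin: "emeasure lborel \<Omega> < \<infinity>" using \<Omega>(1) by (rule emeasure_bounded_finite)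
  obtain c r where cr: "\<And>i::nat. 0 < r i" "\<And>i. cball (c i) (2 * r i) \<subseteq> \<Omega>"
    "\<Omega> = (\<Union>i. ball (c i) (r i))" by (rule open_eq_Union_balls[OF \<Omega>(2,3)]) blast
  define W where "W m x = (\<Sum>i<m. bump (c i) (r i) x)" for m :: nat and x
  have W0: "0 \<le> W m x" for m x unfolding W_def by (intro sum_nonneg bump_nonneg)
  have [measurable]: "W m \<in> borel_measurable borel" for m unfolding W_def[abs_def] by measurable
  \<comment> \<open>One index serves both as number of bumps and as inverse threshold. Each point of
    \<Omega> lies in some ball, hence leaves \<open>A m\<close> eventually, and the measures of
    these sets tend to 0.\<close>
  define A where "A m = {x \<in> \<Omega>. real m * W m x < 1}" for m
  have [measurable]: "A m \<in> sets borel" for m unfolding A_def by measurable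
  have A_fin: "integrable lborel (\<lambda>x. indicator (A m) x :: real)" for m
  proof (rule integrable_real_indicator)
    have "emeasure lborel (A m) \<le> emeasure lborel \<Omega>" by (rule emeasure_mono) (auto simp: A_def)
    then show "emeasure lborel (A m) < \<infinity>" using fin by (rule order.strict_trans1)
  qed simp
  have "(\<lambda>m. LINT x|lborel. indicator (A m) x :: real) \<longlonglongrightarrow> (LINT x::real^'d|lborel. 0)"
  proof (rule integral_dominated_convergence[where w = "\<lambda>x. indicator \<Omega> x"])
    show "integrable lborel (\<lambda>x. indicator \<Omega> x :: real)"
      using fin by (intro integrable_real_indicator) auto
    show "AE x in lborel. (\<lambda>m. indicator (A m) x :: real) \<longlonglongrightarrow> 0"
    proof (intro AE_I2 tendsto_eventually)
      fix x
      show "eventually (\<lambda>m. indicator (A m) x = (0::real)) sequentially"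
      proof (cases "x \<in> \<Omega>")
        case True
        then obtain i where i: "x \<in> ball (c i) (r i)" using cr(3) by blast
        then have b: "0 < bump (c i) (r i) x" using bump_pos_iff[of "r i" "c i" x] cr(1)[of i] by simp
        obtain m0 :: nat where m0: "1 < real m0 * bump (c i) (r i) x"
          using ex_less_of_nat_mult[OF b] by blast
        show ?thesis
        proof (rule eventually_sequentiallyI)
          \<comment> \<open>The bound \<open>Suc i\<close> places the bump of index i among the
            summands i < m.\<close>
          fix m assume m: "max m0 (Suc i) \<le> m"
          have "1 < real m0 * bump (c i) (r i) x" by (rule m0)
          also have "\<dots> \<le> real m * W m x"
          proof (rule mult_mono)
            show "bump (c i) (r i) x \<le> W m x"
              unfolding W_def by (rule member_le_sum) (use m bump_nonneg in auto)
          qed (use m bump_nonneg in auto)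
          finally show "indicator (A m) x = (0::real)" by (simp add: A_def)
        qed
      qed (simp add: A_def)
    qed
    show "AE x in lborel. norm (indicator (A m) x :: real) \<le> indicator \<Omega> x" for m
      by (intro AE_I2) (simp add: A_def indicator_def)
  qed simp_all
  then have "(\<lambda>m. C\<^sup>2 * (LINT x|lborel. indicator (A m) x)) \<longlonglongrightarrow> 0"
    by (intro tendsto_mult_right_zero) simp
  from order_tendstoD(2)[OF this, of "e / 2"] e
  obtain m where m: "C\<^sup>2 * (LINT x|lborel. indicator (A m) x) < e / 2"
    by (auto simp: eventually_sequentially)
  have w2_int: "integrable lborel (\<lambda>x. (w n x)\<^sup>2)" for n
    unfolding power2_eq_square
    by (rule integrable_mult_bounded[OF integrable_bounded_support[OF w(1) \<Omega>(1) w(2,3)] w(1)[of n, folded measurable_lborel2] w(2)])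
  have bw_int: "integrable lborel (\<lambda>x. bump (c i) (r i) x * (w n x)\<^sup>2)" for i n
    using integrable_mult_bounded[OF w2_int, of "bump (c i) (r i)" 1] bump_nonneg[of "c i" "r i"] bump_le_1[of "c i" "r i"]
    by (simp add: mult.commute)
  have Ww_int: "integrable lborel (\<lambda>x. W m x * (w n x)\<^sup>2)" for n
    unfolding W_def sum_distrib_right by (intro Bochner_Integration.integrable_sum bw_int)
  have "(\<lambda>n. LINT x|lborel. W m x * (w n x)\<^sup>2) \<longlonglongrightarrow> 0"
  proof -
    have "(\<lambda>n. \<Sum>i<m. LINT x|lborel. bump (c i) (r i) x * (w n x)\<^sup>2) \<longlonglongrightarrow> (\<Sum>i<m. 0)"
      by (intro tendsto_sum weak_gradient_compact_local[OF \<Omega>(1,2) w grad H weak cr(1,2)])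
    then show ?thesis
      unfolding W_def sum_distrib_right using bw_int by (simp add: Bochner_Integration.integral_sum)
  qed
  then have "(\<lambda>n. real m * (LINT x|lborel. W m x * (w n x)\<^sup>2)) \<longlonglongrightarrow> 0"
    by (rule tendsto_mult_right_zero)
  from order_tendstoD(2)[OF this, of "e / 2"] e
  obtain N where N: "\<And>n. n \<ge> N \<Longrightarrow> real m * (LINT x|lborel. W m x * (w n x)\<^sup>2) < e / 2"
    by (auto simp: eventually_sequentially)
  have "norm ((LINT x|lborel. (w n x)\<^sup>2) - 0) < e" if n: "n \<ge> N" for n
  proof -
    have pw: "(w n x)\<^sup>2 \<le> real m * (W m x * (w n x)\<^sup>2) + C\<^sup>2 * indicator (A m) x" for x
    proof (cases "x \<in> A m")
      case True
      have "(w n x)\<^sup>2 \<le> C\<^sup>2" using w(2)[of n x] by (rule abs_le_square_iff[THEN iffD1, OF order.trans]) simp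
      then show ?thesis using True W0[of m x] by (simp add: add_increasing)
    next
      case False
      then have "w n x = 0 \<or> 1 \<le> real m * W m x" using w(3)[of x n] by (auto simp: A_def)
      then show ?thesis
      proof
        assume "1 \<le> real m * W m x"
        from mult_right_mono[OF this, of "(w n x)\<^sup>2"] show ?thesis using False by (simp add: mult.assoc)
      qed (use False in simp)
    qed
    have "(LINT x|lborel. (w n x)\<^sup>2) \<le> (LINT x|lborel. real m * (W m x * (w n x)\<^sup>2) + C\<^sup>2 * indicator (A m) x)"
      by (intro integral_mono w2_int Bochner_Integration.integrable_add integrable_mult_right Ww_int A_fin pw)
    also have "\<dots> = real m * (LINT x|lborel. W m x * (w n x)\<^sup>2) + C\<^sup>2 * (LINT x|lborel. indicator (A m) x)"
      by (subst Bochner_Integration.integral_add[OF integrable_mult_right[OF Ww_int] integrable_mult_right[OF A_fin]]) simp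
    also have "\<dots> < e" using N[OF n] m by linarith
    finally have "(LINT x|lborel. (w n x)\<^sup>2) < e" .
    moreover have "0 \<le> (LINT x|lborel. (w n x)\<^sup>2)" by (intro integral_nonneg_AE AE_I2) simp
    ultimately show ?thesis by simp
  qed
  then show "\<exists>N. \<forall>n\<ge>N. norm ((LINT x|lborel. (w n x)\<^sup>2) - 0) < e" by blast
qed

section \<open>Compactness and lower semicontinuity in $L^2$\<close>

text \<open>Fatou's lemma. A bound that holds only eventually serves tails of Cauchy sequences; the
  moving bound \<open>c n\<close> serves almost minimal gradients.\<close>

lemma integral_norm2_le_limit:
  fixes u :: "nat \<Rightarrow> 'a \<Rightarrow> 'b::euclidean_space"
  assumes [measurable]: "\<And>n. u n \<in> borel_measurable M" "v \<in> borel_measurable M"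
    and lim: "AE x in M. (\<lambda>n. u n x) \<longlonglongrightarrow> v x"
    and int: "\<And>n. integrable M (\<lambda>x. (norm (u n x))\<^sup>2)"
    and le: "eventually (\<lambda>n. (LINT x|M. (norm (u n x))\<^sup>2) \<le> c n) sequentially" and c: "c \<longlonglongrightarrow> c0"
  shows "integrable M (\<lambda>x. (norm (v x))\<^sup>2)" "(LINT x|M. (norm (v x))\<^sup>2) \<le> c0"
proof -
  have c0: "0 \<le> c0"
  proof (rule tendsto_lowerbound[OF c])
    show "eventually (\<lambda>n. 0 \<le> c n) sequentially"
      using le by eventually_elim (rule order.trans[OF integral_nonneg_AE[OF AE_I2]], auto)
  qed simp
  have "(\<integral>\<^sup>+x. ennreal ((norm (v x))\<^sup>2) \<partial>M) = (\<integral>\<^sup>+x. liminf (\<lambda>n. ennreal ((norm (u n x))\<^sup>2)) \<partial>M)"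
  proof (rule nn_integral_cong_AE, use lim in eventually_elim)
    case (elim x)
    then have "(\<lambda>n. ennreal ((norm (u n x))\<^sup>2)) \<longlonglongrightarrow> ennreal ((norm (v x))\<^sup>2)"
      by (intro tendsto_ennrealI tendsto_intros)
    then show ?case by (rule lim_imp_Liminf[OF trivial_limit_sequentially, symmetric])
  qed
  also have "\<dots> \<le> liminf (\<lambda>n. \<integral>\<^sup>+x. ennreal ((norm (u n x))\<^sup>2) \<partial>M)"
    by (rule nn_integral_liminf) simp
  also have "\<dots> = liminf (\<lambda>n. ennreal (LINT x|M. (norm (u n x))\<^sup>2))"
    using int by (simp add: nn_integral_eq_integral)
  also have "\<dots> \<le> liminf (\<lambda>n. ennreal (c n))"
    by (rule Liminf_mono) (use le in \<open>auto elim: eventually_mono intro: ennreal_leI\<close>)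
  also have "\<dots> = ennreal c0"
    using c by (intro lim_imp_Liminf tendsto_ennrealI) auto
  finally have *: "(\<integral>\<^sup>+x. ennreal ((norm (v x))\<^sup>2) \<partial>M) \<le> ennreal c0" .
  then show int_v: "integrable M (\<lambda>x. (norm (v x))\<^sup>2)"
    by (intro integrableI_bounded) (auto simp: order.strict_trans1[OF _ ennreal_less_top])
  show "(LINT x|M. (norm (v x))\<^sup>2) \<le> c0"
    using * c0 nn_integral_eq_integral[OF int_v] by simp
qed

text \<open>By the parallelogram identity, twice the sum of the two given squares dominates either
  square.\<close>

lemma integrable_norm2_diff:
  fixes u v :: "'a \<Rightarrow> 'b::euclidean_space"
  assumes [measurable]: "u \<in> borel_measurable M" "v \<in> borel_measurable M"
    and int: "integrable M (\<lambda>x. (norm (u x))\<^sup>2)" "integrable M (\<lambda>x. (norm (v x))\<^sup>2)"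
  shows "integrable M (\<lambda>x. (norm (u x - v x))\<^sup>2)" "integrable M (\<lambda>x. (norm (u x + v x))\<^sup>2)"
proof -
  have *: "(norm (u x - v x))\<^sup>2 + (norm (u x + v x))\<^sup>2 = 2 * ((norm (u x))\<^sup>2 + (norm (v x))\<^sup>2)" for x
    by (simp add: power2_norm_eq_inner algebra_simps inner_commute)
  have bound: "integrable M (\<lambda>x. 2 * ((norm (u x))\<^sup>2 + (norm (v x))\<^sup>2))"
    using int by simp
  have le: "norm ((norm (u x - v x))\<^sup>2) \<le> norm (2 * ((norm (u x))\<^sup>2 + (norm (v x))\<^sup>2))"
    "norm ((norm (u x + v x))\<^sup>2) \<le> norm (2 * ((norm (u x))\<^sup>2 + (norm (v x))\<^sup>2))" for x
    unfolding *[symmetric] by simp_all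
  show "integrable M (\<lambda>x. (norm (u x - v x))\<^sup>2)"
    by (rule Bochner_Integration.integrable_bound[OF bound _ AE_I2[OF le(1)]]) simp
  show "integrable M (\<lambda>x. (norm (u x + v x))\<^sup>2)"
    by (rule Bochner_Integration.integrable_bound[OF bound _ AE_I2[OF le(2)]]) simp
qed

text \<open>From the pointwise bound t \<le> \<delta> + t * t / \<delta>, seen by comparing t with
  \<delta>. The free parameter does the work of the Cauchy-Schwarz inequality.\<close>

lemma (in finite_measure) norm_integral_le_norm2:
  fixes u :: "'a \<Rightarrow> 'b::euclidean_space"
  assumes [measurable]: "u \<in> borel_measurable M" and int: "integrable M (\<lambda>x. (norm (u x))\<^sup>2)" and \<delta>: "0 < \<delta>"
  shows "integrable M (\<lambda>x. norm (u x))"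
    "(LINT x|M. norm (u x)) \<le> \<delta> * measure M (space M) + (LINT x|M. (norm (u x))\<^sup>2) / \<delta>"
proof -
  have *: "norm (u x) \<le> \<delta> + (norm (u x))\<^sup>2 / \<delta>" for x
  proof (cases "norm (u x) \<le> \<delta>")
    case False
    then have "norm (u x) * \<delta> \<le> norm (u x) * norm (u x)" by (intro mult_left_mono) auto
    then have "norm (u x) \<le> (norm (u x))\<^sup>2 / \<delta>" using \<delta> by (simp add: power2_eq_square pos_le_divide_eq)
    then show ?thesis using \<delta> by linarith
  qed (use \<delta> in \<open>simp add: add_increasing2\<close>)
  have bound: "integrable M (\<lambda>x. \<delta> + (norm (u x))\<^sup>2 / \<delta>)" using int by simp
  show int1: "integrable M (\<lambda>x. norm (u x))"
    by (rule Bochner_Integration.integrable_bound[OF bound]) (use * in \<open>auto intro: order.trans[OF _ abs_ge_self]\<close>)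
  have "(LINT x|M. norm (u x)) \<le> (LINT x|M. \<delta> + (norm (u x))\<^sup>2 / \<delta>)"
    by (intro integral_mono int1 bound *)
  also have "\<dots> = \<delta> * measure M (space M) + (LINT x|M. (norm (u x))\<^sup>2) / \<delta>"
    using int by simp
  finally show "(LINT x|M. norm (u x)) \<le> \<delta> * measure M (space M) + (LINT x|M. (norm (u x))\<^sup>2) / \<delta>" .
qed

lemma (in finite_measure) tendsto_L1_if_tendsto_L2:
  fixes u :: "nat \<Rightarrow> 'a \<Rightarrow> 'b::euclidean_space"
  assumes [measurable]: "\<And>n. u n \<in> borel_measurable M" and int: "\<And>n. integrable M (\<lambda>x. (norm (u n x))\<^sup>2)"
    and lim: "(\<lambda>n. LINT x|M. (norm (u n x))\<^sup>2) \<longlonglongrightarrow> 0"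
  shows "(\<lambda>n. LINT x|M. norm (u n x)) \<longlonglongrightarrow> 0"
proof (rule LIMSEQ_I)
  fix e :: real assume e: "0 < e"
  \<comment> \<open>Chosen before n, so that the mass term is at most e/2; adding 1 covers the zero
    measure.\<close>
  define \<delta> where "\<delta> = (e / 2) / (measure M (space M) + 1)"
  have m: "0 < measure M (space M) + 1" by (simp add: add_nonneg_pos)
  then have \<delta>: "0 < \<delta>" using e by (simp add: \<delta>_def)
  have "\<delta> * measure M (space M) \<le> \<delta> * (measure M (space M) + 1)" using \<delta> by simp
  also have "\<dots> = e / 2"
    unfolding \<delta>_def by (rule nonzero_eq_divide_eq[THEN iffD1, OF _ refl]) (use m in simp)
  finally have small: "\<delta> * measure M (space M) \<le> e / 2" .
  from order_tendstoD(2)[OF lim, of "\<delta> * (e / 2)"] \<delta> e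
  obtain N where N: "\<And>n. n \<ge> N \<Longrightarrow> (LINT x|M. (norm (u n x))\<^sup>2) < \<delta> * (e / 2)"
    by (auto simp: eventually_sequentially)
  have "norm ((LINT x|M. norm (u n x)) - 0) < e" if "n \<ge> N" for n
  proof -
    have "(LINT x|M. (norm (u n x))\<^sup>2) / \<delta> < e / 2"
      using N[OF that] \<delta> by (simp add: pos_divide_less_eq mult.commute)
    then have "(LINT x|M. norm (u n x)) < e"
      using norm_integral_le_norm2(2)[OF assms(1) int \<delta>, of n] small by linarith
    moreover have "0 \<le> (LINT x|M. norm (u n x))" by simp
    ultimately show ?thesis by simp
  qed
  then show "\<exists>N. \<forall>n\<ge>N. norm ((LINT x|M. norm (u n x)) - 0) < e" by blast
qed

text \<open>Riesz-Fischer: along a rapidly convergent subsequence the increments have summable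
  integrals, hence are summable almost everywhere.\<close>

lemma (in finite_measure) L2_Cauchy_convergent:
  fixes u :: "nat \<Rightarrow> 'a \<Rightarrow> 'b::euclidean_space"
  assumes meas: "\<And>n. u n \<in> borel_measurable M" and int: "\<And>n. integrable M (\<lambda>x. (norm (u n x))\<^sup>2)"
    and Cauchy: "\<And>e. 0 < e \<Longrightarrow> \<exists>N. \<forall>m\<ge>N. \<forall>n\<ge>N. (LINT x|M. (norm (u m x - u n x))\<^sup>2) < e"
  obtains v r where "strict_mono (r :: nat \<Rightarrow> nat)" "v \<in> borel_measurable M"
    "AE x in M. (\<lambda>n. u (r n) x) \<longlonglongrightarrow> v x" "integrable M (\<lambda>x. (norm (v x))\<^sup>2)"
    "(\<lambda>n. LINT x|M. (norm (u (r n) x - v x))\<^sup>2) \<longlonglongrightarrow> 0"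
proof -
  have "\<exists>r. \<forall>n. (\<forall>m\<ge>r n. \<forall>k\<ge>r n. (LINT x|M. (norm (u m x - u k x))\<^sup>2) < (1/4)^n) \<and> r n < r (Suc n)"
  proof (rule dependent_nat_choice)
    show "\<exists>N. \<forall>m\<ge>N. \<forall>k\<ge>N. (LINT x|M. (norm (u m x - u k x))\<^sup>2) < (1/4)^0"
      by (rule Cauchy) simp
    fix N n
    obtain N' where N': "\<forall>m\<ge>N'. \<forall>k\<ge>N'. (LINT x|M. (norm (u m x - u k x))\<^sup>2) < (1/4)^Suc n"
      using Cauchy[of "(1/4)^Suc n"] by auto
    show "\<exists>y. (\<forall>m\<ge>y. \<forall>k\<ge>y. (LINT x|M. (norm (u m x - u k x))\<^sup>2) < (1/4)^Suc n) \<and> N < y"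
      using N' by (intro exI[of _ "max N' (Suc N)"]) auto
  qed
  then obtain r where r: "\<And>n m k. m \<ge> r n \<Longrightarrow> k \<ge> r n \<Longrightarrow> (LINT x|M. (norm (u m x - u k x))\<^sup>2) < (1/4)^n"
    and r_Suc: "\<And>n. r n < r (Suc n)" by blast
  have mono: "strict_mono r" using r_Suc by (simp add: strict_mono_Suc_iff)
  define f where "f n = u (r n)" for n
  have [measurable]: "f n \<in> borel_measurable M" for n unfolding f_def by (rule meas)
  have f_int: "integrable M (\<lambda>x. (norm (f n x))\<^sup>2)" for n unfolding f_def by (rule int)
  have f_diff: "integrable M (\<lambda>x. (norm (f m x - f n x))\<^sup>2)" for m n
    by (intro integrable_norm2_diff f_int) simp_all
  have f_le: "(LINT x|M. (norm (f m x - f n x))\<^sup>2) \<le> (1/4)^m" if "m \<le> n" for m n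
    unfolding f_def by (rule less_imp_le, rule r) (use mono that in \<open>auto simp: strict_mono_less_eq\<close>)
  let ?K = "measure M (space M) + 1"
  \<comment> \<open>Taking \<delta> as the n-th power of 1/2 balances the two terms, since the
    squared increments are below the n-th power of 1/4.\<close>
  have L1: "(LINT x|M. norm (f (Suc n) x - f n x)) \<le> ?K * (1/2)^n" for n
  proof -
    have "(LINT x|M. norm (f n x - f (Suc n) x)) \<le>
        (1/2)^n * measure M (space M) + (LINT x|M. (norm (f n x - f (Suc n) x))\<^sup>2) / (1/2)^n"
      by (intro norm_integral_le_norm2 f_diff) auto
    also have "(LINT x|M. (norm (f n x - f (Suc n) x))\<^sup>2) / (1/2)^n \<le> (1/4)^n / (1/2)^n"
      by (intro divide_right_mono f_le) auto
    also have "(1/4)^n / (1/2)^n = ((1/2)^n :: real)"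
      by (simp flip: power_divide)
    finally show ?thesis by (simp add: norm_minus_commute algebra_simps)
  qed
  have diff_int: "integrable M (\<lambda>x. norm (f (Suc n) x - f n x))" for n
    by (rule norm_integral_le_norm2(1)[OF _ f_diff zero_less_one]) simp
  have "(\<integral>\<^sup>+x. (\<Sum>n. ennreal (norm (f (Suc n) x - f n x))) \<partial>M) =
      (\<Sum>n. \<integral>\<^sup>+x. ennreal (norm (f (Suc n) x - f n x)) \<partial>M)"
    by (rule nn_integral_suminf) simp
  also have "\<dots> = (\<Sum>n. ennreal (LINT x|M. norm (f (Suc n) x - f n x)))"
    using diff_int by (simp add: nn_integral_eq_integral)
  also have "\<dots> \<le> (\<Sum>n. ennreal (?K * (1/2)^n))"
    by (intro suminf_le ennreal_leI L1) auto
  also have "\<dots> = ennreal (\<Sum>n. ?K * (1/2)^n)"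
    by (intro suminf_ennreal2 summable_mult summable_geometric) auto
  also have "\<dots> < \<infinity>" by simp
  finally have "AE x in M. (\<Sum>n. ennreal (norm (f (Suc n) x - f n x))) \<noteq> \<infinity>"
    by (intro nn_integral_PInf_AE) auto
  then have conv: "AE x in M. convergent (\<lambda>n. f n x)"
  proof eventually_elim
    case (elim x)
    then have "summable (\<lambda>n. norm (f (Suc n) x - f n x))"
      by (intro summable_suminf_not_top) auto
    then have "summable (\<lambda>n. f (Suc n) x - f n x)" by (rule summable_norm_cancel)
    then have "convergent (\<lambda>n. f n x - f 0 x)"
      by (simp add: summable_iff_convergent sum_lessThan_telescope[of "\<lambda>n. f n x"])
    from convergent_add[OF this convergent_const[of "f 0 x"]] show "convergent (\<lambda>n. f n x)" by simp
  qed
  define v where "v x = lim (\<lambda>n. f n x)" for x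
  have [measurable]: "v \<in> borel_measurable M" unfolding v_def by (intro borel_measurable_lim_metric) simp
  have lim: "AE x in M. (\<lambda>n. f n x) \<longlonglongrightarrow> v x"
    using conv by eventually_elim (simp add: v_def convergent_LIMSEQ_iff)
  \<comment> \<open>Fatou with m fixed turns the Cauchy estimate into an estimate for the distance
    to v.\<close>
  have *: "integrable M (\<lambda>x. (norm (f m x - v x))\<^sup>2)" "(LINT x|M. (norm (f m x - v x))\<^sup>2) \<le> (1/4)^m" for m
  proof -
    have lim_m: "AE x in M. (\<lambda>n. f m x - f n x) \<longlonglongrightarrow> f m x - v x"
      using lim by eventually_elim (intro tendsto_intros)
    have ev: "eventually (\<lambda>n. (LINT x|M. (norm (f m x - f n x))\<^sup>2) \<le> (1/4)^m) sequentially"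
      by (rule eventually_sequentiallyI[of m]) (rule f_le)
    show "integrable M (\<lambda>x. (norm (f m x - v x))\<^sup>2)" "(LINT x|M. (norm (f m x - v x))\<^sup>2) \<le> (1/4)^m"
      by (rule integral_norm2_le_limit[OF _ _ lim_m f_diff ev tendsto_const]; simp)+
  qed
  show ?thesis
  proof (rule that[of r v])
    show "AE x in M. (\<lambda>n. u (r n) x) \<longlonglongrightarrow> v x" using lim by (simp add: f_def)
    have "integrable M (\<lambda>x. (norm (f 0 x - (f 0 x - v x)))\<^sup>2)"
      by (rule integrable_norm2_diff[OF _ _ f_int *(1)]) simp_all
    then show "integrable M (\<lambda>x. (norm (v x))\<^sup>2)" by simp
    have "(\<lambda>m. LINT x|M. (norm (f m x - v x))\<^sup>2) \<longlonglongrightarrow> 0"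
      by (rule tendsto_sandwich[OF _ _ tendsto_const LIMSEQ_realpow_zero[of "1/4"]])
        (use * in \<open>auto intro!: always_eventually\<close>)
    then show "(\<lambda>n. LINT x|M. (norm (u (r n) x - v x))\<^sup>2) \<longlonglongrightarrow> 0" by (simp add: f_def)
  qed (use mono in simp_all)
qed

section \<open>Weak derivatives: convexity, closedness, compactness, uniqueness\<close>

lemma test_function_bounded:
  fixes \<phi> :: "real^'d \<Rightarrow> real"
  assumes "test_function \<Omega> \<phi>"
  shows "\<phi> \<in> borel_measurable borel" "partial_deriv i \<phi> \<in> borel_measurable borel"
    "\<exists>B. \<forall>x. \<bar>\<phi> x\<bar> \<le> B" "\<exists>B. \<forall>x. \<bar>partial_deriv i \<phi> x\<bar> \<le> B"
proof -
  have C: "C_k k \<phi>" for k using assms by (simp add: test_function_def)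
  have \<phi>: "continuous_on UNIV \<phi>" using C[of 0] by simp
  have d\<phi>: "continuous_on UNIV (partial_deriv i \<phi>)" using C[of "Suc 0"] by simp
  show "\<phi> \<in> borel_measurable borel" "partial_deriv i \<phi> \<in> borel_measurable borel"
    using \<phi> d\<phi> by (auto intro: borel_measurable_continuous_onI)
  have "bounded {x. \<phi> x \<noteq> 0}"
    using assms compact_imp_bounded bounded_subset closure_subset by (auto simp: test_function_def compact_closure)
  then obtain r where r: "{x. \<phi> x \<noteq> 0} \<subseteq> ball 0 r" using bounded_subset_ballD by blast
  then have 0: "\<phi> x = 0" if "x \<notin> ball 0 r" for x using that by blast
  show "\<exists>B. \<forall>x. \<bar>partial_deriv i \<phi> x\<bar> \<le> B" using partial_deriv_bounded[OF d\<phi> 0] by blast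
  have "compact (\<phi> ` cball 0 r)"
    by (intro compact_continuous_image continuous_on_subset[OF \<phi>]) auto
  then obtain B where B: "\<And>x. x \<in> cball 0 r \<Longrightarrow> \<bar>\<phi> x\<bar> \<le> B"
    by (force dest!: compact_imp_bounded simp: bounded_iff)
  have "\<bar>\<phi> x\<bar> \<le> max B 0" for x
    using B[of x] 0[of x] by (cases "x \<in> ball 0 r") auto
  then show "\<exists>B. \<forall>x. \<bar>\<phi> x\<bar> \<le> B" by blast
qed

abbreviation (input) lborel_on :: "'a::euclidean_space set \<Rightarrow> 'a measure" where
  "lborel_on \<Omega> \<equiv> restrict_space lborel \<Omega>"

lemma set_integral_eq_lborel_on:
  fixes f :: "'a::euclidean_space \<Rightarrow> real"
  assumes "open \<Omega>"
  shows "(LINT x:\<Omega>|lborel. f x) = (LINT x|lborel_on \<Omega>. f x)"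
  using assms by (simp add: set_lebesgue_integral_def integral_restrict_space)

lemma L2_on_iff:
  assumes "open \<Omega>"
  shows "L2_on \<Omega> u \<longleftrightarrow> u \<in> borel_measurable (lborel_on \<Omega>) \<and> integrable (lborel_on \<Omega>) (\<lambda>x. (norm (u x))\<^sup>2)"
  using assms
  by (simp add: L2_on_def set_borel_measurable_def set_integrable_def integrable_restrict_space
      borel_measurable_restrict_space_iff)

lemma finite_measure_lborel_on:
  assumes "open \<Omega>" "bounded \<Omega>"
  shows "finite_measure (lborel_on \<Omega>)"
  using emeasure_bounded_finite[OF assms(2)] assms(1)
  by (intro finite_measureI) (simp add: emeasure_restrict_space space_restrict_space)

lemma test_function_measurable_lborel_on:
  assumes "open \<Omega>" "test_function \<Omega> \<phi>"
  shows "\<phi> \<in> borel_measurable (lborel_on \<Omega>)" "partial_deriv i \<phi> \<in> borel_measurable (lborel_on \<Omega>)"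
  by (intro measurable_restrict_space1; use test_function_bounded(1,2)[OF assms(2)] in simp)+

lemma norm_entry_le: "\<bar>(A :: real^'d^'e) $ j $ i\<bar> \<le> norm A"
  by (rule order.trans[OF component_le_norm_cart Finite_Cartesian_Product.norm_nth_le])

lemma integrable_entry:
  fixes G :: "'a \<Rightarrow> real^'d^'e"
  shows "integrable M G \<Longrightarrow> integrable M (\<lambda>x. G x $ j $ i)"
  by (rule integrable_bounded_linear[OF bounded_linear_vec_nth integrable_bounded_linear[OF bounded_linear_vec_nth]])

lemma integrable_component_times_bounded:
  fixes S :: "'a \<Rightarrow> real^'d" and G :: "'a \<Rightarrow> real^'d^'e"
  shows "integrable M S \<Longrightarrow> \<psi> \<in> borel_measurable M \<Longrightarrow> (\<And>x. \<bar>\<psi> x\<bar> \<le> B) \<Longrightarrow> integrable M (\<lambda>x. S x $ j * \<psi> x)"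
    and "integrable M G \<Longrightarrow> \<psi> \<in> borel_measurable M \<Longrightarrow> (\<And>x. \<bar>\<psi> x\<bar> \<le> B) \<Longrightarrow> integrable M (\<lambda>x. G x $ k $ j * \<psi> x)"
  by (rule integrable_mult_bounded, auto intro: integrable_bounded_linear[OF bounded_linear_vec_nth] integrable_entry)+

lemma (in finite_measure) integrable_if_norm2:
  fixes u :: "'a \<Rightarrow> 'b::euclidean_space"
  assumes "u \<in> borel_measurable M" "integrable M (\<lambda>x. (norm (u x))\<^sup>2)"
  shows "integrable M u"
  using norm_integral_le_norm2(1)[OF assms zero_less_one] assms(1) by (simp add: integrable_norm_iff)

text \<open>Midpoints are the convex combinations that the parallelogram argument for gradients
  takes.\<close>

lemma has_weak_deriv_midpoint:
  fixes S S' :: "real^'d \<Rightarrow> real^'d"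
  assumes \<Omega>: "open \<Omega>" and deriv: "has_weak_deriv \<Omega> S G" "has_weak_deriv \<Omega> S' G'"
    and int: "integrable (lborel_on \<Omega>) S" "integrable (lborel_on \<Omega>) S'"
      "integrable (lborel_on \<Omega>) G" "integrable (lborel_on \<Omega>) G'"
  shows "has_weak_deriv \<Omega> (\<lambda>x. (1/2) *\<^sub>R (S x + S' x)) (\<lambda>x. (1/2) *\<^sub>R (G x + G' x))"
  unfolding has_weak_deriv_def
proof (intro allI impI)
  fix \<phi> :: "real^'d \<Rightarrow> real" and i j assume \<phi>: "test_function \<Omega> \<phi>"
  obtain B B' where B: "\<And>x. \<bar>\<phi> x\<bar> \<le> B" "\<And>x. \<bar>partial_deriv i \<phi> x\<bar> \<le> B'"
    using test_function_bounded(3,4)[OF \<phi>] by blast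
  note meas = test_function_measurable_lborel_on[OF \<Omega> \<phi>]
  note ints = integrable_component_times_bounded(1)[OF int(1) meas(2) B(2)] integrable_component_times_bounded(1)[OF int(2) meas(2) B(2)]
    integrable_component_times_bounded(2)[OF int(3) meas(1) B(1)] integrable_component_times_bounded(2)[OF int(4) meas(1) B(1)]
  have eq: "(LINT x|lborel_on \<Omega>. S x $ j * partial_deriv i \<phi> x) = - (LINT x|lborel_on \<Omega>. G x $ j $ i * \<phi> x)"
    "(LINT x|lborel_on \<Omega>. S' x $ j * partial_deriv i \<phi> x) = - (LINT x|lborel_on \<Omega>. G' x $ j $ i * \<phi> x)"
    using deriv \<phi> by (simp_all add: has_weak_deriv_def set_integral_eq_lborel_on[OF \<Omega>])
  have "(LINT x|lborel_on \<Omega>. ((1/2) *\<^sub>R (S x + S' x)) $ j * partial_deriv i \<phi> x) =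
      (LINT x|lborel_on \<Omega>. (1/2) * (S x $ j * partial_deriv i \<phi> x + S' x $ j * partial_deriv i \<phi> x))"
    by (simp add: algebra_simps add_divide_distrib)
  also have "\<dots> = (1/2) * ((LINT x|lborel_on \<Omega>. S x $ j * partial_deriv i \<phi> x) +
      (LINT x|lborel_on \<Omega>. S' x $ j * partial_deriv i \<phi> x))"
    using ints by simp
  also have "\<dots> = - ((1/2) * ((LINT x|lborel_on \<Omega>. G x $ j $ i * \<phi> x) + (LINT x|lborel_on \<Omega>. G' x $ j $ i * \<phi> x)))"
    unfolding eq by (simp only: mult_minus_right flip: minus_add_distrib)
  also have "\<dots> = - (LINT x|lborel_on \<Omega>. (1/2) * (G x $ j $ i * \<phi> x + G' x $ j $ i * \<phi> x))"
    using ints by simp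
  also have "\<dots> = - (LINT x|lborel_on \<Omega>. ((1/2) *\<^sub>R (G x + G' x)) $ j $ i * \<phi> x)"
    by (simp add: algebra_simps add_divide_distrib)
  finally show "(LINT x:\<Omega>|lborel. ((1/2) *\<^sub>R (S x + S' x)) $ j * partial_deriv i \<phi> x) =
      - (LINT x:\<Omega>|lborel. ((1/2) *\<^sub>R (G x + G' x)) $ j $ i * \<phi> x)"
    by (simp only: set_integral_eq_lborel_on[OF \<Omega>])
qed

text \<open>The separate majorant \<open>d\<close> lets a single component or matrix entry inherit
  convergence from the norm of the whole vector or matrix.\<close>

lemma tendsto_integral_times_bounded:
  fixes u :: "nat \<Rightarrow> 'a \<Rightarrow> real" and d :: "nat \<Rightarrow> 'a \<Rightarrow> real"
  assumes int: "\<And>n. integrable M (u n)" "integrable M v" and \<psi>: "\<psi> \<in> borel_measurable M" "\<And>x. \<bar>\<psi> x\<bar> \<le> B"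
    and d: "\<And>n. integrable M (d n)" "\<And>n x. \<bar>u n x - v x\<bar> \<le> d n x" "(\<lambda>n. LINT x|M. d n x) \<longlonglongrightarrow> 0"
  shows "(\<lambda>n. LINT x|M. u n x * \<psi> x) \<longlonglongrightarrow> (LINT x|M. v x * \<psi> x)"
proof (rule LIM_zero_cancel, rule Lim_null_comparison[OF always_eventually, rule_format])
  show "(\<lambda>n. B * (LINT x|M. d n x)) \<longlonglongrightarrow> 0" by (rule tendsto_mult_right_zero[OF d(3)])
  fix n
  have i: "integrable M (\<lambda>x. u n x * \<psi> x)" "integrable M (\<lambda>x. v x * \<psi> x)"
    by (intro integrable_mult_bounded[OF _ \<psi>] int)+
  have "(LINT x|M. u n x * \<psi> x) - (LINT x|M. v x * \<psi> x) = (LINT x|M. u n x * \<psi> x - v x * \<psi> x)"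
    using i by simp
  also have "norm \<dots> \<le> (LINT x|M. B * d n x)"
    unfolding real_norm_def
  proof (rule order.trans[OF integral_abs_bound integral_mono])
    fix x
    have "\<bar>u n x * \<psi> x - v x * \<psi> x\<bar> = \<bar>\<psi> x\<bar> * \<bar>u n x - v x\<bar>" by (simp add: abs_mult flip: left_diff_distrib)
    also have "\<dots> \<le> B * d n x" using \<psi>(2)[of x] d(2)[of n x] by (intro mult_mono) auto
    finally show "\<bar>u n x * \<psi> x - v x * \<psi> x\<bar> \<le> B * d n x" .
  qed (use i d(1) in auto)
  finally show "norm ((LINT x|M. u n x * \<psi> x) - (LINT x|M. v x * \<psi> x)) \<le> B * (LINT x|M. d n x)" by simp
qed

text \<open>Test functions and their partial derivatives are bounded, so convergence of maps and
  gradients in \<open>L\<^sup>1\<close> is enough to pass to the limit in both integrals.\<close>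

lemma has_weak_deriv_limit:
  fixes S :: "nat \<Rightarrow> real^'d \<Rightarrow> real^'d"
  assumes \<Omega>: "open \<Omega>" and deriv: "\<And>n. has_weak_deriv \<Omega> (S n) (G n)"
    and int: "\<And>n. integrable (lborel_on \<Omega>) (S n)" "integrable (lborel_on \<Omega>) T"
      "\<And>n. integrable (lborel_on \<Omega>) (G n)" "integrable (lborel_on \<Omega>) G0"
    and lim: "(\<lambda>n. LINT x|lborel_on \<Omega>. norm (S n x - T x)) \<longlonglongrightarrow> 0"
      "(\<lambda>n. LINT x|lborel_on \<Omega>. norm (G n x - G0 x)) \<longlonglongrightarrow> 0"
  shows "has_weak_deriv \<Omega> T G0"
  unfolding has_weak_deriv_def set_integral_eq_lborel_on[OF \<Omega>]
proof (intro allI impI)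
  fix \<phi> :: "real^'d \<Rightarrow> real" and i j assume \<phi>: "test_function \<Omega> \<phi>"
  obtain B B' where B: "\<And>x. \<bar>\<phi> x\<bar> \<le> B" "\<And>x. \<bar>partial_deriv i \<phi> x\<bar> \<le> B'"
    using test_function_bounded(3,4)[OF \<phi>] by blast
  note meas = test_function_measurable_lborel_on[OF \<Omega> \<phi>]
  have "(\<lambda>n. LINT x|lborel_on \<Omega>. S n x $ j * partial_deriv i \<phi> x) \<longlonglongrightarrow>
      (LINT x|lborel_on \<Omega>. T x $ j * partial_deriv i \<phi> x)"
  proof (rule tendsto_integral_times_bounded[OF _ _ meas(2) B(2) _ _ lim(1)])
    show "\<bar>S n x $ j - T x $ j\<bar> \<le> norm (S n x - T x)" for n x
      using component_le_norm_cart[of "S n x - T x" j] by simp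
  qed (use int in \<open>auto intro: integrable_bounded_linear[OF bounded_linear_vec_nth]\<close>)
  moreover have lim_G: "(\<lambda>n. LINT x|lborel_on \<Omega>. G n x $ j $ i * \<phi> x) \<longlonglongrightarrow>
      (LINT x|lborel_on \<Omega>. G0 x $ j $ i * \<phi> x)"
  proof (rule tendsto_integral_times_bounded[OF _ _ meas(1) B(1) _ _ lim(2)])
    show "\<bar>G n x $ j $ i - G0 x $ j $ i\<bar> \<le> norm (G n x - G0 x)" for n x
      using norm_entry_le[of "G n x - G0 x" j i] by simp
  qed (use int in \<open>auto intro: integrable_entry\<close>)
  moreover have "(LINT x|lborel_on \<Omega>. S n x $ j * partial_deriv i \<phi> x) = - (LINT x|lborel_on \<Omega>. G n x $ j $ i * \<phi> x)" for n
    using deriv[of n] \<phi> by (simp add: has_weak_deriv_def set_integral_eq_lborel_on[OF \<Omega>])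
  ultimately have "(\<lambda>n. - (LINT x|lborel_on \<Omega>. G n x $ j $ i * \<phi> x)) \<longlonglongrightarrow>
      (LINT x|lborel_on \<Omega>. T x $ j * partial_deriv i \<phi> x)"
    by (simp only:)
  from LIMSEQ_unique[OF this tendsto_minus[OF lim_G]]
  show "(LINT x|lborel_on \<Omega>. T x $ j * partial_deriv i \<phi> x) = - (LINT x|lborel_on \<Omega>. G0 x $ j $ i * \<phi> x)" .
qed

text \<open>The gradients \<open>G n\<close> need not converge strongly. In place of weak
  compactness, the least squared norms over nested convex sets are used: they increase and stay
  below K, hence converge, and this makes almost minimal elements a Cauchy sequence. Closedness
  identifies its limit as a gradient of T.\<close>

lemma weak_deriv_compact:
  fixes S :: "nat \<Rightarrow> real^'d \<Rightarrow> real^'d"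
  assumes \<Omega>: "open \<Omega>" "bounded \<Omega>" and deriv: "\<And>n. has_weak_deriv \<Omega> (S n) (G n)"
    and S: "\<And>n. integrable (lborel_on \<Omega>) (S n)" and T: "integrable (lborel_on \<Omega>) T"
    and G: "\<And>n. L2_on \<Omega> (G n)" "\<And>n. (LINT x|lborel_on \<Omega>. (norm (G n x))\<^sup>2) \<le> K"
    and lim: "(\<lambda>n. LINT x|lborel_on \<Omega>. norm (S n x - T x)) \<longlonglongrightarrow> 0"
  obtains G0 where "L2_on \<Omega> G0" "has_weak_deriv \<Omega> T G0" "(LINT x|lborel_on \<Omega>. (norm (G0 x))\<^sup>2) \<le> K"
proof -
  interpret finite_measure "lborel_on \<Omega>" using \<Omega> by (rule finite_measure_lborel_on)
  let ?N = "lborel_on \<Omega>"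
  define sq where "sq A = (LINT x|?N. (norm (A x))\<^sup>2)" for A :: "real^'d \<Rightarrow> real^'d^'d"
  \<comment> \<open>Gradients of maps within 1/(k+1) of T in \<open>L\<^sup>1\<close>; the sets
    shrink as k grows, and each contains some \<open>G n\<close>.\<close>
  define \<A> where "\<A> k = {A. L2_on \<Omega> A \<and> (\<exists>R. integrable ?N R \<and> has_weak_deriv \<Omega> R A \<and>
    (LINT x|?N. norm (R x - T x)) \<le> inverse (real (Suc k)))}" for k
  have sq0: "0 \<le> sq A" for A unfolding sq_def by (intro integral_nonneg_AE AE_I2) simp
  have bdd: "bdd_below (sq ` \<A> k)" for k using sq0 by (intro bdd_belowI2[of _ 0])
  have ex: "\<exists>n. G n \<in> \<A> k" for k
  proof -
    have "eventually (\<lambda>n. (LINT x|?N. norm (S n x - T x)) < inverse (real (Suc k))) sequentially"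
      by (rule order_tendstoD(2)[OF lim]) simp
    then obtain n where "(LINT x|?N. norm (S n x - T x)) < inverse (real (Suc k))"
      by (auto simp: eventually_sequentially)
    then show ?thesis unfolding \<A>_def using G(1) S deriv by (intro exI[of _ n]) force
  qed
  have anti: "\<A> m \<subseteq> \<A> k" if "k \<le> m" for k m
  proof -
    have "inverse (real (Suc m)) \<le> inverse (real (Suc k))" using that by simp
    then show ?thesis unfolding \<A>_def by (blast intro: order.trans)
  qed
  define d where "d k = (INF A\<in>\<A> k. sq A)" for k
  have d_le: "d k \<le> sq A" if "A \<in> \<A> k" for k A unfolding d_def by (rule cINF_lower[OF bdd that])
  have d_mono: "d k \<le> d m" if "k \<le> m" for k m
    unfolding d_def by (rule cINF_superset_mono[OF _ bdd anti[OF that]]) (use ex in auto)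
  have d_K: "d k \<le> K" for k using ex[of k] d_le G(2) unfolding sq_def by (meson order.trans)
  have "\<exists>A\<in>\<A> k. sq A < d k + inverse (real (Suc k))" for k
  proof -
    have "d k < d k + inverse (real (Suc k))" by simp
    then show ?thesis unfolding d_def by (subst (asm) (1) cINF_less_iff[OF _ bdd]) (use ex in auto)
  qed
  then obtain A where A: "\<And>k. A k \<in> \<A> k" "\<And>k. sq (A k) < d k + inverse (real (Suc k))" by metis
  have A_L2: "A k \<in> borel_measurable ?N" "integrable ?N (\<lambda>x. (norm (A k x))\<^sup>2)" for k
    using A(1)[of k] by (auto simp: \<A>_def L2_on_iff[OF \<Omega>(1)])
  have A_int: "integrable ?N (A k)" for k by (rule integrable_if_norm2[OF A_L2])
  obtain R where R: "\<And>k. integrable ?N (R k)" "\<And>k. has_weak_deriv \<Omega> (R k) (A k)"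
    "\<And>k. (LINT x|?N. norm (R k x - T x)) \<le> inverse (real (Suc k))"
    using A(1) unfolding \<A>_def mem_Collect_eq by metis
  \<comment> \<open>For k \<le> m the tighter tolerance of \<open>A m\<close> implies that of level
    k, and the tolerance survives averaging.\<close>
  have mid: "(\<lambda>x. (1/2) *\<^sub>R (A k x + A m x)) \<in> \<A> k" if "k \<le> m" for k m
    unfolding \<A>_def mem_Collect_eq
  proof (intro conjI exI)
    have "integrable ?N (\<lambda>x. (1/2)\<^sup>2 * (norm (A k x + A m x))\<^sup>2)"
      by (intro integrable_mult_right integrable_norm2_diff A_L2)
    then show "L2_on \<Omega> (\<lambda>x. (1/2) *\<^sub>R (A k x + A m x))"
      using A_L2(1) by (simp add: L2_on_iff[OF \<Omega>(1)] power_mult_distrib power_divide)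
    show "has_weak_deriv \<Omega> (\<lambda>x. (1/2) *\<^sub>R (R k x + R m x)) (\<lambda>x. (1/2) *\<^sub>R (A k x + A m x))"
      by (intro has_weak_deriv_midpoint \<Omega> R A_int)
    show "integrable ?N (\<lambda>x. (1/2) *\<^sub>R (R k x + R m x))" using R(1) by simp
    have i: "integrable ?N (\<lambda>x. norm (R k x - T x))" for k
      using R(1) T by (intro integrable_norm Bochner_Integration.integrable_diff)
    have "(LINT x|?N. norm ((1/2) *\<^sub>R (R k x + R m x) - T x)) \<le>
        (LINT x|?N. (1/2) * (norm (R k x - T x) + norm (R m x - T x)))"
    proof (rule integral_mono)
      fix x
      have "(1/2) *\<^sub>R (R k x + R m x) - T x = (1/2) *\<^sub>R ((R k x - T x) + (R m x - T x))"
        by (simp add: vec_eq_iff field_simps)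
      then have "norm ((1/2) *\<^sub>R (R k x + R m x) - T x) = (1/2) * norm ((R k x - T x) + (R m x - T x))"
        by simp
      also have "\<dots> \<le> (1/2) * (norm (R k x - T x) + norm (R m x - T x))"
        by (intro mult_left_mono norm_triangle_ineq) auto
      finally show "norm ((1/2) *\<^sub>R (R k x + R m x) - T x) \<le> (1/2) * (norm (R k x - T x) + norm (R m x - T x))" .
    next
      show "integrable ?N (\<lambda>x. norm ((1/2) *\<^sub>R (R k x + R m x) - T x))"
        using R(1) T by (intro integrable_norm Bochner_Integration.integrable_diff) auto
      show "integrable ?N (\<lambda>x. (1/2) * (norm (R k x - T x) + norm (R m x - T x)))"
        by (intro integrable_mult_right Bochner_Integration.integrable_add i)
    qed
    also have "\<dots> = (1/2) * ((LINT x|?N. norm (R k x - T x)) + (LINT x|?N. norm (R m x - T x)))"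
      using i by simp
    also have "\<dots> \<le> (1/2) * (inverse (real (Suc k)) + inverse (real (Suc m)))"
      by (intro mult_left_mono add_mono R(3)) simp
    also have "\<dots> \<le> (1/2) * (inverse (real (Suc k)) + inverse (real (Suc k)))"
      using that by (intro mult_left_mono add_mono) auto
    finally show "(LINT x|?N. norm ((1/2) *\<^sub>R (R k x + R m x) - T x)) \<le> inverse (real (Suc k))" by simp
  qed
  \<comment> \<open>The parallelogram identity turns almost minimality of the norms into a Cauchy estimate.\<close>
  have para: "sq (\<lambda>x. A k x - A m x) \<le> 2 * (d m - d k) + 4 * inverse (real (Suc k))" if "k \<le> m" for k m
  proof -
    have ii: "integrable ?N (\<lambda>x. (norm (A k x + A m x))\<^sup>2)" "integrable ?N (\<lambda>x. (norm (A k x - A m x))\<^sup>2)"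
      by (intro integrable_norm2_diff A_L2)+
    define b where "b = sq (\<lambda>x. (1/2) *\<^sub>R (A k x + A m x))"
    have "b = (LINT x|?N. (1/4) * (norm (A k x + A m x))\<^sup>2)"
      unfolding sq_def b_def by (simp add: power_mult_distrib power_divide)
    then have "(LINT x|?N. (norm (A k x + A m x))\<^sup>2) = 4 * b"
      using ii by simp
    moreover have "d k \<le> b" unfolding b_def by (rule d_le[OF mid[OF that]])
    moreover have "sq (\<lambda>x. A k x - A m x) = 2 * sq (A k) + 2 * sq (A m) - (LINT x|?N. (norm (A k x + A m x))\<^sup>2)"
    proof -
      have "sq (\<lambda>x. A k x - A m x) =
          (LINT x|?N. 2 * (norm (A k x))\<^sup>2 + 2 * (norm (A m x))\<^sup>2 - (norm (A k x + A m x))\<^sup>2)"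
        unfolding sq_def
        by (intro Bochner_Integration.integral_cong) (simp_all add: power2_norm_eq_inner algebra_simps inner_commute)
      then show ?thesis using ii A_L2(2) unfolding sq_def by simp
    qed
    moreover have "inverse (real (Suc m)) \<le> inverse (real (Suc k))" using that by simp
    \<comment> \<open>The arithmetic isolated in plain reals: both squared norms are almost minimal,
      while the midpoint \<open>b\<close> cannot fall below \<open>dk\<close>.\<close>
    moreover have "s \<le> 2 * (dm - dk) + 4 * ik"
      if "p = 4 * b" "dk \<le> b" "s = 2 * a + 2 * c - p" "im \<le> ik" "a < dk + ik" "c < dm + im"
      for s a b c p dk dm ik im :: real using that by (simp add: algebra_simps)
    ultimately show ?thesis using A(2)[of k] A(2)[of m] by blast
  qed
  have "incseq d" using d_mono by (simp add: incseq_def)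
  then obtain dlim where dlim: "d \<longlonglongrightarrow> dlim" "\<And>k. d k \<le> dlim"
    using incseq_convergent[of d K] d_K by metis
  have Cauchy: "\<exists>N. \<forall>m\<ge>N. \<forall>n\<ge>N. (LINT x|?N. (norm (A m x - A n x))\<^sup>2) < e" if e: "0 < e" for e
  proof -
    have "(\<lambda>k. 2 * (dlim - d k) + 4 * inverse (real (Suc k))) \<longlonglongrightarrow> 2 * (dlim - dlim) + 4 * 0"
      by (intro tendsto_intros dlim(1) LIMSEQ_inverse_real_of_nat)
    from order_tendstoD(2)[OF this, of e] e
    obtain N where N: "\<And>k. k \<ge> N \<Longrightarrow> 2 * (dlim - d k) + 4 * inverse (real (Suc k)) < e"
      by (auto simp: eventually_sequentially)
    have le: "sq (\<lambda>x. A k x - A m x) < e" if "N \<le> k" "k \<le> m" for k m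
      using para[OF that(2)] N[OF that(1)] dlim(2)[of m] by argo
    have sym: "sq (\<lambda>x. A k x - A m x) = sq (\<lambda>x. A m x - A k x)" for k m
      unfolding sq_def by (simp add: norm_minus_commute)
    show ?thesis
    proof (intro exI[of _ N] allI impI)
      fix m n assume *: "N \<le> m" "N \<le> n"
      have "sq (\<lambda>x. A m x - A n x) < e"
      proof (cases "m \<le> n")
        case True
        then show ?thesis using le[OF *(1)] by blast
      next
        case False
        then have "n \<le> m" by simp
        then show ?thesis unfolding sym[of m n] using le[OF *(2)] by blast
      qed
      then show "(LINT x|?N. (norm (A m x - A n x))\<^sup>2) < e" unfolding sq_def .
    qed
  qed
  obtain G0 r where r: "strict_mono (r :: nat \<Rightarrow> nat)" "G0 \<in> borel_measurable ?N"
    "AE x in ?N. (\<lambda>n. A (r n) x) \<longlonglongrightarrow> G0 x" "integrable ?N (\<lambda>x. (norm (G0 x))\<^sup>2)"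
    "(\<lambda>n. LINT x|?N. (norm (A (r n) x - G0 x))\<^sup>2) \<longlonglongrightarrow> 0"
    by (rule L2_Cauchy_convergent[OF A_L2 Cauchy]) blast
  have inv: "(\<lambda>n. inverse (real (Suc (r n)))) \<longlonglongrightarrow> 0"
    using LIMSEQ_subseq_LIMSEQ[OF LIMSEQ_inverse_real_of_nat r(1)] by (simp add: comp_def)
  show ?thesis
  proof (rule that)
    show "L2_on \<Omega> G0" using r by (simp add: L2_on_iff[OF \<Omega>(1)])
    show "has_weak_deriv \<Omega> T G0"
    proof (rule has_weak_deriv_limit[OF \<Omega>(1) R(2) R(1) T A_int integrable_if_norm2[OF r(2,4)]])
      show "(\<lambda>n. LINT x|?N. norm (R (r n) x - T x)) \<longlonglongrightarrow> 0"
        by (rule tendsto_sandwich[OF _ _ tendsto_const inv]) (use R(3) in \<open>auto intro!: always_eventually\<close>)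
      show "(\<lambda>n. LINT x|?N. norm (A (r n) x - G0 x)) \<longlonglongrightarrow> 0"
        by (rule tendsto_L1_if_tendsto_L2[OF _ _ r(5)])
          (use r(2) A_L2(1) in \<open>auto intro!: integrable_norm2_diff A_L2 r\<close>)
    qed
    have "(\<lambda>n. K + inverse (real (Suc (r n)))) \<longlonglongrightarrow> K + 0"
      by (intro tendsto_intros inv)
    moreover have "sq (A (r n)) \<le> K + inverse (real (Suc (r n)))" for n
      using A(2)[of "r n"] d_K[of "r n"] by linarith
    ultimately have "(LINT x|?N. (norm (G0 x))\<^sup>2) \<le> K + 0"
      by (intro integral_norm2_le_limit(2)[OF A_L2(1) r(2,3) A_L2(2)]) (auto simp: sq_def)
    then show "(LINT x|?N. (norm (G0 x))\<^sup>2) \<le> K" by simp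
  qed
qed

lemma weak_deriv_AE_unique:
  assumes \<Omega>: "open \<Omega>" "bounded \<Omega>" and G: "L2_on \<Omega> G" "L2_on \<Omega> G'"
    and deriv: "has_weak_deriv \<Omega> T G" "has_weak_deriv \<Omega> T G'"
  shows "AE x in lborel_on \<Omega>. G x = G' x"
proof -
  interpret finite_measure "lborel_on \<Omega>" using \<Omega> by (rule finite_measure_lborel_on)
  have int: "integrable (lborel_on \<Omega>) G" "integrable (lborel_on \<Omega>) G'"
    using G by (auto intro: integrable_if_norm2 simp: L2_on_iff[OF \<Omega>(1)])
  have "AE x in lborel_on \<Omega>. \<forall>j i. G x $ j $ i - G' x $ j $ i = 0"
    unfolding AE_all_countable
  proof (intro allI)
    fix j i
    have i: "integrable (lborel_on \<Omega>) (\<lambda>x. G x $ j $ i - G' x $ j $ i)"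
      by (intro Bochner_Integration.integrable_diff integrable_entry int)
    have "AE x in lborel. x \<in> \<Omega> \<longrightarrow> G x $ j $ i - G' x $ j $ i = 0"
    proof (rule AE_eq_0_if_test_integrals_eq_0[OF \<Omega>(1)])
      show "set_integrable lborel \<Omega> (\<lambda>x. G x $ j $ i - G' x $ j $ i)"
        using i \<Omega>(1) by (simp add: set_integrable_def integrable_restrict_space)
      fix \<phi> assume \<phi>: "test_function \<Omega> \<phi>"
      obtain B where B: "\<And>x. \<bar>\<phi> x\<bar> \<le> B" using test_function_bounded(3)[OF \<phi>] by blast
      note meas = test_function_measurable_lborel_on(1)[OF \<Omega>(1) \<phi>]
      have "(LINT x|lborel_on \<Omega>. G x $ j $ i * \<phi> x) = (LINT x|lborel_on \<Omega>. G' x $ j $ i * \<phi> x)"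
      proof -
        have "(LINT x|lborel_on \<Omega>. T x $ j * partial_deriv i \<phi> x) = - (LINT x|lborel_on \<Omega>. G x $ j $ i * \<phi> x)"
          "(LINT x|lborel_on \<Omega>. T x $ j * partial_deriv i \<phi> x) = - (LINT x|lborel_on \<Omega>. G' x $ j $ i * \<phi> x)"
          using deriv \<phi> by (simp_all add: has_weak_deriv_def set_integral_eq_lborel_on[OF \<Omega>(1)])
        then show ?thesis by (simp only: neg_equal_iff_equal)
      qed
      moreover have "integrable (lborel_on \<Omega>) (\<lambda>x. G x $ j $ i * \<phi> x)" "integrable (lborel_on \<Omega>) (\<lambda>x. G' x $ j $ i * \<phi> x)"
        by (intro integrable_component_times_bounded(2)[OF _ meas B] int)+
      ultimately show "(LINT x:\<Omega>|lborel. (G x $ j $ i - G' x $ j $ i) * \<phi> x) = 0"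
        by (simp add: set_integral_eq_lborel_on[OF \<Omega>(1)] left_diff_distrib)
    qed
    then show "AE x in lborel_on \<Omega>. G x $ j $ i - G' x $ j $ i = 0"
      using \<Omega>(1) by (simp add: AE_restrict_space_iff)
  qed
  then show ?thesis by eventually_elim (simp add: vec_eq_iff)
qed

text \<open>\<open>weak_deriv\<close> is an arbitrary selection; uniqueness almost everywhere allows
  the energy to be computed from any gradient at hand.\<close>

lemma dirichlet_eq:
  assumes \<Omega>: "open \<Omega>" "bounded \<Omega>" and G: "L2_on \<Omega> G" "has_weak_deriv \<Omega> T G"
  shows "dirichlet \<Omega> T = (LINT x|lborel_on \<Omega>. (norm (G x))\<^sup>2)"
proof -
  have W: "L2_on \<Omega> (weak_deriv \<Omega> T) \<and> has_weak_deriv \<Omega> T (weak_deriv \<Omega> T)"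
    unfolding weak_deriv_def by (rule someI[of _ G]) (use G in simp)
  have "AE x in lborel_on \<Omega>. weak_deriv \<Omega> T x = G x"
    using weak_deriv_AE_unique[OF \<Omega>] W G by blast
  then have "AE x in lborel_on \<Omega>. (norm (weak_deriv \<Omega> T x))\<^sup>2 = (norm (G x))\<^sup>2"
    by eventually_elim simp
  then show ?thesis
    unfolding dirichlet_def set_integral_eq_lborel_on[OF \<Omega>(1)]
    using W G by (intro integral_cong_AE) (auto simp: L2_on_iff[OF \<Omega>(1)])
qed

lemma borel_measurable_component [measurable (raw)]:
  fixes T :: "'a \<Rightarrow> real^'d"
  assumes "T \<in> borel_measurable M"
  shows "(\<lambda>x. T x $ j) \<in> borel_measurable M"
  by (rule measurable_compose[OF assms]) (intro borel_measurable_continuous_onI continuous_intros)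

text \<open>The indicator turns a function meaningful only on \<Omega> into one on the whole space
  vanishing outside, the form required by the compactness lemma.\<close>

lemma weak_gradient_component_diff:
  fixes T T' :: "real^'d \<Rightarrow> real^'d"
  assumes \<Omega>: "open \<Omega>" and int: "integrable (lborel_on \<Omega>) T" "integrable (lborel_on \<Omega>) T'"
      "integrable (lborel_on \<Omega>) G" "integrable (lborel_on \<Omega>) G'"
    and deriv: "has_weak_deriv \<Omega> T G" "has_weak_deriv \<Omega> T' G'"
  shows "weak_gradient \<Omega> (\<lambda>x. indicator \<Omega> x * (T x - T' x) $ j) (\<lambda>x. (G x - G' x) $ j)"
  unfolding weak_gradient_def
proof (intro allI impI)
  fix \<phi> :: "real^'d \<Rightarrow> real" and i assume \<phi>: "test_function \<Omega> \<phi>"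
  obtain B B' where B: "\<And>x. \<bar>\<phi> x\<bar> \<le> B" "\<And>x. \<bar>partial_deriv i \<phi> x\<bar> \<le> B'"
    using test_function_bounded(3,4)[OF \<phi>] by blast
  note meas = test_function_measurable_lborel_on[OF \<Omega> \<phi>]
  note ints = integrable_component_times_bounded(1)[OF int(1) meas(2) B(2)] integrable_component_times_bounded(1)[OF int(2) meas(2) B(2)]
    integrable_component_times_bounded(2)[OF int(3) meas(1) B(1)] integrable_component_times_bounded(2)[OF int(4) meas(1) B(1)]
  have eq: "(LINT x|lborel_on \<Omega>. T x $ j * partial_deriv i \<phi> x) = - (LINT x|lborel_on \<Omega>. G x $ j $ i * \<phi> x)"
    "(LINT x|lborel_on \<Omega>. T' x $ j * partial_deriv i \<phi> x) = - (LINT x|lborel_on \<Omega>. G' x $ j $ i * \<phi> x)"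
    using deriv \<phi> by (simp_all add: has_weak_deriv_def set_integral_eq_lborel_on[OF \<Omega>])
  have "(LINT x|lborel_on \<Omega>. indicator \<Omega> x * (T x - T' x) $ j * partial_deriv i \<phi> x) =
      (LINT x|lborel_on \<Omega>. T x $ j * partial_deriv i \<phi> x - T' x $ j * partial_deriv i \<phi> x)"
    by (intro Bochner_Integration.integral_cong) (auto simp: space_restrict_space left_diff_distrib)
  also have "\<dots> = (LINT x|lborel_on \<Omega>. T x $ j * partial_deriv i \<phi> x) - (LINT x|lborel_on \<Omega>. T' x $ j * partial_deriv i \<phi> x)"
    using ints by simp
  also have "\<dots> = - ((LINT x|lborel_on \<Omega>. G x $ j $ i * \<phi> x) - (LINT x|lborel_on \<Omega>. G' x $ j $ i * \<phi> x))"
    unfolding eq by (simp only: minus_diff_eq diff_minus_eq_add minus_add_distrib uminus_add_conv_diff)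
  also have "(LINT x|lborel_on \<Omega>. G x $ j $ i * \<phi> x) - (LINT x|lborel_on \<Omega>. G' x $ j $ i * \<phi> x) =
      (LINT x|lborel_on \<Omega>. (G x - G' x) $ j $ i * \<phi> x)"
    using ints by (simp add: left_diff_distrib)
  finally show "(LINT x:\<Omega>|lborel. indicator \<Omega> x * (T x - T' x) $ j * partial_deriv i \<phi> x) =
      - (LINT x:\<Omega>|lborel. (G x - G' x) $ j $ i * \<phi> x)"
    by (simp only: set_integral_eq_lborel_on[OF \<Omega>])
qed

section \<open>Transport maps and plans between bounded domains\<close>

text \<open>The three-epsilon argument for exchanging limits; the error \<open>e m\<close> must not
  depend on k.\<close>

lemma LIMSEQ_uniform_approx:
  fixes s :: "nat \<Rightarrow> real"
  assumes a: "\<And>m. a m \<longlonglongrightarrow> l m" and e: "e \<longlonglongrightarrow> (0::real)"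
    and le: "\<And>m k. \<bar>s k - a m k\<bar> \<le> e m" "\<And>m. \<bar>s0 - l m\<bar> \<le> e m"
  shows "s \<longlonglongrightarrow> s0"
proof (rule LIMSEQ_I)
  fix d :: real assume d: "0 < d"
  from order_tendstoD(2)[OF e, of "d / 3"] d obtain m where m: "e m < d / 3"
    by (auto simp: eventually_sequentially)
  obtain K where K: "\<And>k. k \<ge> K \<Longrightarrow> norm (a m k - l m) < d / 3"
    using LIMSEQ_D[OF a[of m], of "d / 3"] d by auto
  have "norm (s k - s0) < d" if "k \<ge> K" for k
    using K[OF that] le(1)[of k m] le(2)[of m] m unfolding real_norm_def by linarith
  then show "\<exists>K. \<forall>k\<ge>K. norm (s k - s0) < d" by blast
qed

text \<open>The radius \<open>R\<close> bounds all transport maps at once; the constant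
  \<open>c\<close> lets Lebesgue integrals be recovered from integrals with respect to
  \<mu>.\<close>

locale density_transport =
  fixes \<Omega> \<Omega>' :: "(real^'d) set" and \<mu> \<nu> :: "(real^'d) measure" and f :: "real^'d \<Rightarrow> real" and c R :: real
  assumes \<Omega>: "open \<Omega>" "bounded \<Omega>" "\<Omega> \<noteq> {}" and \<Omega>': "open \<Omega>'" "\<Omega>' \<noteq> {}"
    and R: "\<And>y. y \<in> \<Omega>' \<Longrightarrow> norm y \<le> R"
    and prob: "prob_space \<mu>" and f: "f \<in> borel_measurable (lborel_on \<Omega>)"
    and \<mu>: "\<mu> = density (lborel_on \<Omega>) (\<lambda>x. ennreal (f x))"
    and c: "0 < c" "AE x in lborel_on \<Omega>. c \<le> f x"
    and sets_\<nu>: "sets \<nu> = sets (lborel_on \<Omega>')"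
begin

sublocale \<mu>: prob_space \<mu> by (rule prob)

sublocale N: finite_measure "lborel_on \<Omega>" using \<Omega> by (intro finite_measure_lborel_on)

lemma R0: "0 \<le> R" using R \<Omega>'(2) norm_ge_zero order.trans by blast

lemma sets_\<mu>: "sets \<mu> = sets (lborel_on \<Omega>)" and space_\<mu>: "space \<mu> = \<Omega>" and space_\<nu>: "space \<nu> = \<Omega>'"
  using sets_eq_imp_space_eq[OF sets_\<nu>] by (simp_all add: \<mu> space_restrict_space)

lemma measurable_\<mu>: "h \<in> measurable borel M \<Longrightarrow> h \<in> measurable \<mu> M"
  and measurable_\<nu>: "h \<in> measurable borel M \<Longrightarrow> h \<in> measurable \<nu> M"
  by (simp_all add: measurable_cong_sets[OF sets_\<mu> refl] measurable_cong_sets[OF sets_\<nu> refl] measurable_restrict_space1)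

lemma measurable_\<mu>_iff: "h \<in> measurable \<mu> M \<longleftrightarrow> h \<in> measurable (lborel_on \<Omega>) M"
  by (simp add: measurable_cong_sets[OF sets_\<mu> refl])

text \<open>The density is positive almost everywhere, so \<mu> and Lebesgue measure on \<Omega>
  have the same null sets.\<close>

lemma AE_\<mu>_iff: "(AE x in \<mu>. P x) \<longleftrightarrow> (AE x in lborel_on \<Omega>. P x)"
proof -
  have "(AE x in \<mu>. P x) \<longleftrightarrow> (AE x in lborel_on \<Omega>. 0 < f x \<longrightarrow> P x)"
    unfolding \<mu> using f by (subst AE_density) auto
  also have "\<dots> \<longleftrightarrow> (AE x in lborel_on \<Omega>. P x)"
  proof
    assume "AE x in lborel_on \<Omega>. 0 < f x \<longrightarrow> P x"
    with c(2) show "AE x in lborel_on \<Omega>. P x" by eventually_elim (use c(1) in auto)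
  qed (auto elim: eventually_mono)
  finally show ?thesis .
qed

lemma AE_\<mu>_if_lborel: "AE x in lborel. P x \<Longrightarrow> AE x in \<mu>. P x"
  unfolding AE_\<mu>_iff using \<Omega>(1) by (subst AE_restrict_space_iff) auto

lemma transport_map_measurable:
  assumes "T \<in> transport_maps \<mu> \<nu>"
  shows "T \<in> borel_measurable \<mu>" "T \<in> borel_measurable (lborel_on \<Omega>)" "\<And>x. x \<in> \<Omega> \<Longrightarrow> T x \<in> \<Omega>'"
    "\<And>x. x \<in> \<Omega> \<Longrightarrow> norm (T x) \<le> R"
proof -
  have T: "T \<in> measurable \<mu> \<nu>" using assms by (simp add: transport_maps_def)
  then show Tx: "T x \<in> \<Omega>'" if "x \<in> \<Omega>" for x
    using measurable_space[OF T] that by (simp add: space_\<mu> space_\<nu>)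
  then show "norm (T x) \<le> R" if "x \<in> \<Omega>" for x using R that by blast
  show "T \<in> borel_measurable \<mu>"
    using measurable_comp[OF T measurable_\<nu>[of "\<lambda>x. x"]] by (simp add: comp_def)
  then show "T \<in> borel_measurable (lborel_on \<Omega>)" by (simp add: measurable_\<mu>_iff)
qed

lemma transport_map_L2:
  assumes "T \<in> transport_maps \<mu> \<nu>"
  shows "integrable (lborel_on \<Omega>) T" "integrable (lborel_on \<Omega>) (\<lambda>x. (norm (T x))\<^sup>2)"
proof -
  note [measurable] = transport_map_measurable(2)[OF assms]
  have le: "norm (T x) \<le> R" if "x \<in> space (lborel_on \<Omega>)" for x
    using transport_map_measurable(4)[OF assms] that by (simp add: space_restrict_space)
  then show "integrable (lborel_on \<Omega>) T"
    by (intro N.integrable_const_bound[where B = R] AE_I2) simp_all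
  show "integrable (lborel_on \<Omega>) (\<lambda>x. (norm (T x))\<^sup>2)"
    by (intro N.integrable_const_bound[where B = "R\<^sup>2"] AE_I2) (simp_all add: le power_mono)
qed

lemma integral_\<mu>: "h \<in> borel_measurable \<mu> \<Longrightarrow> (LINT x|\<mu>. h x) = (LINT x|lborel_on \<Omega>. f x * h x :: real)"
  unfolding \<mu> using c f by (subst integral_density) (auto elim!: eventually_mono simp: measurable_\<mu>_iff)

lemma plan_measurable:
  assumes "\<gamma> \<in> transport_plans \<mu> \<nu>"
  shows "fst \<in> measurable \<gamma> \<mu>" "snd \<in> measurable \<gamma> \<nu>" "fst \<in> borel_measurable \<gamma>" "snd \<in> borel_measurable \<gamma>"
    "space \<gamma> = \<Omega> \<times> \<Omega>'" "prob_space \<gamma>"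
proof -
  have s: "sets \<gamma> = sets (\<mu> \<Otimes>\<^sub>M \<nu>)" using assms by (simp add: transport_plans_def)
  show *: "fst \<in> measurable \<gamma> \<mu>" "snd \<in> measurable \<gamma> \<nu>"
    by (simp_all add: measurable_cong_sets[OF s refl])
  show "fst \<in> borel_measurable \<gamma>" using measurable_comp[OF *(1) measurable_\<mu>[of "\<lambda>x. x"]] by (simp add: comp_def)
  show "snd \<in> borel_measurable \<gamma>" using measurable_comp[OF *(2) measurable_\<nu>[of "\<lambda>x. x"]] by (simp add: comp_def)
  show "space \<gamma> = \<Omega> \<times> \<Omega>'" using sets_eq_imp_space_eq[OF s] by (simp add: space_pair_measure space_\<mu> space_\<nu>)
  show "prob_space \<gamma>" using assms by (simp add: transport_plans_def)
qed

lemma plan_marginal: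
  assumes "\<gamma> \<in> transport_plans \<mu> \<nu>" "h \<in> borel_measurable \<mu>"
  shows "(LINT z|\<gamma>. h (fst z)) = (LINT x|\<mu>. h x :: real)"
proof -
  have "(LINT x|\<mu>. h x) = (LINT x|distr \<gamma> \<mu> fst. h x)" using assms(1) by (simp add: transport_plans_def)
  also have "\<dots> = (LINT z|\<gamma>. h (fst z))"
    by (rule integral_distr[OF plan_measurable(1)[OF assms(1)] assms(2)])
  finally show ?thesis by simp
qed

lemma induced_plan_integral:
  assumes T: "T \<in> transport_maps \<mu> \<nu>" and \<phi>: "\<phi> \<in> borel_measurable (\<mu> \<Otimes>\<^sub>M \<nu>)"
  shows "(LINT z|induced_plan \<mu> \<nu> T. \<phi> z :: real) = (LINT x|\<mu>. \<phi> (x, T x))"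
proof -
  have "(\<lambda>x. (x, T x)) \<in> measurable \<mu> (\<mu> \<Otimes>\<^sub>M \<nu>)"
    using T by (intro measurable_Pair) (simp_all add: transport_maps_def)
  then show ?thesis unfolding induced_plan_def using \<phi> by (rule integral_distr)
qed

lemma measurable_continuous_product:
  fixes \<phi> :: "(real^'d) \<times> (real^'d) \<Rightarrow> real"
  assumes "continuous_on UNIV \<phi>"
  shows "\<phi> \<in> borel_measurable (\<mu> \<Otimes>\<^sub>M \<nu>)"
proof -
  have "(\<lambda>z. (fst z, snd z)) \<in> measurable (\<mu> \<Otimes>\<^sub>M \<nu>) (borel \<Otimes>\<^sub>M borel)"
    by (intro measurable_Pair measurable_compose[OF measurable_fst measurable_\<mu>]
        measurable_compose[OF measurable_snd measurable_\<nu>]) simp_all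
  then have "(\<lambda>z. z) \<in> measurable (\<mu> \<Otimes>\<^sub>M \<nu>) (borel :: ((real^'d) \<times> (real^'d)) measure)"
    by (simp add: borel_prod)
  from measurable_compose[OF this borel_measurable_continuous_onI[OF assms]] show ?thesis .
qed

lemma weak_convergence_integral:
  fixes \<phi> :: "(real^'d) \<times> (real^'d) \<Rightarrow> real"
  assumes T: "\<And>k. T k \<in> transport_maps \<mu> \<nu>"
    and conv: "weakly_converges (\<Omega> \<times> \<Omega>') (\<lambda>k. induced_plan \<mu> \<nu> (T k)) \<gamma>"
    and \<phi>: "continuous_on UNIV \<phi>" "\<And>z. z \<in> \<Omega> \<times> \<Omega>' \<Longrightarrow> \<bar>\<phi> z\<bar> \<le> B"
  shows "(\<lambda>k. LINT x|\<mu>. \<phi> (x, T k x)) \<longlonglongrightarrow> (LINT z|\<gamma>. \<phi> z)"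
proof -
  have "continuous_on (\<Omega> \<times> \<Omega>') \<phi>" "bounded (\<phi> ` (\<Omega> \<times> \<Omega>'))"
    using \<phi>(2) by (auto intro: continuous_on_subset[OF \<phi>(1)] boundedI[of _ B])
  then have "(\<lambda>k. LINT z|induced_plan \<mu> \<nu> (T k). \<phi> z) \<longlonglongrightarrow> (LINT z|\<gamma>. \<phi> z)"
    using conv unfolding weakly_converges_def by blast
  then show ?thesis
    by (simp add: induced_plan_integral[OF T measurable_continuous_product[OF \<phi>(1)]])
qed

text \<open>Approximation is measured in \<mu> directly, because the density may be unbounded.
  Pointwise convergence carries over by absolute continuity, and constants are integrable for a
  probability measure.\<close>

lemma continuous_approx_L1:
  assumes \<psi>: "\<psi> \<in> borel_measurable borel" "\<And>x. \<bar>\<psi> x\<bar> \<le> B"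
  obtains g :: "nat \<Rightarrow> real^'d \<Rightarrow> real" where "\<And>m. continuous_on UNIV (g m)" "\<And>m x. \<bar>g m x\<bar> \<le> B"
    "(\<lambda>m. LINT x|\<mu>. \<bar>\<psi> x - g m x\<bar>) \<longlonglongrightarrow> 0"
proof -
  obtain g where g: "\<And>m. continuous_on UNIV (g m)" "\<And>m x. \<bar>g m x\<bar> \<le> B"
    "AE x in lborel. (\<lambda>m. g m x) \<longlonglongrightarrow> \<psi> x"
    by (rule borel_measurable_continuous_approx[OF \<psi>]) blast
  have [measurable]: "\<psi> \<in> borel_measurable \<mu>" "g m \<in> borel_measurable \<mu>" for m
    by (intro measurable_\<mu> \<psi> borel_measurable_continuous_onI g)+
  have "(\<lambda>m. LINT x|\<mu>. \<bar>\<psi> x - g m x\<bar>) \<longlonglongrightarrow> (LINT x|\<mu>. 0)"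
  proof (rule integral_dominated_convergence[where w = "\<lambda>_. 2 * B"])
    show "AE x in \<mu>. (\<lambda>m. \<bar>\<psi> x - g m x\<bar>) \<longlonglongrightarrow> 0"
      using AE_\<mu>_if_lborel[OF g(3)]
    proof eventually_elim
      case (elim x)
      from tendsto_rabs[OF tendsto_diff[OF tendsto_const[of "\<psi> x"] elim]] show ?case by simp
    qed
    show "AE x in \<mu>. norm \<bar>\<psi> x - g m x\<bar> \<le> 2 * B" for m
    proof (rule AE_I2)
      fix x
      show "norm \<bar>\<psi> x - g m x\<bar> \<le> 2 * B"
        using \<psi>(2)[of x] g(2)[of m x] abs_triangle_ineq4[of "\<psi> x" "g m x"] by simp
    qed
  qed simp_all
  then show ?thesis using that[OF g(1,2)] by simp
qed

end

section \<open>Compactness of transport maps and $\Gamma$-convergence\<close>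

context density_transport
begin

text \<open>Weak convergence admits only continuous integrands. A Borel weight in the first variable
  is replaced by a continuous one at a cost of R times their distance in \<open>L\<^sup>1\<close> of
  \<mu>. This cost is the same for all the plans, since they share the first marginal \<mu>.\<close>

lemma weak_convergence_weighted:
  assumes T: "\<And>k. T k \<in> transport_maps \<mu> \<nu>" and \<gamma>: "\<gamma> \<in> transport_plans \<mu> \<nu>"
    and conv: "weakly_converges (\<Omega> \<times> \<Omega>') (\<lambda>k. induced_plan \<mu> \<nu> (T k)) \<gamma>"
    and \<psi>: "\<psi> \<in> borel_measurable borel" "\<And>x. \<bar>\<psi> x\<bar> \<le> B"
  shows "(\<lambda>k. LINT x|\<mu>. \<psi> x * T k x $ j) \<longlonglongrightarrow> (LINT z|\<gamma>. \<psi> (fst z) * snd z $ j)"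
proof -
  interpret \<gamma>: prob_space \<gamma> by (rule plan_measurable(6)[OF \<gamma>])
  note [measurable] = plan_measurable(3,4)[OF \<gamma>] transport_map_measurable(1)[OF T] \<psi>(1)
  obtain g :: "nat \<Rightarrow> real^'d \<Rightarrow> real" where g: "\<And>m. continuous_on UNIV (g m)" "\<And>m x. \<bar>g m x\<bar> \<le> B"
    "(\<lambda>m. LINT x|\<mu>. \<bar>\<psi> x - g m x\<bar>) \<longlonglongrightarrow> 0"
    by (rule continuous_approx_L1[OF \<psi>]) blast
  have [measurable]: "g m \<in> borel_measurable borel" for m
    by (intro borel_measurable_continuous_onI g)
  note [measurable] = measurable_\<mu>[of \<psi> borel] measurable_\<mu>[of "g _" borel]
  have bdd: "\<bar>a * y\<bar> \<le> C * R" if "\<bar>a\<bar> \<le> C" "\<bar>y\<bar> \<le> R" for a y C :: real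
    using that R0 unfolding abs_mult by (intro mult_mono) auto
  have lip: "\<bar>a * y - b * y\<bar> \<le> R * \<bar>a - b\<bar>" if "\<bar>y\<bar> \<le> R" for a b y :: real
    using mult_right_mono[OF that, of "\<bar>a - b\<bar>"] unfolding left_diff_distrib[symmetric] abs_mult
    by (simp add: mult.commute)
  have comp: "\<bar>y $ j\<bar> \<le> R" if "norm y \<le> R" for y :: "real^'d"
    using component_le_norm_cart[of y j] that by linarith
  have int_\<mu>: "integrable \<mu> (\<lambda>x. h x * T k x $ j)" if "h \<in> borel_measurable borel" "\<And>x. \<bar>h x\<bar> \<le> C" for h k C
  proof (rule \<mu>.integrable_const_bound[where B = "C * R"])
    show "AE x in \<mu>. norm (h x * T k x $ j) \<le> C * R"
      unfolding real_norm_def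
      by (intro AE_I2 bdd that comp transport_map_measurable(4)[OF T]) (simp add: space_\<mu>)
  qed (use measurable_\<mu>[OF that(1)] in measurable)
  have int_\<gamma>: "integrable \<gamma> (\<lambda>z. h (fst z) * snd z $ j)" if "h \<in> borel_measurable borel" "\<And>x. \<bar>h x\<bar> \<le> C" for h C
  proof (rule \<gamma>.integrable_const_bound[where B = "C * R"])
    show "AE z in \<gamma>. norm (h (fst z) * snd z $ j) \<le> C * R"
      unfolding real_norm_def
      by (intro AE_I2 bdd that comp R) (auto simp: plan_measurable(5)[OF \<gamma>])
  qed (use that(1) in measurable)
  have ints: "integrable \<mu> (\<lambda>x. \<psi> x * T k x $ j)" "integrable \<mu> (\<lambda>x. g m x * T k x $ j)"
      "integrable \<gamma> (\<lambda>z. \<psi> (fst z) * snd z $ j)" "integrable \<gamma> (\<lambda>z. g m (fst z) * snd z $ j)" for k m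
    by (rule int_\<mu>[OF \<psi>] int_\<gamma>[OF \<psi>] int_\<mu>[OF _ g(2)] int_\<gamma>[OF _ g(2)]; measurable)+
  have int_d: "integrable \<mu> (\<lambda>x. \<bar>\<psi> x - g m x\<bar>)" for m
  proof (rule \<mu>.integrable_const_bound[where B = "2 * B"])
    have "\<bar>\<psi> x - g m x\<bar> \<le> 2 * B" for x
      using \<psi>(2)[of x] g(2)[of m x] abs_triangle_ineq4[of "\<psi> x" "g m x"] by simp
    then show "AE x in \<mu>. norm \<bar>\<psi> x - g m x\<bar> \<le> 2 * B" by simp
  qed measurable
  show ?thesis
  proof (rule LIMSEQ_uniform_approx)
    show "(\<lambda>k. LINT x|\<mu>. g m x * T k x $ j) \<longlonglongrightarrow> (LINT z|\<gamma>. g m (fst z) * snd z $ j)" for m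
    proof -
      have 1: "continuous_on UNIV (\<lambda>z. g m (fst z) * snd z $ j)"
        by (intro continuous_intros continuous_on_compose2[OF g(1)]) auto
      have 2: "\<bar>g m (fst z) * snd z $ j\<bar> \<le> B * R" if "z \<in> \<Omega> \<times> \<Omega>'" for z
        using that by (intro bdd g comp R) auto
      show ?thesis using weak_convergence_integral[OF T conv 1 2] by simp
    qed
    show "(\<lambda>m. R * (LINT x|\<mu>. \<bar>\<psi> x - g m x\<bar>)) \<longlonglongrightarrow> 0" by (rule tendsto_mult_right_zero[OF g(3)])
    show "\<bar>(LINT x|\<mu>. \<psi> x * T k x $ j) - (LINT x|\<mu>. g m x * T k x $ j)\<bar> \<le> R * (LINT x|\<mu>. \<bar>\<psi> x - g m x\<bar>)" for m k
    proof -
      have "(LINT x|\<mu>. \<psi> x * T k x $ j) - (LINT x|\<mu>. g m x * T k x $ j) =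
          (LINT x|\<mu>. \<psi> x * T k x $ j - g m x * T k x $ j)"
        by (rule Bochner_Integration.integral_diff[OF ints(1,2), symmetric])
      also have "\<bar>\<dots>\<bar> \<le> (LINT x|\<mu>. R * \<bar>\<psi> x - g m x\<bar>)"
      proof (rule order.trans[OF integral_abs_bound integral_mono])
        fix x assume "x \<in> space \<mu>"
        then have "\<bar>T k x $ j\<bar> \<le> R" using comp transport_map_measurable(4)[OF T] by (simp add: space_\<mu>)
        then show "\<bar>\<psi> x * T k x $ j - g m x * T k x $ j\<bar> \<le> R * \<bar>\<psi> x - g m x\<bar>" by (rule lip)
      qed (intro integrable_abs integrable_mult_right Bochner_Integration.integrable_diff ints int_d)+
      finally show ?thesis by simp
    qed
    show "\<bar>(LINT z|\<gamma>. \<psi> (fst z) * snd z $ j) - (LINT z|\<gamma>. g m (fst z) * snd z $ j)\<bar> \<le> R * (LINT x|\<mu>. \<bar>\<psi> x - g m x\<bar>)" for m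
    proof -
      have marg: "(LINT z|\<gamma>. \<bar>\<psi> (fst z) - g m (fst z)\<bar>) = (LINT x|\<mu>. \<bar>\<psi> x - g m x\<bar>)"
        by (rule plan_marginal[OF \<gamma>, of "\<lambda>x. \<bar>\<psi> x - g m x\<bar>"]) measurable
      have int_d\<gamma>: "integrable \<gamma> (\<lambda>z. \<bar>\<psi> (fst z) - g m (fst z)\<bar>)"
      proof (rule \<gamma>.integrable_const_bound[where B = "2 * B"])
        have "\<bar>\<psi> x - g m x\<bar> \<le> 2 * B" for x
          using \<psi>(2)[of x] g(2)[of m x] abs_triangle_ineq4[of "\<psi> x" "g m x"] by simp
        then show "AE z in \<gamma>. norm \<bar>\<psi> (fst z) - g m (fst z)\<bar> \<le> 2 * B" by simp
      qed measurable
      have "(LINT z|\<gamma>. \<psi> (fst z) * snd z $ j) - (LINT z|\<gamma>. g m (fst z) * snd z $ j) =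
          (LINT z|\<gamma>. \<psi> (fst z) * snd z $ j - g m (fst z) * snd z $ j)"
        by (rule Bochner_Integration.integral_diff[OF ints(3,4), symmetric])
      also have "\<bar>\<dots>\<bar> \<le> (LINT z|\<gamma>. R * \<bar>\<psi> (fst z) - g m (fst z)\<bar>)"
      proof (rule order.trans[OF integral_abs_bound integral_mono])
        fix z assume "z \<in> space \<gamma>"
        then have "\<bar>snd z $ j\<bar> \<le> R" using comp R by (auto simp: plan_measurable(5)[OF \<gamma>])
        then show "\<bar>\<psi> (fst z) * snd z $ j - g m (fst z) * snd z $ j\<bar> \<le> R * \<bar>\<psi> (fst z) - g m (fst z)\<bar>" by (rule lip)
      qed (intro integrable_abs integrable_mult_right Bochner_Integration.integrable_diff ints int_d\<gamma>)+
      finally show ?thesis by (simp add: marg)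
    qed
  qed
qed

text \<open>Integrating the weight \<psi>/f against \<mu> gives the Lebesgue integral with weight
  \<psi>. Only the existence of the limit is recorded, since it will cancel in differences.\<close>

lemma weak_convergence_lborel:
  assumes T: "\<And>k. T k \<in> transport_maps \<mu> \<nu>" and \<gamma>: "\<gamma> \<in> transport_plans \<mu> \<nu>"
    and conv: "weakly_converges (\<Omega> \<times> \<Omega>') (\<lambda>k. induced_plan \<mu> \<nu> (T k)) \<gamma>"
    and \<psi>: "\<psi> \<in> borel_measurable borel" "\<And>x. \<bar>\<psi> x\<bar> \<le> B"
  shows "convergent (\<lambda>k. LINT x|lborel_on \<Omega>. \<psi> x * T k x $ j)"
proof -
  have B0: "0 \<le> B" using \<psi>(2)[of 0] by linarith
  define f' where "f' x = indicator \<Omega> x * f x" for x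
  have f'[measurable]: "f' \<in> borel_measurable borel"
    using f \<Omega>(1) by (simp add: f'_def[abs_def] borel_measurable_restrict_space_iff)
  \<comment> \<open>The value 0 is used where the extended density is below c, which inside \<Omega>
    happens only on a null set; thus B/c bounds the quotient everywhere.\<close>
  define \<Psi> where "\<Psi> x = (if c \<le> f' x then \<psi> x / f' x else 0)" for x
  have \<Psi>[measurable]: "\<Psi> \<in> borel_measurable borel"
    unfolding \<Psi>_def[abs_def] using \<psi>(1) f' by measurable
  have \<Psi>_bound: "\<bar>\<Psi> x\<bar> \<le> B / c" for x
  proof (cases "c \<le> f' x")
    case True
    then have "\<bar>\<psi> x\<bar> / f' x \<le> B / c" using \<psi>(2)[of x] c(1) by (intro frac_le) auto
    then show ?thesis using True c(1) by (simp add: \<Psi>_def abs_divide)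
  qed (use B0 c(1) in \<open>simp add: \<Psi>_def\<close>)
  have eq: "(LINT x|\<mu>. \<Psi> x * T k x $ j) = (LINT x|lborel_on \<Omega>. \<psi> x * T k x $ j)" for k
  proof -
    note [measurable] = transport_map_measurable(1,2)[OF T] measurable_\<mu>[OF \<Psi>] measurable_restrict_space1[OF \<Psi>[folded measurable_lborel2]]
      measurable_restrict_space1[OF \<psi>(1)[folded measurable_lborel2]] f
    have "(LINT x|\<mu>. \<Psi> x * T k x $ j) = (LINT x|lborel_on \<Omega>. f x * (\<Psi> x * T k x $ j))"
      by (rule integral_\<mu>) measurable
    also have "\<dots> = (LINT x|lborel_on \<Omega>. \<psi> x * T k x $ j)"
    proof (rule integral_cong_AE)
      have "AE x in lborel_on \<Omega>. x \<in> \<Omega>" by (rule AE_I2) (simp add: space_restrict_space)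
      with c(2) show "AE x in lborel_on \<Omega>. f x * (\<Psi> x * T k x $ j) = \<psi> x * T k x $ j"
        by eventually_elim (use c(1) in \<open>simp add: \<Psi>_def f'_def\<close>)
    qed measurable
    finally show ?thesis .
  qed
  show ?thesis
    using weak_convergence_weighted[OF T \<gamma> conv \<Psi> \<Psi>_bound, of j] unfolding eq convergent_def by blast
qed

lemma indicator_component_measurable:
  assumes "T \<in> borel_measurable (lborel_on \<Omega>)"
  shows "(\<lambda>x. indicator \<Omega> x * T x $ j :: real) \<in> borel_measurable borel"
proof -
  have "(\<lambda>x. T x $ j) \<in> borel_measurable (lborel_on \<Omega>)" using assms by measurable
  then show ?thesis using \<Omega>(1) by (simp add: borel_measurable_restrict_space_iff)
qed

text \<open>Failure of the Cauchy property yields two index sequences along which the maps stay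
  apart. Every weighted integral has the same limit along both, so the componentwise differences are
  weakly null with bounded gradients, hence strongly null.\<close>

lemma transport_maps_L2_Cauchy:
  assumes T: "\<And>k. T k \<in> transport_maps \<mu> \<nu>" and \<gamma>: "\<gamma> \<in> transport_plans \<mu> \<nu>"
    and conv: "weakly_converges (\<Omega> \<times> \<Omega>') (\<lambda>k. induced_plan \<mu> \<nu> (T k)) \<gamma>"
    and G: "\<And>k. L2_on \<Omega> (G k)" "\<And>k. has_weak_deriv \<Omega> (T k) (G k)"
      "\<And>k. (LINT x|lborel_on \<Omega>. (norm (G k x))\<^sup>2) \<le> K"
    and e: "0 < e"
  shows "\<exists>N. \<forall>m\<ge>N. \<forall>n\<ge>N. (LINT x|lborel_on \<Omega>. (norm (T m x - T n x))\<^sup>2) < e"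
proof (rule ccontr)
  assume "\<not> ?thesis"
  then have "\<forall>N. \<exists>m n. N \<le> m \<and> N \<le> n \<and> e \<le> (LINT x|lborel_on \<Omega>. (norm (T m x - T n x))\<^sup>2)"
    by (simp add: not_less)
  \<comment> \<open>The sequences need not be monotone; \<open>N \<le> r N\<close> and
    \<open>N \<le> s N\<close> already send both to infinity.\<close>
  then obtain r s where rs: "\<And>N. N \<le> r N" "\<And>N. N \<le> s N"
    "\<And>N. e \<le> (LINT x|lborel_on \<Omega>. (norm (T (r N) x - T (s N) x))\<^sup>2)" by metis
  have top: "filterlim r at_top sequentially" "filterlim s at_top sequentially"
    using rs(1,2) by (auto intro!: filterlim_at_top_mono[OF filterlim_ident] always_eventually)
  note [measurable] = transport_map_measurable(2)[OF T]
  note T_int = transport_map_L2(1)[OF T]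
  have G_meas[measurable]: "G k \<in> borel_measurable (lborel_on \<Omega>)" and G_L2: "integrable (lborel_on \<Omega>) (\<lambda>x. (norm (G k x))\<^sup>2)" for k
    using G(1)[of k] by (auto simp: L2_on_iff[OF \<Omega>(1)])
  have G_int: "integrable (lborel_on \<Omega>) (G k)" for k by (rule N.integrable_if_norm2[OF G_meas G_L2])
  define w where "w j N x = indicator \<Omega> x * (T (r N) x - T (s N) x) $ j" for j N x
  have Tj_int: "integrable (lborel_on \<Omega>) (\<lambda>x. T k x $ j)" for k j
    by (rule integrable_bounded_linear[OF bounded_linear_vec_nth T_int])
  have sq0: "(\<lambda>N. LINT x|lborel. (w j N x)\<^sup>2) \<longlonglongrightarrow> 0" for j
  proof (rule weak_gradient_compact[OF \<Omega>(2,1,3)])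
    show "w j N \<in> borel_measurable borel" for N
      unfolding w_def[abs_def] by (rule indicator_component_measurable) measurable
    show "\<bar>w j N x\<bar> \<le> 2 * R" for N x
    proof (cases "x \<in> \<Omega>")
      case True
      have "\<bar>(T (r N) x - T (s N) x) $ j\<bar> \<le> norm (T (r N) x - T (s N) x)" by (rule component_le_norm_cart)
      also have "\<dots> \<le> norm (T (r N) x) + norm (T (s N) x)" by (rule norm_triangle_ineq4)
      also have "\<dots> \<le> R + R" by (intro add_mono transport_map_measurable(4)[OF T True])
      finally show ?thesis using True by (simp add: w_def)
    qed (use R0 in \<open>simp add: w_def\<close>)
    show "w j N x = 0" if "x \<notin> \<Omega>" for N x using that by (simp add: w_def)
    show "weak_gradient \<Omega> (w j N) (\<lambda>x. (G (r N) x - G (s N) x) $ j)" for N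
      unfolding w_def[abs_def] by (rule weak_gradient_component_diff[OF \<Omega>(1) T_int T_int G_int G_int G(2) G(2)])
    \<comment> \<open>The parallelogram identity again; after integration it produces the bound
      \<open>4 * K\<close>.\<close>
    have le: "(norm ((G (r N) x - G (s N) x) $ j))\<^sup>2 \<le> 2 * (norm (G (r N) x))\<^sup>2 + 2 * (norm (G (s N) x))\<^sup>2" for N x
    proof -
      have "(norm ((G (r N) x - G (s N) x) $ j))\<^sup>2 \<le> (norm (G (r N) x - G (s N) x))\<^sup>2"
        by (intro power_mono Finite_Cartesian_Product.norm_nth_le) simp
      also have "\<dots> \<le> (norm (G (r N) x - G (s N) x))\<^sup>2 + (norm (G (r N) x + G (s N) x))\<^sup>2" by simp
      also have "\<dots> = 2 * (norm (G (r N) x))\<^sup>2 + 2 * (norm (G (s N) x))\<^sup>2"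
        by (simp add: power2_norm_eq_inner algebra_simps inner_commute)
      finally show ?thesis .
    qed
    have bnd: "integrable (lborel_on \<Omega>) (\<lambda>x. 2 * (norm (G (r N) x))\<^sup>2 + 2 * (norm (G (s N) x))\<^sup>2)" for N
      using G_L2 by simp
    have row_meas: "(\<lambda>x. (G (r N) x - G (s N) x) $ j) \<in> borel_measurable (lborel_on \<Omega>)" for N
      by (rule borel_measurable_integrable[OF integrable_bounded_linear[OF bounded_linear_vec_nth Bochner_Integration.integrable_diff[OF G_int G_int]]])
    have row_L2: "integrable (lborel_on \<Omega>) (\<lambda>x. (norm ((G (r N) x - G (s N) x) $ j))\<^sup>2)" for N
    proof (rule Bochner_Integration.integrable_bound[OF bnd])
      show "AE x in lborel_on \<Omega>. norm ((norm ((G (r N) x - G (s N) x) $ j))\<^sup>2)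
          \<le> norm (2 * (norm (G (r N) x))\<^sup>2 + 2 * (norm (G (s N) x))\<^sup>2)"
        using le by (intro AE_I2) (auto intro: order.trans)
    qed (use row_meas in measurable)
    then show "L2_on \<Omega> (\<lambda>x. (G (r N) x - G (s N) x) $ j)" for N
      using row_meas by (simp add: L2_on_iff[OF \<Omega>(1)])
    show "(LINT x:\<Omega>|lborel. (norm ((G (r N) x - G (s N) x) $ j))\<^sup>2) \<le> 4 * K" for N
    proof -
      have "(LINT x:\<Omega>|lborel. (norm ((G (r N) x - G (s N) x) $ j))\<^sup>2) \<le>
          (LINT x|lborel_on \<Omega>. 2 * (norm (G (r N) x))\<^sup>2 + 2 * (norm (G (s N) x))\<^sup>2)"
        unfolding set_integral_eq_lborel_on[OF \<Omega>(1)] by (intro integral_mono row_L2 bnd le)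
      also have "\<dots> = 2 * (LINT x|lborel_on \<Omega>. (norm (G (r N) x))\<^sup>2) + 2 * (LINT x|lborel_on \<Omega>. (norm (G (s N) x))\<^sup>2)"
        using G_L2 by simp
      finally show ?thesis using G(3)[of "r N"] G(3)[of "s N"] by argo
    qed
    fix \<psi> :: "real^'d \<Rightarrow> real" assume \<psi>: "\<psi> \<in> borel_measurable borel" "\<And>x. \<bar>\<psi> x\<bar> \<le> 1"
    have \<psi>N: "\<psi> \<in> borel_measurable (lborel_on \<Omega>)" using \<psi>(1) by (intro measurable_restrict_space1) simp
    obtain L where L: "(\<lambda>k. LINT x|lborel_on \<Omega>. \<psi> x * T k x $ j) \<longlonglongrightarrow> L"
      using weak_convergence_lborel[OF T \<gamma> conv \<psi>] unfolding convergent_def by blast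
    have "(\<lambda>N. (LINT x|lborel_on \<Omega>. \<psi> x * T (r N) x $ j) - (LINT x|lborel_on \<Omega>. \<psi> x * T (s N) x $ j)) \<longlonglongrightarrow> L - L"
      by (intro tendsto_diff filterlim_compose[OF L] top)
    moreover have "(LINT x|lborel_on \<Omega>. \<psi> x * T (r N) x $ j) - (LINT x|lborel_on \<Omega>. \<psi> x * T (s N) x $ j) =
        (LINT x|lborel. \<psi> x * w j N x)" for N
    proof -
      have i: "integrable (lborel_on \<Omega>) (\<lambda>x. \<psi> x * T k x $ j)" for k
        using integrable_mult_bounded[OF Tj_int \<psi>N \<psi>(2)] by (simp add: mult.commute)
      have "(LINT x|lborel_on \<Omega>. \<psi> x * T (r N) x $ j) - (LINT x|lborel_on \<Omega>. \<psi> x * T (s N) x $ j) =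
          (LINT x|lborel_on \<Omega>. \<psi> x * (T (r N) x - T (s N) x) $ j)"
        using i by (simp add: right_diff_distrib)
      also have "\<dots> = (LINT x|lborel. \<psi> x * w j N x)"
        unfolding set_integral_eq_lborel_on[OF \<Omega>(1), symmetric] set_lebesgue_integral_def w_def
        by (simp add: mult.left_commute)
      finally show ?thesis .
    qed
    ultimately show "(\<lambda>N. LINT x|lborel. \<psi> x * w j N x) \<longlonglongrightarrow> 0" by simp
  qed
  have "(LINT x|lborel_on \<Omega>. (norm (T (r N) x - T (s N) x))\<^sup>2) = (\<Sum>j\<in>UNIV. LINT x|lborel. (w j N x)\<^sup>2)" for N
  proof -
    have wN: "(LINT x|lborel. (w j N x)\<^sup>2) = (LINT x|lborel_on \<Omega>. ((T (r N) x - T (s N) x) $ j)\<^sup>2)" for j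
      unfolding set_integral_eq_lborel_on[OF \<Omega>(1), symmetric] set_lebesgue_integral_def w_def
      by (intro Bochner_Integration.integral_cong) (auto simp: indicator_def)
    have "integrable (lborel_on \<Omega>) (\<lambda>x. ((T (r N) x - T (s N) x) $ j)\<^sup>2)" for j
    proof (rule Bochner_Integration.integrable_bound)
      show "integrable (lborel_on \<Omega>) (\<lambda>x. (norm (T (r N) x - T (s N) x))\<^sup>2)"
        by (intro integrable_norm2_diff transport_map_L2(2)[OF T]) measurable
      have "\<bar>(T (r N) x - T (s N) x) $ j\<bar>\<^sup>2 \<le> (norm (T (r N) x - T (s N) x))\<^sup>2" for x
        by (intro power_mono component_le_norm_cart) simp
      then show "AE x in lborel_on \<Omega>. norm (((T (r N) x - T (s N) x) $ j)\<^sup>2) \<le> norm ((norm (T (r N) x - T (s N) x))\<^sup>2)"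
        by (intro AE_I2) simp
    qed measurable
    moreover have "(norm x)\<^sup>2 = (\<Sum>j\<in>UNIV. (x $ j)\<^sup>2)" for x :: "real^'d"
      unfolding power2_norm_eq_inner inner_vec_def by (simp add: power2_eq_square)
    ultimately show ?thesis
      unfolding wN by (simp only: Bochner_Integration.integral_sum)
  qed
  moreover have "(\<lambda>N. \<Sum>j\<in>UNIV. LINT x|lborel. (w j N x)\<^sup>2) \<longlonglongrightarrow> (\<Sum>j\<in>(UNIV :: 'd set). 0)"
    by (intro tendsto_sum sq0)
  ultimately have "(\<lambda>N. LINT x|lborel_on \<Omega>. (norm (T (r N) x - T (s N) x))\<^sup>2) \<longlonglongrightarrow> 0" by simp
  then have "e \<le> 0" by (rule LIMSEQ_le_const) (use rs(3) in blast)
  then show False using e by simp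
qed

text \<open>Strong convergence lets the limit of the plans be compared with the graph of v: the
  \<gamma>-integral of the distance from the second coordinate to v of the first is shown to vanish,
  component by component.\<close>

lemma transport_maps_limit:
  assumes T: "\<And>k. T k \<in> transport_maps \<mu> \<nu>" and \<gamma>: "\<gamma> \<in> transport_plans \<mu> \<nu>"
    and conv: "weakly_converges (\<Omega> \<times> \<Omega>') (\<lambda>k. induced_plan \<mu> \<nu> (T k)) \<gamma>"
    and G: "\<And>k. L2_on \<Omega> (G k)" "\<And>k. has_weak_deriv \<Omega> (T k) (G k)"
      "\<And>k. (LINT x|lborel_on \<Omega>. (norm (G k x))\<^sup>2) \<le> K"
  obtains r v where "strict_mono (r :: nat \<Rightarrow> nat)" "v \<in> borel_measurable borel"
    "AE x in lborel_on \<Omega>. (\<lambda>n. T (r n) x) \<longlonglongrightarrow> v x" "AE z in \<gamma>. snd z = v (fst z)"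
proof -
  interpret \<gamma>: prob_space \<gamma> by (rule plan_measurable(6)[OF \<gamma>])
  note T_meas = transport_map_measurable(2)[OF T]
  obtain v0 r where r: "strict_mono (r :: nat \<Rightarrow> nat)" and v0: "v0 \<in> borel_measurable (lborel_on \<Omega>)"
    "AE x in lborel_on \<Omega>. (\<lambda>n. T (r n) x) \<longlonglongrightarrow> v0 x"
    by (rule N.L2_Cauchy_convergent[OF T_meas transport_map_L2(2)[OF T] transport_maps_L2_Cauchy[OF T \<gamma> conv G]]) blast
  define v1 where "v1 x = indicator \<Omega> x *\<^sub>R v0 x" for x
  have v1[measurable]: "v1 \<in> borel_measurable borel"
    using v0(1) \<Omega>(1) by (simp add: v1_def[abs_def] borel_measurable_restrict_space_iff)
  \<comment> \<open>A modification on a null set that makes the limit Borel and bounded on the whole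
    space, as the continuous approximation requires.\<close>
  define v where "v x = (if norm (v1 x) \<le> R then v1 x else 0)" for x
  have v[measurable]: "v \<in> borel_measurable borel"
    unfolding v_def[abs_def] using v1 by measurable
  have v_R: "norm (v x) \<le> R" for x using R0 by (simp add: v_def)
  have in_\<Omega>: "AE x in lborel_on \<Omega>. x \<in> \<Omega>" by (rule AE_I2) (simp add: space_restrict_space)
  have lim: "AE x in lborel_on \<Omega>. (\<lambda>n. T (r n) x) \<longlonglongrightarrow> v x"
    using v0(2) in_\<Omega>
  proof eventually_elim
    case (elim x)
    have "norm (v0 x) \<le> R"
      by (rule LIMSEQ_le_const2[OF tendsto_norm[OF elim(1)]])
        (use transport_map_measurable(4)[OF T elim(2)] in blast)
    then show ?case using elim by (simp add: v_def v1_def)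
  qed
  have T\<mu>[measurable]: "T k \<in> borel_measurable \<mu>" for k by (rule transport_map_measurable(1)[OF T])
  have comp: "\<bar>y $ j\<bar> \<le> R" if "norm y \<le> R" for y :: "real^'d" and j
    using component_le_norm_cart[of y j] that by linarith
  \<comment> \<open>Weak convergence only sees continuous integrands, so \<open>v\<close> is replaced by continuous \<open>h m\<close>.\<close>
  have "AE z in \<gamma>. snd z $ j = v (fst z) $ j" for j
  proof -
    have vj: "(\<lambda>x. v x $ j) \<in> borel_measurable borel" "\<bar>v x $ j\<bar> \<le> R" for x
      using comp[OF v_R] by simp_all
    obtain h :: "nat \<Rightarrow> real^'d \<Rightarrow> real" where h: "\<And>m. continuous_on UNIV (h m)" "\<And>m x. \<bar>h m x\<bar> \<le> R"
      "(\<lambda>m. LINT x|\<mu>. \<bar>v x $ j - h m x\<bar>) \<longlonglongrightarrow> 0"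
      by (rule continuous_approx_L1[OF vj]) blast
    have hb[measurable]: "h m \<in> borel_measurable borel" for m
      by (intro borel_measurable_continuous_onI h)
    note [measurable] = plan_measurable(3,4)[OF \<gamma>]
    have m1: "(\<lambda>x. \<bar>v x $ j - h m x\<bar>) \<in> borel_measurable \<mu>" for m
      by (rule measurable_\<mu>) measurable
    have m2: "(\<lambda>x. \<bar>T k x $ j - h m x\<bar>) \<in> borel_measurable \<mu>" for k m
      by (intro borel_measurable_abs borel_measurable_diff borel_measurable_component T\<mu> measurable_\<mu>[OF hb])
    have le2R: "\<bar>a - b\<bar> \<le> 2 * R" if "\<bar>a\<bar> \<le> R" "\<bar>b\<bar> \<le> R" for a b :: real
      using that abs_triangle_ineq4[of a b] by linarith
    have space_R: "\<bar>snd z $ j\<bar> \<le> R" if "z \<in> \<Omega> \<times> \<Omega>'" for z :: "(real^'d) \<times> (real^'d)" using that by (intro comp R) auto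
    \<comment> \<open>One sequence of integrals has two limits: through weak convergence of the
      plans, and through almost everywhere convergence of the maps.\<close>
    have I: "(LINT z|\<gamma>. \<bar>snd z $ j - h m (fst z)\<bar>) = (LINT x|\<mu>. \<bar>v x $ j - h m x\<bar>)" for m
    proof (rule LIMSEQ_unique)
      have 1: "continuous_on UNIV (\<lambda>z. \<bar>snd z $ j - h m (fst z)\<bar>)"
        by (intro continuous_intros continuous_on_compose2[OF h(1)]) auto
      have 2: "\<bar>\<bar>snd z $ j - h m (fst z)\<bar>\<bar> \<le> 2 * R" if "z \<in> \<Omega> \<times> \<Omega>'" for z
        unfolding abs_abs by (intro le2R space_R[OF that] h)
      show "(\<lambda>n. LINT x|\<mu>. \<bar>T (r n) x $ j - h m x\<bar>) \<longlonglongrightarrow> (LINT z|\<gamma>. \<bar>snd z $ j - h m (fst z)\<bar>)"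
        using LIMSEQ_subseq_LIMSEQ[OF weak_convergence_integral[OF T conv 1 2] r] by (simp add: comp_def)
      show "(\<lambda>n. LINT x|\<mu>. \<bar>T (r n) x $ j - h m x\<bar>) \<longlonglongrightarrow> (LINT x|\<mu>. \<bar>v x $ j - h m x\<bar>)"
      proof (rule integral_dominated_convergence[where w = "\<lambda>_. 2 * R"])
        have "AE x in \<mu>. (\<lambda>n. T (r n) x) \<longlonglongrightarrow> v x" unfolding AE_\<mu>_iff by (rule lim)
        then show "AE x in \<mu>. (\<lambda>n. \<bar>T (r n) x $ j - h m x\<bar>) \<longlonglongrightarrow> \<bar>v x $ j - h m x\<bar>"
          by eventually_elim (intro tendsto_intros)
        show "AE x in \<mu>. norm \<bar>T (r n) x $ j - h m x\<bar> \<le> 2 * R" for n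
          unfolding real_norm_def abs_abs
          by (intro AE_I2 le2R comp transport_map_measurable(4)[OF T] h) (simp add: space_\<mu>)
      qed (rule m1 m2 | simp)+
    qed
    have i1: "integrable \<gamma> (\<lambda>z. \<bar>snd z $ j - h m (fst z)\<bar>)" for m
    proof (rule \<gamma>.integrable_const_bound[where B = "2 * R"])
      show "AE z in \<gamma>. norm \<bar>snd z $ j - h m (fst z)\<bar> \<le> 2 * R"
        unfolding real_norm_def abs_abs
        by (intro AE_I2 le2R space_R h) (simp add: plan_measurable(5)[OF \<gamma>])
    qed measurable
    have i2: "integrable \<gamma> (\<lambda>z. \<bar>v (fst z) $ j - h m (fst z)\<bar>)" for m
    proof (rule \<gamma>.integrable_const_bound[where B = "2 * R"])
      show "AE z in \<gamma>. norm \<bar>v (fst z) $ j - h m (fst z)\<bar> \<le> 2 * R"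
        unfolding real_norm_def abs_abs by (intro AE_I2 le2R vj h)
    qed measurable
    have i3: "integrable \<gamma> (\<lambda>z. \<bar>snd z $ j - v (fst z) $ j\<bar>)"
    proof (rule \<gamma>.integrable_const_bound[where B = "2 * R"])
      show "AE z in \<gamma>. norm \<bar>snd z $ j - v (fst z) $ j\<bar> \<le> 2 * R"
        unfolding real_norm_def abs_abs
        by (intro AE_I2 le2R space_R vj) (simp add: plan_measurable(5)[OF \<gamma>])
    qed measurable
    have marg: "(LINT z|\<gamma>. \<bar>v (fst z) $ j - h m (fst z)\<bar>) = (LINT x|\<mu>. \<bar>v x $ j - h m x\<bar>)" for m
      by (rule plan_marginal[OF \<gamma>, of "\<lambda>x. \<bar>v x $ j - h m x\<bar>"]) (rule m1)
    \<comment> \<open>The triangle inequality through \<open>h m\<close>; each of the two terms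
      equals the same approximation error, whence the factor 2.\<close>
    have bound: "(LINT z|\<gamma>. \<bar>snd z $ j - v (fst z) $ j\<bar>) \<le> 2 * (LINT x|\<mu>. \<bar>v x $ j - h m x\<bar>)" for m
    proof -
      have "(LINT z|\<gamma>. \<bar>snd z $ j - v (fst z) $ j\<bar>) \<le>
          (LINT z|\<gamma>. \<bar>snd z $ j - h m (fst z)\<bar> + \<bar>v (fst z) $ j - h m (fst z)\<bar>)"
        by (intro integral_mono i3 Bochner_Integration.integrable_add i1 i2) linarith
      also have "\<dots> = (LINT z|\<gamma>. \<bar>snd z $ j - h m (fst z)\<bar>) + (LINT z|\<gamma>. \<bar>v (fst z) $ j - h m (fst z)\<bar>)"
        by (rule Bochner_Integration.integral_add[OF i1 i2])
      finally show ?thesis unfolding I marg by simp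
    qed
    have "(LINT z|\<gamma>. \<bar>snd z $ j - v (fst z) $ j\<bar>) \<le> 0"
      by (rule LIMSEQ_le_const[OF tendsto_mult_right_zero[OF h(3)]]) (use bound in blast)
    moreover have "0 \<le> (LINT z|\<gamma>. \<bar>snd z $ j - v (fst z) $ j\<bar>)" by simp
    ultimately have "AE z in \<gamma>. \<bar>snd z $ j - v (fst z) $ j\<bar> = 0"
      using integral_nonneg_eq_0_iff_AE[OF i3] by simp
    then show ?thesis by eventually_elim simp
  qed
  then have "AE z in \<gamma>. \<forall>j. snd z $ j = v (fst z) $ j" unfolding AE_all_countable by (rule allI)
  then have "AE z in \<gamma>. snd z = v (fst z)" by eventually_elim (simp add: vec_eq_iff)
  with r v lim show ?thesis by (rule that)
qed

section \<open>From plans carried by graphs to transport maps\<close>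

lemma plan_on_graph_induced:
  assumes \<gamma>: "\<gamma> \<in> transport_plans \<mu> \<nu>" and v: "v \<in> borel_measurable borel"
    and graph: "AE z in \<gamma>. snd z = v (fst z)"
  obtains T where "T \<in> transport_maps \<mu> \<nu>" "\<gamma> = induced_plan \<mu> \<nu> T"
proof -
  obtain y0 where y0: "y0 \<in> \<Omega>'" using \<Omega>'(2) by blast
  \<comment> \<open>A transport map must send every point into \<Omega>', while v does so only
    almost everywhere; \<open>y0\<close> repairs the exceptional points.\<close>
  define T where "T x = (if v x \<in> \<Omega>' then v x else y0)" for x
  have [measurable]: "\<Omega>' \<in> sets borel" using \<Omega>'(1) by simp
  have "T \<in> borel_measurable borel" unfolding T_def[abs_def] using v by measurable
  then have "T \<in> measurable (lborel_on \<Omega>) (lborel_on \<Omega>')"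
    by (intro measurable_restrict_space2 measurable_restrict_space1) (auto simp: T_def y0)
  then have T: "T \<in> measurable \<mu> \<nu>"
    by (simp add: measurable_cong_sets[OF sets_\<mu> sets_\<nu>])
  note fs = plan_measurable(1,2)[OF \<gamma>]
  have s: "sets \<gamma> = sets (\<mu> \<Otimes>\<^sub>M \<nu>)" and m: "distr \<gamma> \<mu> fst = \<mu>" "distr \<gamma> \<nu> snd = \<nu>"
    using \<gamma> by (auto simp: transport_plans_def)
  have in_\<Omega>': "AE z in \<gamma>. snd z \<in> \<Omega>'" by (rule AE_I2) (auto simp: plan_measurable(5)[OF \<gamma>])
  have eq: "AE z in \<gamma>. T (fst z) = snd z"
    using graph in_\<Omega>' by eventually_elim (simp add: T_def)
  have Tf: "(\<lambda>z. T (fst z)) \<in> measurable \<gamma> \<nu>" by (rule measurable_compose[OF fs(1) T])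
  have pair: "(\<lambda>x. (x, T x)) \<in> measurable \<mu> (\<mu> \<Otimes>\<^sub>M \<nu>)" using T by simp
  show ?thesis
  proof (rule that)
    have "distr \<mu> \<nu> T = distr (distr \<gamma> \<mu> fst) \<nu> T" by (simp add: m)
    also have "\<dots> = distr \<gamma> \<nu> (\<lambda>z. T (fst z))" using distr_distr[OF T fs(1)] by (simp add: comp_def)
    also have "\<dots> = distr \<gamma> \<nu> snd" by (rule distr_cong_AE[OF refl refl eq Tf fs(2)])
    finally show "T \<in> transport_maps \<mu> \<nu>" using T m by (simp add: transport_maps_def)
    have "induced_plan \<mu> \<nu> T = distr (distr \<gamma> \<mu> fst) (\<mu> \<Otimes>\<^sub>M \<nu>) (\<lambda>x. (x, T x))"
      by (simp add: induced_plan_def m)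
    also have "\<dots> = distr \<gamma> (\<mu> \<Otimes>\<^sub>M \<nu>) (\<lambda>z. (fst z, T (fst z)))"
      using distr_distr[OF pair fs(1)] by (simp add: comp_def)
    also have "\<dots> = distr \<gamma> (\<mu> \<Otimes>\<^sub>M \<nu>) (\<lambda>z. z)"
    proof (rule distr_cong_AE[OF refl refl])
      show "AE z in \<gamma>. (fst z, T (fst z)) = z" using eq by eventually_elim (simp add: prod_eq_iff)
      show "(\<lambda>z. (fst z, T (fst z))) \<in> measurable \<gamma> (\<mu> \<Otimes>\<^sub>M \<nu>)" using fs(1) Tf by (rule measurable_Pair)
      show "(\<lambda>z. z) \<in> measurable \<gamma> (\<mu> \<Otimes>\<^sub>M \<nu>)" by (simp add: measurable_cong_sets[OF s refl])
    qed
    also have "\<dots> = \<gamma>" by (rule distr_id2[OF s[symmetric]])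
    finally show "\<gamma> = induced_plan \<mu> \<nu> T" ..
  qed
qed

lemma induced_plan_graph_AE:
  assumes T: "T \<in> transport_maps \<mu> \<nu>" and v: "v \<in> borel_measurable borel"
    and graph: "AE z in induced_plan \<mu> \<nu> T. snd z = v (fst z)"
  shows "AE x in \<mu>. T x = v x"
proof -
  have pair: "(\<lambda>x. (x, T x)) \<in> measurable \<mu> (\<mu> \<Otimes>\<^sub>M \<nu>)" using T by (intro measurable_Pair) (simp_all add: transport_maps_def)
  have [measurable]: "(\<lambda>z. snd z) \<in> measurable (\<mu> \<Otimes>\<^sub>M \<nu>) (borel :: (real^'d) measure)"
    "(\<lambda>z. v (fst z)) \<in> borel_measurable (\<mu> \<Otimes>\<^sub>M \<nu>)"
    by (rule measurable_compose[OF measurable_snd measurable_\<nu>], simp)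
      (rule measurable_compose[OF measurable_fst measurable_\<mu>[OF v]])
  have "{z \<in> space (\<mu> \<Otimes>\<^sub>M \<nu>). snd z = v (fst z)} \<in> sets (\<mu> \<Otimes>\<^sub>M \<nu>)" by measurable
  from AE_distr_iff[OF pair this] show ?thesis using graph[unfolded induced_plan_def] by simp
qed

text \<open>The second conclusion covers every map inducing \<gamma>, because
  \<open>on_plans\<close> evaluates a functional at an unspecified one.\<close>

lemma transport_compactness:
  assumes T: "\<And>k. T k \<in> transport_maps \<mu> \<nu>" "\<And>k. T k \<in> H1 \<Omega>" and \<gamma>: "\<gamma> \<in> transport_plans \<mu> \<nu>"
    and conv: "weakly_converges (\<Omega> \<times> \<Omega>') (\<lambda>k. induced_plan \<mu> \<nu> (T k)) \<gamma>"
    and K: "\<And>k. dirichlet \<Omega> (T k) \<le> K"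
    and cost: "(\<lambda>k. transport_cost \<mu> (T k)) \<longlonglongrightarrow> C"
  shows "\<exists>S\<in>transport_maps \<mu> \<nu>. \<gamma> = induced_plan \<mu> \<nu> S"
    and "\<And>S. S \<in> transport_maps \<mu> \<nu> \<Longrightarrow> \<gamma> = induced_plan \<mu> \<nu> S \<Longrightarrow>
      S \<in> H1 \<Omega> \<and> dirichlet \<Omega> S \<le> K \<and> transport_cost \<mu> S = C"
proof -
  have "\<exists>G. L2_on \<Omega> G \<and> has_weak_deriv \<Omega> (T k) G" for k using T(2)[of k] by (simp add: H1_def)
  then obtain G where G: "\<And>k. L2_on \<Omega> (G k)" "\<And>k. has_weak_deriv \<Omega> (T k) (G k)" by metis
  have GK: "(LINT x|lborel_on \<Omega>. (norm (G k x))\<^sup>2) \<le> K" for k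
    using K[of k] dirichlet_eq[OF \<Omega>(1,2) G] by simp
  obtain r v where r: "strict_mono (r :: nat \<Rightarrow> nat)" and v: "v \<in> borel_measurable borel"
    and lim: "AE x in lborel_on \<Omega>. (\<lambda>n. T (r n) x) \<longlonglongrightarrow> v x" and graph: "AE z in \<gamma>. snd z = v (fst z)"
    by (rule transport_maps_limit[OF T(1) \<gamma> conv G GK]) blast
  show "\<exists>S\<in>transport_maps \<mu> \<nu>. \<gamma> = induced_plan \<mu> \<nu> S"
    by (rule plan_on_graph_induced[OF \<gamma> v graph]) blast
  fix S assume S: "S \<in> transport_maps \<mu> \<nu>" "\<gamma> = induced_plan \<mu> \<nu> S"
  \<comment> \<open>The graph property of \<gamma> forces any representative to agree almost
    everywhere with the strong limit v.\<close>
  have Sv: "AE x in lborel_on \<Omega>. S x = v x"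
    using induced_plan_graph_AE[OF S(1) v] graph unfolding S(2) AE_\<mu>_iff by blast
  have limS: "AE x in lborel_on \<Omega>. (\<lambda>n. T (r n) x) \<longlonglongrightarrow> S x"
    using lim Sv by eventually_elim simp
  have diff_meas: "(\<lambda>x. norm (T k x - S x)) \<in> borel_measurable (lborel_on \<Omega>)" for k
    by (intro measurable_compose[OF borel_measurable_diff borel_measurable_norm] transport_map_measurable(2) T S)
  have cost_meas: "(\<lambda>x. norm (Q x - x)) \<in> borel_measurable \<mu>" if "Q \<in> transport_maps \<mu> \<nu>" for Q
    by (intro measurable_compose[OF borel_measurable_diff borel_measurable_norm] transport_map_measurable(1)[OF that]
        measurable_\<mu>[of "\<lambda>x. x"]) simp
  note RT = transport_map_measurable(4)[OF T(1)] and RS = transport_map_measurable(4)[OF S(1)]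
  have "(\<lambda>n. LINT x|lborel_on \<Omega>. norm (T (r n) x - S x)) \<longlonglongrightarrow> (LINT x|lborel_on \<Omega>. 0)"
  proof (rule integral_dominated_convergence[where w = "\<lambda>_. R + R"])
    show "AE x in lborel_on \<Omega>. (\<lambda>n. norm (T (r n) x - S x)) \<longlonglongrightarrow> 0"
      using limS by eventually_elim (simp add: LIM_zero tendsto_norm_zero)
    show "AE x in lborel_on \<Omega>. norm (norm (T (r n) x - S x)) \<le> R + R" for n
    proof (rule AE_I2)
      fix x assume "x \<in> space (lborel_on \<Omega>)"
      then have "x \<in> \<Omega>" by (simp add: space_restrict_space)
      then show "norm (norm (T (r n) x - S x)) \<le> R + R"
        using norm_triangle_ineq4[of "T (r n) x" "S x"] RT[of x "r n"] RS[of x] by simp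
    qed
  qed (rule diff_meas | simp)+
  then have L1: "(\<lambda>n. LINT x|lborel_on \<Omega>. norm (T (r n) x - S x)) \<longlonglongrightarrow> 0" by simp
  obtain G0 where G0: "L2_on \<Omega> G0" "has_weak_deriv \<Omega> S G0" "(LINT x|lborel_on \<Omega>. (norm (G0 x))\<^sup>2) \<le> K"
    by (rule weak_deriv_compact[OF \<Omega>(1,2) G(2) transport_map_L2(1)[OF T(1)] transport_map_L2(1)[OF S(1)] G(1) GK L1]) blast
  have "S \<in> H1 \<Omega>"
    using G0 transport_map_L2(2)[OF S(1)] transport_map_measurable(2)[OF S(1)]
    by (auto simp: H1_def L2_on_iff[OF \<Omega>(1)])
  moreover have "dirichlet \<Omega> S \<le> K" using dirichlet_eq[OF \<Omega>(1,2) G0(1,2)] G0(3) by simp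
  moreover have "transport_cost \<mu> S = C"
  proof (rule LIMSEQ_unique)
    show "(\<lambda>n. transport_cost \<mu> (T (r n))) \<longlonglongrightarrow> C"
      using LIMSEQ_subseq_LIMSEQ[OF cost r] by (simp add: comp_def)
    obtain D where D: "\<And>x. x \<in> \<Omega> \<Longrightarrow> norm x \<le> D" using \<Omega>(2) unfolding bounded_iff by blast
    show "(\<lambda>n. transport_cost \<mu> (T (r n))) \<longlonglongrightarrow> transport_cost \<mu> S"
      unfolding transport_cost_def
    proof (rule integral_dominated_convergence[where w = "\<lambda>_. R + D"])
      show "AE x in \<mu>. (\<lambda>n. norm (T (r n) x - x)) \<longlonglongrightarrow> norm (S x - x)"
        unfolding AE_\<mu>_iff using limS by eventually_elim (intro tendsto_intros)
      show "AE x in \<mu>. norm (norm (T (r n) x - x)) \<le> R + D" for n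
      proof (rule AE_I2)
        fix x assume "x \<in> space \<mu>"
        then have "x \<in> \<Omega>" by (simp add: space_\<mu>)
        then show "norm (norm (T (r n) x - x)) \<le> R + D"
          using norm_triangle_ineq4[of "T (r n) x" x] RT[of x "r n"] D[of x] by simp
      qed
    qed (rule cost_meas[OF T(1)] cost_meas[OF S(1)] | simp)+
  qed
  ultimately show "S \<in> H1 \<Omega> \<and> dirichlet \<Omega> S \<le> K \<and> transport_cost \<mu> S = C" by blast
qed

end

section \<open>The renormalised functionals and the two inequalities\<close>

lemma on_plans_representative:
  assumes "\<exists>T\<in>transport_maps \<mu> \<nu>. \<gamma> = induced_plan \<mu> \<nu> T"
  obtains T where "T \<in> transport_maps \<mu> \<nu>" "\<gamma> = induced_plan \<mu> \<nu> T" "\<And>F. on_plans \<mu> \<nu> F \<gamma> = F T"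
proof -
  define T where "T = (SOME T. T \<in> transport_maps \<mu> \<nu> \<and> \<gamma> = induced_plan \<mu> \<nu> T)"
  have "\<exists>T. T \<in> transport_maps \<mu> \<nu> \<and> \<gamma> = induced_plan \<mu> \<nu> T" using assms by blast
  from someI_ex[OF this] have "T \<in> transport_maps \<mu> \<nu> \<and> \<gamma> = induced_plan \<mu> \<nu> T" unfolding T_def .
  moreover have "on_plans \<mu> \<nu> F \<gamma> = F T" for F
    unfolding on_plans_def T_def using assms by (rule if_P)
  ultimately show ?thesis using that by blast
qed

lemma on_plans_not_induced:
  "\<not> (\<exists>T\<in>transport_maps \<mu> \<nu>. \<gamma> = induced_plan \<mu> \<nu> T) \<Longrightarrow> on_plans \<mu> \<nu> F \<gamma> = \<infinity>"
  unfolding on_plans_def by (rule if_not_P)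

text \<open>An infinite value stays infinite after subtracting a real and dividing by a positive
  number, so a finite bound forces the plan to come from an admissible map.\<close>

lemma renormalised_cost_less_imp:
  fixes \<Omega> :: "(real^'d) set"
  assumes \<epsilon>: "0 < \<epsilon>" and less: "(on_plans \<mu> \<nu> (J \<Omega> \<mu> \<nu> \<epsilon>) \<gamma> - ereal (W1 \<mu> \<nu>)) / ereal \<epsilon> < ereal C"
  obtains T where "T \<in> H1 \<Omega> \<inter> transport_maps \<mu> \<nu>" "\<gamma> = induced_plan \<mu> \<nu> T"
    "transport_cost \<mu> T + \<epsilon> * dirichlet \<Omega> T \<le> W1 \<mu> \<nu> + C * \<epsilon>"
proof -
  have fin: "on_plans \<mu> \<nu> (J \<Omega> \<mu> \<nu> \<epsilon>) \<gamma> \<noteq> \<infinity>" using less \<epsilon> by auto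
  then have "\<exists>T\<in>transport_maps \<mu> \<nu>. \<gamma> = induced_plan \<mu> \<nu> T" using on_plans_not_induced by blast
  then obtain T where T: "T \<in> transport_maps \<mu> \<nu>" "\<gamma> = induced_plan \<mu> \<nu> T"
    and J: "\<And>F. on_plans \<mu> \<nu> F \<gamma> = F T" by (rule on_plans_representative) blast
  have T': "T \<in> H1 \<Omega> \<inter> transport_maps \<mu> \<nu>" using fin unfolding J by (auto simp: J_def split: if_splits)
  have "ereal ((transport_cost \<mu> T + \<epsilon> * dirichlet \<Omega> T - W1 \<mu> \<nu>) / \<epsilon>) < ereal C"
    using less T' \<epsilon> unfolding J by (simp add: J_def)
  then have "transport_cost \<mu> T + \<epsilon> * dirichlet \<Omega> T - W1 \<mu> \<nu> < C * \<epsilon>"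
    using \<epsilon> by (simp add: pos_divide_less_eq)
  then show ?thesis using that[OF T' T(2)] by simp
qed

lemma W1_le_transport_cost: "T \<in> transport_maps \<mu> \<nu> \<Longrightarrow> W1 \<mu> \<nu> \<le> transport_cost \<mu> T"
  unfolding W1_def by (rule cINF_lower) (auto intro!: bdd_belowI2[of _ 0] simp: transport_cost_def)

lemma dirichlet_nonneg: "0 \<le> dirichlet \<Omega> T"
  unfolding dirichlet_def set_lebesgue_integral_def by (intro integral_nonneg_AE AE_I2) simp

lemma renormalised_cost_at_minimiser:
  assumes "T \<in> O1 \<mu> \<nu> \<inter> H1 \<Omega>" and \<epsilon>: "0 < \<epsilon>"
  shows "(J \<Omega> \<mu> \<nu> \<epsilon> T - ereal (W1 \<mu> \<nu>)) / ereal \<epsilon> = ereal (dirichlet \<Omega> T)"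
  using assms by (simp add: J_def O1_def)

text \<open>One representative evaluates both functionals. At a minimiser in
  \<open>H1 \<Omega>\<close> the sequence of quotients is constant; in all other cases the
  right-hand side is infinite.\<close>

lemma gamma_limsup:
  fixes \<Omega> :: "(real^'d) set"
  assumes \<epsilon>: "\<And>n. 0 < \<epsilon> n"
  shows "limsup (\<lambda>n. (on_plans \<mu> \<nu> (J \<Omega> \<mu> \<nu> (\<epsilon> n)) \<gamma> - ereal (W1 \<mu> \<nu>)) / ereal (\<epsilon> n))
    \<le> on_plans \<mu> \<nu> (H_limit \<Omega> \<mu> \<nu>) \<gamma>"
proof (cases "\<exists>T\<in>transport_maps \<mu> \<nu>. \<gamma> = induced_plan \<mu> \<nu> T")
  case True
  then obtain T where on: "\<And>F. on_plans \<mu> \<nu> F \<gamma> = F T" by (rule on_plans_representative) blast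
  show ?thesis
  proof (cases "T \<in> O1 \<mu> \<nu> \<inter> H1 \<Omega>")
    case opt: True
    show ?thesis
      unfolding on renormalised_cost_at_minimiser[OF opt \<epsilon>] using opt
      by (simp add: H_limit_def Limsup_const)
  qed (auto simp: on H_limit_def)
qed (simp add: on_plans_not_induced)

context density_transport
begin

text \<open>If the inequality failed, a real C would lie strictly between its sides and infinitely
  many quotients would be below C. Compactness along that subsequence gives a minimiser of energy at
  most C inducing \<gamma>, a contradiction.\<close>

lemma gamma_liminf:
  assumes \<epsilon>: "\<And>n. 0 < \<epsilon> n" "\<epsilon> \<longlonglongrightarrow> 0" and \<gamma>: "\<gamma> \<in> transport_plans \<mu> \<nu>"
    and conv: "weakly_converges (\<Omega> \<times> \<Omega>') \<gamma>s \<gamma>"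
  shows "on_plans \<mu> \<nu> (H_limit \<Omega> \<mu> \<nu>) \<gamma>
    \<le> liminf (\<lambda>n. (on_plans \<mu> \<nu> (J \<Omega> \<mu> \<nu> (\<epsilon> n)) (\<gamma>s n) - ereal (W1 \<mu> \<nu>)) / ereal (\<epsilon> n))"
    (is "?H \<le> liminf ?F")
proof (rule ccontr)
  assume "\<not> ?thesis"
  then obtain C where C: "liminf ?F < ereal C" "ereal C < ?H"
    using ereal_dense2[of "liminf ?F" ?H] by (auto simp: not_le)
  have "frequently (\<lambda>n. ?F n < ereal C) sequentially"
  proof (rule ccontr)
    assume "\<not> frequently (\<lambda>n. ?F n < ereal C) sequentially"
    then have "eventually (\<lambda>n. ereal C \<le> ?F n) sequentially" by (simp add: not_frequently not_less)
    from Liminf_bounded[OF this] C(1) show False by simp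
  qed
  then have "infinite {n. ?F n < ereal C}"
    by (simp add: frequently_cofinite flip: cofinite_eq_sequentially)
  then obtain s :: "nat \<Rightarrow> nat" where s: "strict_mono s" "\<And>k. ?F (s k) < ereal C"
    using infinite_enumerate[of "{n. ?F n < ereal C}"] by auto
  have "\<exists>T. T \<in> H1 \<Omega> \<inter> transport_maps \<mu> \<nu> \<and> \<gamma>s (s k) = induced_plan \<mu> \<nu> T \<and>
      transport_cost \<mu> T + \<epsilon> (s k) * dirichlet \<Omega> T \<le> W1 \<mu> \<nu> + C * \<epsilon> (s k)" for k
    by (rule renormalised_cost_less_imp[OF \<epsilon>(1) s(2)[of k]]) blast
  then obtain T where T: "\<And>k. T k \<in> H1 \<Omega>" "\<And>k. T k \<in> transport_maps \<mu> \<nu>"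
    "\<And>k. \<gamma>s (s k) = induced_plan \<mu> \<nu> (T k)"
    "\<And>k. transport_cost \<mu> (T k) + \<epsilon> (s k) * dirichlet \<Omega> (T k) \<le> W1 \<mu> \<nu> + C * \<epsilon> (s k)"
    by (metis IntE)
  \<comment> \<open>The cost is at least \<open>W1\<close>, so it can be cancelled, and division by
    \<open>\<epsilon> (s k)\<close> leaves the energy bound.\<close>
  have dir: "dirichlet \<Omega> (T k) \<le> C" for k
  proof -
    have "\<epsilon> (s k) * dirichlet \<Omega> (T k) \<le> \<epsilon> (s k) * C"
      using T(4)[of k] W1_le_transport_cost[OF T(2)[of k]] by (simp add: mult.commute)
    then show ?thesis using \<epsilon>(1)[of "s k"] by simp
  qed
  have \<epsilon>s: "(\<lambda>k. \<epsilon> (s k)) \<longlonglongrightarrow> 0" using LIMSEQ_subseq_LIMSEQ[OF \<epsilon>(2) s(1)] by (simp add: comp_def)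
  have cost: "(\<lambda>k. transport_cost \<mu> (T k)) \<longlonglongrightarrow> W1 \<mu> \<nu>"
  proof (rule tendsto_sandwich[OF _ _ tendsto_const])
    show "eventually (\<lambda>k. W1 \<mu> \<nu> \<le> transport_cost \<mu> (T k)) sequentially"
      using W1_le_transport_cost[OF T(2)] by simp
    have "transport_cost \<mu> (T k) \<le> W1 \<mu> \<nu> + C * \<epsilon> (s k)" for k
      using T(4)[of k] mult_nonneg_nonneg[OF less_imp_le[OF \<epsilon>(1)[of "s k"]] dirichlet_nonneg[of \<Omega> "T k"]]
      by linarith
    then show "eventually (\<lambda>k. transport_cost \<mu> (T k) \<le> W1 \<mu> \<nu> + C * \<epsilon> (s k)) sequentially" by simp
    have "(\<lambda>k. W1 \<mu> \<nu> + C * \<epsilon> (s k)) \<longlonglongrightarrow> W1 \<mu> \<nu> + C * 0" by (intro tendsto_intros \<epsilon>s)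
    then show "(\<lambda>k. W1 \<mu> \<nu> + C * \<epsilon> (s k)) \<longlonglongrightarrow> W1 \<mu> \<nu>" by simp
  qed
  have conv_T: "weakly_converges (\<Omega> \<times> \<Omega>') (\<lambda>k. induced_plan \<mu> \<nu> (T k)) \<gamma>"
    unfolding weakly_converges_def T(3)[symmetric]
  proof (intro allI impI)
    fix \<phi> :: "(real^'d) \<times> (real^'d) \<Rightarrow> real"
    assume "continuous_on (\<Omega> \<times> \<Omega>') \<phi> \<and> bounded (\<phi> ` (\<Omega> \<times> \<Omega>'))"
    then have "(\<lambda>n. LINT z|\<gamma>s n. \<phi> z) \<longlonglongrightarrow> (LINT z|\<gamma>. \<phi> z)"
      using conv unfolding weakly_converges_def by blast
    from LIMSEQ_subseq_LIMSEQ[OF this s(1)] show "(\<lambda>k. LINT z|\<gamma>s (s k). \<phi> z) \<longlonglongrightarrow> (LINT z|\<gamma>. \<phi> z)"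
      by (simp add: comp_def)
  qed
  note compact = transport_compactness[OF T(2,1) \<gamma> conv_T dir cost]
  obtain S where S: "S \<in> transport_maps \<mu> \<nu>" "\<gamma> = induced_plan \<mu> \<nu> S"
    and H: "\<And>F. on_plans \<mu> \<nu> F \<gamma> = F S" by (rule on_plans_representative[OF compact(1)]) blast
  have "S \<in> H1 \<Omega> \<and> dirichlet \<Omega> S \<le> C \<and> transport_cost \<mu> S = W1 \<mu> \<nu>"
    using compact(2)[OF S] .
  then have "?H \<le> ereal C" unfolding H using S by (simp add: H_limit_def O1_def)
  then show False using C(2) by simp
qed

end

theorem proposition3p2:
  fixes \<Omega> \<Omega>' :: "(real^'d) set"
    and \<mu> \<nu> :: "(real^'d) measure"
    and f g :: "real^'d \<Rightarrow> real"
  assumes "open \<Omega>" "connected \<Omega>" "\<Omega> \<noteq> {}" "bounded \<Omega>" "lipschitz_boundary \<Omega>"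
    and "open \<Omega>'" "connected \<Omega>'" "\<Omega>' \<noteq> {}" "bounded \<Omega>'"
    and "prob_space \<mu>" "prob_space \<nu>"
    and "f \<in> borel_measurable (restrict_space lborel \<Omega>)"
    and "\<mu> = density (restrict_space lborel \<Omega>) (\<lambda>x. ennreal (f x))"
    and "\<exists>c>0. AE x in restrict_space lborel \<Omega>. c \<le> f x"
    and "g \<in> borel_measurable (restrict_space lborel \<Omega>')"
    and "\<nu> = density (restrict_space lborel \<Omega>') (\<lambda>x. ennreal (g x))"
    and "\<exists>c>0. AE x in restrict_space lborel \<Omega>'. c \<le> g x"
    and "H1 \<Omega> \<inter> transport_maps \<mu> \<nu> \<noteq> {}"
  shows "gamma_converges (transport_plans \<mu> \<nu>) (weakly_converges (\<Omega> \<times> \<Omega>'))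
           (\<lambda>\<epsilon> \<gamma>. (on_plans \<mu> \<nu> (J \<Omega> \<mu> \<nu> \<epsilon>) \<gamma> - ereal (W1 \<mu> \<nu>)) / ereal \<epsilon>)
           (on_plans \<mu> \<nu> (H_limit \<Omega> \<mu> \<nu>))"
proof -
  obtain c where c: "0 < c" "AE x in lborel_on \<Omega>. c \<le> f x" using assms by blast
  obtain R where R: "\<And>y. y \<in> \<Omega>' \<Longrightarrow> norm y \<le> R" using \<open>bounded \<Omega>'\<close> unfolding bounded_iff by blast
  have sets_\<nu>: "sets \<nu> = sets (lborel_on \<Omega>')"
    using \<open>\<nu> = density (restrict_space lborel \<Omega>') (\<lambda>x. ennreal (g x))\<close> by simp
  interpret density_transport \<Omega> \<Omega>' \<mu> \<nu> f c R
    by (rule density_transport.intro) (fact assms c R sets_\<nu>)+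
  show ?thesis
    unfolding gamma_converges_def
  proof (intro allI impI ballI conjI)
    fix \<epsilon> :: "nat \<Rightarrow> real" and \<gamma>
    assume \<epsilon>: "(\<forall>n. 0 < \<epsilon> n) \<and> \<epsilon> \<longlonglongrightarrow> 0" and \<gamma>: "\<gamma> \<in> transport_plans \<mu> \<nu>"
    show "on_plans \<mu> \<nu> (H_limit \<Omega> \<mu> \<nu>) \<gamma>
        \<le> liminf (\<lambda>n. (on_plans \<mu> \<nu> (J \<Omega> \<mu> \<nu> (\<epsilon> n)) (\<gamma>s n) - ereal (W1 \<mu> \<nu>)) / ereal (\<epsilon> n))"
      if "(\<forall>n. \<gamma>s n \<in> transport_plans \<mu> \<nu>) \<and> weakly_converges (\<Omega> \<times> \<Omega>') \<gamma>s \<gamma>" for \<gamma>s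
      using gamma_liminf \<epsilon> \<gamma> that by blast
    show "\<exists>\<gamma>s. (\<forall>n. \<gamma>s n \<in> transport_plans \<mu> \<nu>) \<and> weakly_converges (\<Omega> \<times> \<Omega>') \<gamma>s \<gamma> \<and>
        limsup (\<lambda>n. (on_plans \<mu> \<nu> (J \<Omega> \<mu> \<nu> (\<epsilon> n)) (\<gamma>s n) - ereal (W1 \<mu> \<nu>)) / ereal (\<epsilon> n))
          \<le> on_plans \<mu> \<nu> (H_limit \<Omega> \<mu> \<nu>) \<gamma>"
      using \<epsilon> \<gamma> gamma_limsup[of \<epsilon>] by (intro exI[of _ "\<lambda>_. \<gamma>"]) (simp add: weakly_converges_def)
  qed
qed

end
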